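(* Every simple, pairwise intersecting arrangement of $n\ge 3$ pseudocircles has at least $2n/3$ triangles.
   Context: A pseudocircle is a simple closed curve on the sphere. An arrangement of pseudocircles is a finite collection of pseudocircles such that any two are either disjoint or intersect in exactly two points, at which they cross; it is simple if no three pseudocircles share a point, and pairwise intersecting if every two pseudocircles intersect. A triangle is a cell of the induced decomposition of the sphere with exactly $3$ crossings on its boundary. (Digons, i.e., cells with $2$ crossings on the boundary, are allowed.) *)

theory Defs
  imports "HOL-Analysis.Analysis"
begin

definition S2 :: "(real^3) set" where
  "S2 = sphere 0 1"

definition pseudocircle :: "(real^3) set \<Rightarrow> bool" where
  "pseudocircle C \<longleftrightarrow> C \<subseteq> S2 \<and>
     (\<exists>g :: real \<Rightarrow> real^3. simple_path g \<and> pathfinish g = pathstart g \<and> path_image g = C)"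

definition crosses_at :: "(real^3) set \<Rightarrow> (real^3) set \<Rightarrow> real^3 \<Rightarrow> bool" where
  "crosses_at C D p \<longleftrightarrow> p \<in> C \<and> p \<in> D \<and>
     (\<forall>e>0. \<exists>x\<in>D \<inter> ball p e - C. \<exists>y\<in>D \<inter> ball p e - C.
              \<not> connected_component (S2 - C) x y)"

definition simple_pi_arrangement :: "(real^3) set set \<Rightarrow> bool" where
  "simple_pi_arrangement A \<longleftrightarrow> finite A \<and>
     (\<forall>C\<in>A. pseudocircle C) \<and>
     (\<forall>C\<in>A. \<forall>D\<in>A. C \<noteq> D \<longrightarrow>
         card (C \<inter> D) = 2 \<and> (\<forall>p\<in>C \<inter> D. crosses_at C D p)) \<and>
     (\<forall>C\<in>A. \<forall>D\<in>A. \<forall>E\<in>A. C \<noteq> D \<and> D \<noteq> E \<and> C \<noteq> E \<longrightarrow> C \<inter> D \<inter> E = {})"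

definition crossings :: "(real^3) set set \<Rightarrow> (real^3) set" where
  "crossings A = (\<Union>C\<in>A. \<Union>D\<in>A. if C = D then {} else C \<inter> D)"

definition cells :: "(real^3) set set \<Rightarrow> (real^3) set set" where
  "cells A = components (S2 - \<Union>A)"

definition triangles :: "(real^3) set set \<Rightarrow> (real^3) set set" where
  "triangles A = {F \<in> cells A. card (closure F \<inter> crossings A) = 3}"

end

theory Submission
  imports Defs
begin

text \<open>
  Every pseudocircle $C$ is incident to two triangles; as a triangle has three crossings, each on two
  pseudocircles, at most three pseudocircles share two crossings with it, and double counting gives
  $2n \le 3 p_3$.

  Since $n \ge 3$, some side $D$ of $C$ has the property that every pseudocircle crosses another one
  inside $D$. Each other pseudocircle meets $D$ in one arc. Call the cyclic order of the endpoints
  on $C$ ``leftwards''. From an endpoint $x$ follow its arc to the first crossing $q_x$, with the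
  pseudocircle $g_x$, and let $K_x$ be the leftward interval from $x$ to the second end of $g_x$.
  By induction on $K_x$ one finds two neighbouring endpoints in $K_x$ with the same first crossing;
  with it they span a triangle. Applying this to $x$, and then to the left base point of the triangle
  found, gives two triangles. In the induction step one takes the leftmost endpoint $w$ in $K_x$ over
  whose corner region (bounded by the arc of $w$ up to $q_w$ and by $g_w$ down to its near end) no
  blocking arc makes a hump; any obstruction to $w$ spanning a triangle yields either a blocking arc
  with both ends further left in $K_x$, so that the induction hypothesis applies, or a better choice
  of $w$.
\<close>

subsection \<open>Jordan curves and crosscuts on the sphere\<close>

text \<open>A blocking arc helps the induction only if both its ends lie in $K_x$ and left of the
  endpoint \<open>v\<close> that it blocks; with one end elsewhere it gives nothing. This obstacle
  explains the choice of \<open>w\<close>. Humps over the corner of \<open>x\<close> itself are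
  harmless: their ends lie between the two ends of \<open>g x\<close>, hence in $K_x$, so
  \<open>x\<close> qualifies and a leftmost \<open>w\<close> exists. From \<open>q v\<close> the
  blocker of an endpoint \<open>v\<close> under the corner of \<open>w\<close> is followed in both
  directions. A branch that avoids \<open>g w\<close> is trapped and returns to the base; two
  branches that meet \<open>g w\<close> form a hump. What remains is \<open>g v = g w\<close>, or
  one trapped branch and one that leaves through \<open>g w\<close>; the leftmost such
  \<open>v\<close> is a better choice of \<open>w\<close>. Crossing is a local condition, and order
  is only known along curves. All planarity comes from one fact: a crosscut of a Jordan domain
  separates the two boundary arcs between its ends. It is applied to \<open>D\<close> and to the
  sides of other pseudocircles.\<close>

lemma punctured_sphere_homeomorphism:
  assumes "p \<in> S2"
  obtains h k where "homeomorphism (S2 - {p}) (UNIV :: complex set) h k"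
proof -
  have "(rel_frontier (cball (0::real^3) 1) - {p}) homeomorphic (UNIV :: complex set)"
    by (rule homeomorphic_punctured_sphere_affine_gen)
      (use assms in \<open>auto simp: S2_def rel_frontier_cball aff_dim_cball\<close>)
  then show thesis
    using that by (auto simp: S2_def rel_frontier_cball homeomorphic_def)
qed

text \<open>A connected set that contains one piece and meets the other would be split by their
  relatively open traces, so each piece is a maximal connected subset.\<close>

lemma components_pair:
  assumes "U \<union> V = S" "U \<inter> V = {}" "U \<noteq> {}" "V \<noteq> {}" "connected U" "connected V"
    and oU: "openin (top_of_set S) U" and oV: "openin (top_of_set S) V"
  shows "components S = {U, V}"
proof -
  have max: "d = A" if d: "d \<subseteq> S" "A \<subseteq> d" "connected d" and A: "A \<noteq> {}" "A \<union> B = S" "A \<inter> B = {}"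
      "openin (top_of_set S) A" "openin (top_of_set S) B" for A B d
  proof -
    have "openin (top_of_set d) (d \<inter> A)" "openin (top_of_set d) (d \<inter> B)"
      using openin_subtopology_Int2[OF A(4), of d] openin_subtopology_Int2[OF A(5), of d] d(1)
      by (auto simp: subtopology_subtopology Int_absorb1)
    moreover have "d \<subseteq> d \<inter> A \<union> d \<inter> B" "(d \<inter> A) \<inter> (d \<inter> B) = {}" "d \<inter> A \<noteq> {}"
      using d A by auto
    ultimately have "d \<inter> B = {}"
      using \<open>connected d\<close> unfolding connected_openin by metis
    then show ?thesis using d A(2) by blast
  qed
  have "U \<in> components S"
    unfolding in_components_maximal using assms(1,3,5) max[of _ U V] assms(1-4) oU oV by (metis sup_ge1)
  moreover have "V \<in> components S"
    unfolding in_components_maximal using assms(1,4,6) max[of _ V U] assms(1-4) oU oV by (metis Un_commute Int_commute sup_ge1)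
  moreover have "W = U \<or> W = V" if "W \<in> components S" for W
  proof -
    obtain x where "x \<in> W" using in_components_nonempty \<open>W \<in> components S\<close> by blast
    then have "x \<in> U \<or> x \<in> V" using in_components_subset that assms(1) by blast
    then show ?thesis
      using components_eq \<open>U \<in> components S\<close> \<open>V \<in> components S\<close> that \<open>x \<in> W\<close> by blast
  qed
  ultimately show ?thesis by blast
qed

text \<open>The planar Jordan curve theorem, carried over with \<open>p\<close> playing the role of
  infinity: the unbounded region receives \<open>p\<close> as an extra point.\<close>

lemma punctured_jordan_components:
  assumes g: "simple_path g" "pathfinish g = pathstart g" "path_image g = F" "F \<subseteq> S2"
    and p: "p \<in> S2 - F" and hom: "homeomorphism (S2 - {p}) (UNIV :: complex set) h k"
  shows "components (S2 - F) = {k ` inside (h ` F), insert p (k ` outside (h ` F))}"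
    and "p \<notin> k ` inside (h ` F)"
proof -
  let ?J = "h ` F"
  let ?U = "k ` inside ?J" and ?V = "insert p (k ` outside ?J)"
  have FS: "F \<subseteq> S2 - {p}" using g p by auto
  have ch: "continuous_on (S2 - {p}) h" and ck: "continuous_on UNIV k"
    and kh: "\<And>x. x \<in> S2 - {p} \<Longrightarrow> k (h x) = x" and hk: "\<And>z. h (k z) = z"
    and ki: "range k = S2 - {p}"
    using hom by (auto simp: homeomorphism_def)
  have ih: "inj_on h (S2 - {p})" using kh by (metis inj_onI)
  have J: "?J = path_image (h \<circ> g)" using g by (simp add: path_image_compose)
  have s: "simple_path (h \<circ> g)"
    using g FS ch ih by (intro simple_path_continuous_image) (auto intro: continuous_on_subset inj_on_subset)
  have l: "pathfinish (h \<circ> g) = pathstart (h \<circ> g)"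
    using g by (simp add: pathstart_compose pathfinish_compose)
  note jio = Jordan_inside_outside[OF s l, folded J]
  have kJ: "k ` ?J = F" using kh FS by (force simp: image_image)
  have injk: "inj k" using hk by (metis injI)
  have UV: "?U \<union> ?V = S2 - F"
  proof -
    have "k ` (inside ?J \<union> outside ?J) = k ` (- ?J)" using jio by simp
    also have "\<dots> = range k - k ` ?J" using injk by (simp add: image_set_diff Compl_eq_Diff_UNIV)
    also have "\<dots> = S2 - {p} - F" using ki kJ by auto
    finally show ?thesis using p by blast
  qed
  have pk: "p \<notin> range k" using ki by auto
  then show "p \<notin> k ` inside ?J" by blast
  have "k ` inside ?J \<inter> k ` outside ?J = {}" using jio injk by (metis image_Int image_empty)
  then have dis: "?U \<inter> ?V = {}" using pk by blast
  have cU: "connected ?U" using jio ck by (meson connected_continuous_image continuous_on_subset subset_UNIV)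
  have cO: "connected (k ` outside ?J)" using jio ck by (meson connected_continuous_image continuous_on_subset subset_UNIV)
  have S2c: "compact S2" by (simp add: S2_def)
  \<comment> \<open>Otherwise \<open>outside ?J\<close> would lie in the image of a compact set that
    misses a ball around \<open>p\<close>, and be bounded. As a limit point, \<open>p\<close> can be
    added without losing connectedness.\<close>
  have "p \<in> closure (k ` outside ?J)"
  proof (rule ccontr)
    assume "p \<notin> closure (k ` outside ?J)"
    then obtain e where e: "e > 0" "\<forall>y\<in>k ` outside ?J. dist y p \<ge> e"
      by (metis closure_approachable not_le)
    then have sub: "k ` outside ?J \<subseteq> S2 - ball p e" using ki by (auto simp: dist_commute)
    have "compact (S2 - ball p e)" using S2c by (simp add: compact_diff)
    then have "compact (h ` (S2 - ball p e))"
      by (rule compact_continuous_image[rotated]) (rule continuous_on_subset[OF ch], use e in auto)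
    moreover have "outside ?J \<subseteq> h ` (S2 - ball p e)"
      using image_mono[OF sub, of h] hk by (auto simp: image_image)
    ultimately have "bounded (outside ?J)" by (meson bounded_subset compact_imp_bounded)
    then show False using jio by simp
  qed
  then have cV: "connected ?V"
    by (intro connected_intermediate_closure[OF cO]) (use closure_subset[of "k ` outside ?J"] in auto)
  have "openin (top_of_set (S2 - {p})) ?U"
    by (rule homeomorphism_imp_open_map[of UNIV _ k h]) (use hom jio homeomorphism_sym in auto)
  then have "openin (top_of_set S2) ?U"
    by (rule openin_trans) (auto intro: openin_delete)
  then have oU: "openin (top_of_set (S2 - F)) ?U"
    by (rule openin_subset_trans) (use UV in auto)
  \<comment> \<open>Relative openness of \<open>?V\<close> is read off from its complement, since
    \<open>k\<close> does not cover a neighbourhood of \<open>p\<close>.\<close>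
  have "closure (inside ?J) = inside ?J \<union> ?J"
    using jio by (metis closure_Un_frontier)
  moreover have "compact (closure (inside ?J))" using jio by (simp add: compact_closure)
  ultimately have "compact (k ` (inside ?J \<union> ?J))"
    using ck by (metis compact_continuous_image continuous_on_subset subset_UNIV)
  then have "closed (?U \<union> F)" by (metis compact_imp_closed image_Un kJ)
  then have "openin (top_of_set (S2 - F)) ((S2 - F) - (?U \<union> F))"
    by (metis Diff_eq open_Compl openin_open)
  moreover have "(S2 - F) - (?U \<union> F) = ?V" using UV dis by blast
  ultimately have oV: "openin (top_of_set (S2 - F)) ?V" by simp
  show "components (S2 - F) = {?U, ?V}"
    by (rule components_pair[OF UV dis _ _ cU cV oU oV]) (use jio in simp_all)
qed

lemma jordan_two_components:
  assumes "simple_path g" "pathfinish g = pathstart g" "path_image g = F" "F \<subseteq> S2" "F \<noteq> S2"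
  obtains U V where "components (S2 - F) = {U, V}" "U \<noteq> V"
proof -
  obtain p where p: "p \<in> S2 - F" using assms by blast
  obtain h k where hom: "homeomorphism (S2 - {p}) (UNIV :: complex set) h k"
    using punctured_sphere_homeomorphism p by blast
  show thesis
    using punctured_jordan_components[OF assms(1-4) p hom] that by blast
qed


text \<open>Puncturing the sphere in the other component turns \<open>W\<close> into a bounded
  inside, to which planar results apply.\<close>

lemma jordan_component_puncture:
  assumes g: "simple_path g" "pathfinish g = pathstart g" "path_image g = F" "F \<subseteq> S2" "F \<noteq> S2"
    and W: "W \<in> components (S2 - F)"
  obtains p h k where "p \<in> S2 - F" "p \<notin> W" "homeomorphism (S2 - {p}) (UNIV :: complex set) h k"
    "W = k ` inside (h ` F)"
proof -
  obtain U V where UV: "components (S2 - F) = {U, V}" "U \<noteq> V"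
    using jordan_two_components[OF g] by blast
  then obtain W' where W': "W' \<in> components (S2 - F)" "W' \<noteq> W" by auto
  then obtain p where pW': "p \<in> W'" using in_components_nonempty by blast
  have p: "p \<in> S2 - F" "p \<notin> W"
    using W'(1) pW' in_components_subset apply blast
    using W' pW' W components_eq by blast
  obtain h k where hom: "homeomorphism (S2 - {p}) (UNIV :: complex set) h k"
    using punctured_sphere_homeomorphism p by blast
  show thesis
    using that[OF p hom] punctured_jordan_components(1)[OF g(1-4) p(1) hom] W p(2) by auto
qed

text \<open>With the puncture outside \<open>G\<close> this is the planar theta-curve lemma: a chord
  splits the inside of a closed curve. The closures are recorded because they are the closed sets
  that later disconnect other sets.\<close>

lemma crosscut_regions:
  assumes c1: "arc c1" "pathstart c1 = a" "pathfinish c1 = b"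
    and c2: "arc c2" "pathstart c2 = a" "pathfinish c2 = b"
    and c: "arc c" "pathstart c = a" "pathfinish c = b"
    and int: "path_image c1 \<inter> path_image c2 = {a,b}" "path_image c1 \<inter> path_image c = {a,b}"
      "path_image c2 \<inter> path_image c = {a,b}"
    and F: "path_image c1 \<union> path_image c2 = F" "F \<subseteq> S2" "F \<noteq> S2"
    and G: "G \<in> components (S2 - F)" "path_image c - {a,b} \<subseteq> G"
  obtains I1 I2 where "connected I1" "I1 \<noteq> {}" "I1 \<inter> I2 = {}"
    "I1 \<union> I2 \<union> (path_image c - {a,b}) = G"
    "closure I1 = I1 \<union> path_image c1 \<union> path_image c" "I1 \<inter> (path_image c1 \<union> path_image c) = {}"
    "closure I2 = I2 \<union> path_image c2 \<union> path_image c" "I2 \<inter> (path_image c2 \<union> path_image c) = {}"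
proof -
  have ab: "a \<noteq> b" using c1 arc_distinct_ends by metis
  define g where "g = c1 +++ reversepath c2"
  have g: "simple_path g" "pathfinish g = pathstart g" "path_image g = F"
    using c1 c2 int F by (auto simp: g_def path_image_join intro!: simple_path_join_loop arc_reversepath)
  obtain p h k where p: "p \<in> S2 - F" "p \<notin> G"
    and hom: "homeomorphism (S2 - {p}) (UNIV :: complex set) h k" and Gk: "G = k ` inside (h ` F)"
    using jordan_component_puncture[OF g F(2,3) G(1)] by metis
  have cs: "path_image c1 \<subseteq> S2 - {p}" "path_image c2 \<subseteq> S2 - {p}"
    using F p by auto
  have "path_image c \<subseteq> G \<union> {a, b}" using G by blast
  moreover have "a \<in> F" "b \<in> F" using F int by auto
  moreover have "G \<subseteq> S2" using G in_components_subset by blast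
  ultimately have csc: "path_image c \<subseteq> S2 - {p}" using F(2) p by blast
  have ch: "continuous_on (S2 - {p}) h" and ck: "continuous_on UNIV k"
    and kh: "\<And>x. x \<in> S2 - {p} \<Longrightarrow> k (h x) = x" and hk: "\<And>z. h (k z) = z"
    using hom by (auto simp: homeomorphism_def)
  have ih: "inj_on h (S2 - {p})" using kh by (metis inj_onI)
  have injk: "inj k" using hk by (metis injI)
  have arcs: "arc (h \<circ> d)" if "arc d" "path_image d \<subseteq> S2 - {p}" for d
  proof -
    have "path (h \<circ> d)"
      using that ch by (intro path_continuous_image) (auto intro: continuous_on_subset arc_imp_path)
    moreover have "inj_on (h \<circ> d) {0..1}"
      using that ih by (intro comp_inj_on) (auto simp: arc_def path_image_def intro: inj_on_subset)
    ultimately show ?thesis by (simp add: arc_def)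
  qed
  have inth: "path_image (h \<circ> d) \<inter> path_image (h \<circ> e) = {h a, h b}"
    if "path_image d \<inter> path_image e = {a, b}" "path_image d \<subseteq> S2 - {p}" "path_image e \<subseteq> S2 - {p}" for d e
    using inj_on_image_Int[OF ih that(2,3)] that(1) by (simp add: path_image_compose)
  have khi: "k ` h ` S = S" if "S \<subseteq> S2 - {p}" for S
    using kh that by (force simp: image_image)
  have hF: "h ` F = path_image (h \<circ> c1) \<union> path_image (h \<circ> c2)"
    using F by (auto simp: path_image_compose image_Un)
  have hab: "h a \<noteq> h b" using ab ih cs(1) int(1) by (auto dest: inj_onD)
  have ne: "path_image (h \<circ> c) \<inter> inside (path_image (h \<circ> c1) \<union> path_image (h \<circ> c2)) \<noteq> {}"
  proof -
    have "path_image c - {a, b} \<noteq> {}"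
      using nonempty_simple_path_endless[OF arc_imp_simple_path[OF c(1)]] c by simp
    then obtain x where x: "x \<in> path_image c" "x \<in> G" using G by blast
    then obtain z where "z \<in> inside (h ` F)" "x = k z" using Gk by blast
    then have "h x \<in> inside (h ` F)" using hk by simp
    then show ?thesis using x hF by (auto simp: path_image_compose)
  qed
  let ?I = "\<lambda>d. inside (path_image (h \<circ> d) \<union> path_image (h \<circ> c))"
  have *: "?I c1 \<inter> ?I c2 = {}"
    "?I c1 \<union> ?I c2 \<union> (path_image (h \<circ> c) - {h a,h b}) = inside (path_image (h \<circ> c1) \<union> path_image (h \<circ> c2))"
    by (rule split_inside_simple_closed_curve[of "h \<circ> c1" "h a" "h b" "h \<circ> c2" "h \<circ> c"];
        use arcs c1 c2 c cs csc int inth hab ne in \<open>auto simp: arc_imp_simple_path pathstart_compose pathfinish_compose\<close>)+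
  have cl: "connected (k ` ?I d) \<and>
      k ` ?I d \<noteq> {} \<and>
      closure (k ` ?I d)
        = k ` ?I d \<union> path_image d \<union> path_image c \<and>
      k ` ?I d \<inter> (path_image d \<union> path_image c) = {}"
    if d: "arc d" "pathstart d = a" "pathfinish d = b" "path_image d \<inter> path_image c = {a, b}"
      "path_image d \<subseteq> S2 - {p}" for d
  proof -
    define g' where "g' = (h \<circ> d) +++ reversepath (h \<circ> c)"
    have pe: "pathfinish (h \<circ> d) = pathstart (reversepath (h \<circ> c))"
      "pathfinish (reversepath (h \<circ> c)) = pathstart (h \<circ> d)"
      using d c by (auto simp: pathstart_compose pathfinish_compose)
    have "simple_path g'"
      unfolding g'_def
      using inth[OF d(4,5) csc] arcs d c csc
      by (intro simple_path_join_loop pe) (auto simp: pathstart_compose pathfinish_compose intro: arc_reversepath)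
    moreover have "pathfinish g' = pathstart g'" using pe by (simp add: g'_def)
    moreover have pg: "path_image g' = path_image (h \<circ> d) \<union> path_image (h \<circ> c)"
      using pe by (simp add: g'_def path_image_join)
    ultimately have jio: "?I d \<noteq> {}"
      "connected (?I d)"
      "bounded (?I d)"
      "frontier (?I d) = path_image (h \<circ> d) \<union> path_image (h \<circ> c)"
      using Jordan_inside_outside[of g'] by auto
    define I where "I = ?I d"
    define J where "J = path_image (h \<circ> d) \<union> path_image (h \<circ> c)"
    have kJ: "k ` J = path_image d \<union> path_image c"
      using khi[OF d(5)] khi[OF csc] by (simp add: J_def image_Un path_image_compose)
    have clI: "closure I = I \<union> J" using jio(4) by (metis closure_Un_frontier I_def J_def)
    have "closure (k ` I) = k ` closure I"
    proof
      have "compact (closure I)" using jio by (simp add: I_def compact_closure)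
      then have "compact (k ` closure I)" using ck by (metis compact_continuous_image continuous_on_subset subset_UNIV)
      then show "closure (k ` I) \<subseteq> k ` closure I"
        by (intro closure_minimal image_mono closure_subset compact_imp_closed)
      show "k ` closure I \<subseteq> closure (k ` I)"
        using closure_subset[of "k ` I"] ck by (intro image_closure_subset) (auto intro: continuous_on_subset)
    qed
    then have A: "closure (k ` I) = k ` I \<union> path_image d \<union> path_image c"
      using clI kJ by (simp add: image_Un Un_assoc)
    have "I \<inter> J = {}" using inside_no_overlap by (auto simp: I_def J_def)
    then have "k ` I \<inter> (path_image d \<union> path_image c) = {}"
      using kJ injk by (metis image_Int image_empty)
    moreover have "connected (k ` I)" using jio(2) ck
      by (metis I_def connected_continuous_image continuous_on_subset subset_UNIV)
    moreover have "k ` I \<noteq> {}" using jio(1) by (simp add: I_def)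
    ultimately show ?thesis using A by (simp add: I_def)
  qed
  show thesis
  proof (rule that[of "k ` ?I c1" "k ` ?I c2"])
    show "k ` ?I c1 \<inter> k ` ?I c2 = {}" using *(1) injk by (metis image_Int image_empty)
    have "G = k ` (?I c1 \<union> ?I c2 \<union> (path_image (h \<circ> c) - {h a, h b}))" using Gk *(2) hF by simp
    also have "\<dots> = k ` ?I c1 \<union> k ` ?I c2 \<union> (k ` h ` path_image c - {k (h a), k (h b)})"
      using injk by (simp add: image_Un image_set_diff path_image_compose)
    also have "\<dots> = k ` ?I c1 \<union> k ` ?I c2 \<union> (path_image c - {a, b})"
    proof -
      have "k (h a) = a" "k (h b) = b" using kh csc int(2) by blast+
      then show ?thesis using khi[OF csc] by simp
    qed
    finally show "k ` ?I c1 \<union> k ` ?I c2 \<union> (path_image c - {a, b}) = G" by simp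
  qed (use cl[OF c1 int(2) cs(1)] cl[OF c2 int(3) cs(2)] in auto)
qed

text \<open>\<open>P\<close> contains an arc from \<open>a\<close> to \<open>b\<close>, a crosscut
  of \<open>G\<close>. The closures of the two regions that it cuts off meet only on this arc, so
  they would disconnect \<open>S\<close>. \<open>P\<close> is a set rather than a path because it is
  later a union of pieces of several curves.\<close>

lemma crosscut_separates:
  assumes c1: "arc c1" "pathstart c1 = a" "pathfinish c1 = b"
    and c2: "arc c2" "pathstart c2 = a" "pathfinish c2 = b"
    and int: "path_image c1 \<inter> path_image c2 = {a,b}"
    and F: "path_image c1 \<union> path_image c2 = F" "F \<subseteq> S2" "F \<noteq> S2"
    and G: "G \<in> components (S2 - F)"
    and P: "path_connected P" "a \<in> P" "b \<in> P" "P \<subseteq> G \<union> {a,b}"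
    and S: "connected S" "S \<subseteq> G \<union> F" "S \<inter> P = {}"
    and s: "s \<in> S" "s \<in> path_image c1" and s': "s' \<in> S" "s' \<in> path_image c2"
  shows False
proof -
  have ab: "a \<noteq> b" using c1 arc_distinct_ends by metis
  obtain c where c: "arc c" "path_image c \<subseteq> P" "pathstart c = a" "pathfinish c = b"
    using P(1-3) ab by (metis path_connected_arcwise)
  have GF: "G \<inter> F = {}" using G in_components_subset by blast
  have cab: "a \<in> path_image c" "b \<in> path_image c" "a \<in> F" "b \<in> F" 
    using c pathstart_in_path_image pathfinish_in_path_image int F by blast+
  have pc: "path_image c \<inter> F = {a, b}" using c P GF cab by blast
  have "path_image c1 \<inter> path_image c = {a,b}" "path_image c2 \<inter> path_image c = {a,b}"
    using pc F int by blast+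
  moreover have "path_image c - {a, b} \<subseteq> G" using c P by blast
  ultimately obtain I1 I2 where I: "I1 \<inter> I2 = {}"
    "I1 \<union> I2 \<union> (path_image c - {a,b}) = G"
    "closure I1 = I1 \<union> path_image c1 \<union> path_image c" "I1 \<inter> (path_image c1 \<union> path_image c) = {}"
    "closure I2 = I2 \<union> path_image c2 \<union> path_image c" "I2 \<inter> (path_image c2 \<union> path_image c) = {}"
    using crosscut_regions[OF c1 c2 c(1,3,4) int _ _ F G] by metis
  have Sc: "S \<inter> path_image c = {}" "a \<notin> S" "b \<notin> S" using S(3) c P by auto
  have sub: "S \<subseteq> closure I1 \<union> closure I2" using S(2) I(2,3,5) F(1) by blast
  have "closure I1 \<inter> closure I2 \<inter> S = {}"
  proof -
    have "I1 \<inter> path_image c2 = {}" "I2 \<inter> path_image c1 = {}" using I(2) GF F(1) by blast+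
    moreover have "x \<notin> path_image c1 \<or> x \<notin> path_image c2" if "x \<in> S" for x
      using int Sc(2,3) that by (metis IntI insertE emptyE)
    moreover have "x \<notin> path_image c" if "x \<in> S" for x using Sc(1) that by auto
    moreover have "x \<notin> I1 \<or> x \<notin> I2" for x using I(1) by auto
    ultimately have "\<not> (x \<in> closure I1 \<and> x \<in> closure I2 \<and> x \<in> S)" for x
      unfolding I(3,5) by (metis UnE disjoint_iff)
    then show ?thesis by auto
  qed
  moreover have "closure I1 \<inter> S \<noteq> {}" "closure I2 \<inter> S \<noteq> {}" using s s' I(3,5) by blast+
  ultimately show False
    using connected_closedD[OF S(1) _ sub closed_closure closed_closure] by blast
qed

subsection \<open>One side of a pseudocircle\<close>

lemma arrangement_pseudocircle: "simple_pi_arrangement A \<Longrightarrow> E \<in> A \<Longrightarrow> pseudocircle E"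
  by (simp add: simple_pi_arrangement_def)

lemma arrangement_card_2:
  "simple_pi_arrangement A \<Longrightarrow> E \<in> A \<Longrightarrow> F \<in> A \<Longrightarrow> E \<noteq> F \<Longrightarrow> card (E \<inter> F) = 2"
  by (simp add: simple_pi_arrangement_def)

lemma arrangement_crosses:
  "simple_pi_arrangement A \<Longrightarrow> E \<in> A \<Longrightarrow> F \<in> A \<Longrightarrow> E \<noteq> F \<Longrightarrow> p \<in> E \<Longrightarrow> p \<in> F \<Longrightarrow> crosses_at E F p"
  by (simp add: simple_pi_arrangement_def)

lemma arrangement_no_triple:
  assumes "simple_pi_arrangement A" "E \<in> A" "F \<in> A" "H \<in> A" "p \<in> E" "p \<in> F" "p \<in> H"
  shows "E = F \<or> F = H \<or> E = H"
proof (rule ccontr)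
  assume "\<not> ?thesis"
  then have "E \<inter> F \<inter> H = {}"
    using assms(1-4) by (simp add: simple_pi_arrangement_def)
  then show False using assms by blast
qed

lemma arrangement_finite: "simple_pi_arrangement A \<Longrightarrow> finite A"
  by (simp add: simple_pi_arrangement_def)

lemma crossings_iff: "x \<in> crossings A \<longleftrightarrow> (\<exists>E\<in>A. \<exists>F\<in>A. E \<noteq> F \<and> x \<in> E \<and> x \<in> F)"
  by (auto simp: crossings_def split: if_splits)

lemma crossings_finite:
  assumes "simple_pi_arrangement A" shows "finite (crossings A)"
proof -
  have "finite (E \<inter> F)" if "E \<in> A" "F \<in> A" "E \<noteq> F" for E F
    using arrangement_card_2[OF assms that] by (metis card.infinite zero_neq_numeral)
  then show ?thesis
    unfolding crossings_def by (intro finite_UN_I arrangement_finite[OF assms]) auto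
qed

text \<open>A crossing requires points of \<open>F\<close> off \<open>E\<close>. Thus the properness
  needed for the Jordan curve theorem comes without an argument on dimension.\<close>

lemma arrangement_ne_sphere:
  assumes arr: "simple_pi_arrangement A" and "E \<in> A" "F \<in> A" "E \<noteq> F"
  shows "E \<noteq> S2"
proof
  assume E: "E = S2"
  have "card (E \<inter> F) = 2" using arrangement_card_2[OF assms] .
  then have "E \<inter> F \<noteq> {}" by auto
  then obtain p where "p \<in> E" "p \<in> F" by blast
  then have "crosses_at E F p" using arrangement_crosses[OF assms] by blast
  then have "\<exists>x\<in>F \<inter> ball p 1 - E. True" unfolding crosses_at_def using zero_less_one by blast
  moreover have "F \<subseteq> S2" using arrangement_pseudocircle[OF arr assms(3)] by (simp add: pseudocircle_def)
  ultimately show False using E by auto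
qed

lemma pseudocircle_closed:
  assumes "pseudocircle E" shows "closed E" "compact E"
  using assms unfolding pseudocircle_def
  by (metis closed_path_image compact_path_image simple_path_imp_path)+

text \<open>For a pseudocircle \<open>E\<close> other than \<open>C\<close>, \<open>\<gamma> E\<close> runs through the part of \<open>E\<close> on the side \<open>D\<close>
  of \<open>C\<close>, and \<open>\<eta> E\<close> through the part on the other side.\<close>

locale arrangement_side =
  fixes A :: "(real^3) set set" and C D :: "(real^3) set"
    and \<gamma> \<eta> :: "(real^3) set \<Rightarrow> real \<Rightarrow> real^3" and \<phi> :: "real \<Rightarrow> real^3"
  assumes arr: "simple_pi_arrangement A" and CA: "C \<in> A"
    and D: "D \<in> components (S2 - C)"
    and phi: "simple_path \<phi>" "pathfinish \<phi> = pathstart \<phi>" "path_image \<phi> = C"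
    and gam: "\<And>E. E \<in> A - {C} \<Longrightarrow> arc (\<gamma> E)"
      "\<And>E. E \<in> A - {C} \<Longrightarrow> path_image (\<gamma> E) = E \<inter> (D \<union> C)"
      "\<And>E. E \<in> A - {C} \<Longrightarrow> E \<inter> C = {\<gamma> E 0, \<gamma> E 1}"
    and eta: "\<And>E. E \<in> A - {C} \<Longrightarrow> arc (\<eta> E)"
      "\<And>E. E \<in> A - {C} \<Longrightarrow> pathstart (\<eta> E) = pathfinish (\<gamma> E)"
      "\<And>E. E \<in> A - {C} \<Longrightarrow> pathfinish (\<eta> E) = pathstart (\<gamma> E)"
      "\<And>E. E \<in> A - {C} \<Longrightarrow> path_image (\<gamma> E) \<inter> path_image (\<eta> E) = {\<gamma> E 0, \<gamma> E 1}"
      "\<And>E. E \<in> A - {C} \<Longrightarrow> path_image (\<gamma> E) \<union> path_image (\<eta> E) = E"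
    and crossed: "\<And>E. E \<in> A - {C} \<Longrightarrow> \<exists>F\<in>A. F \<noteq> E \<and> E \<inter> F \<inter> D \<noteq> {}"
begin

text \<open>An arc in \<open>D\<close> is accessed through either of its endpoints \<open>v\<close>: the path \<open>\<delta> v\<close> starts at \<open>v\<close>,
  and \<open>par v\<close> is the parameter along it, so that \<open>par (opp v) = 1 - par v\<close>.\<close>

definition X where "X = {v \<in> C. \<exists>E\<in>A - {C}. v \<in> E}"
definition cir where "cir v = (THE E. E \<in> A - {C} \<and> v \<in> E)"
definition \<delta> where "\<delta> v = (if \<gamma> (cir v) 0 = v then \<gamma> (cir v) else reversepath (\<gamma> (cir v)))"
definition opp where "opp v = \<delta> v 1"
definition bar where "bar v = cir v \<inter> (D \<union> C)"
definition par where "par v p = (THE t. t \<in> {0..1} \<and> \<delta> v t = p)"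
definition mid where "mid v a b = {p \<in> bar v. par v a \<le> par v p \<and> par v p \<le> par v b}"
abbreviation ini where "ini v p \<equiv> mid v v p"

lemma A_S2: "E \<in> A \<Longrightarrow> E \<subseteq> S2"
  using arrangement_pseudocircle[OF arr] by (auto simp: pseudocircle_def)

lemma DC: "D \<inter> C = {}" and DS2: "D \<subseteq> S2"
  using D in_components_subset by blast+

lemma triple: "E \<in> A \<Longrightarrow> F \<in> A \<Longrightarrow> H \<in> A \<Longrightarrow> p \<in> E \<Longrightarrow> p \<in> F \<Longrightarrow> p \<in> H \<Longrightarrow> E = F \<or> F = H \<or> E = H"
  using arrangement_no_triple[OF arr] by blast

text \<open>By simplicity a point of \<open>C\<close> lies on at most one further pseudocircle, so
  the description in \<open>cir\<close> is unique.\<close>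

lemma cir_eq: "v \<in> C \<Longrightarrow> E \<in> A - {C} \<Longrightarrow> v \<in> E \<Longrightarrow> cir v = E"
  unfolding cir_def by (rule the_equality) (use triple CA in blast)+

lemma X_I: "v \<in> C \<Longrightarrow> E \<in> A - {C} \<Longrightarrow> v \<in> E \<Longrightarrow> v \<in> X"
  by (auto simp: X_def)

lemma X_C: "v \<in> X \<Longrightarrow> v \<in> C" by (simp add: X_def)

lemma cir: assumes "v \<in> X" shows "cir v \<in> A - {C}" "cir v \<in> A" "cir v \<noteq> C" "v \<in> cir v"
proof -
  obtain E where E: "v \<in> C" "E \<in> A - {C}" "v \<in> E" using assms by (auto simp: X_def)
  then show "cir v \<in> A - {C}" "v \<in> cir v" using cir_eq by auto
  then show "cir v \<in> A" "cir v \<noteq> C" by auto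
qed

lemma gam_ends: assumes "E \<in> A - {C}"
  shows "\<gamma> E 0 \<in> X" "\<gamma> E 1 \<in> X" "cir (\<gamma> E 0) = E" "cir (\<gamma> E 1) = E" "\<gamma> E 0 \<noteq> \<gamma> E 1"
proof -
  have "\<gamma> E 0 \<in> E \<inter> C" "\<gamma> E 1 \<in> E \<inter> C" using gam(3) assms by auto
  then show "\<gamma> E 0 \<in> X" "\<gamma> E 1 \<in> X" "cir (\<gamma> E 0) = E" "cir (\<gamma> E 1) = E"
    using assms X_I cir_eq by auto
  show "\<gamma> E 0 \<noteq> \<gamma> E 1"
    using arc_distinct_ends[OF gam(1)[OF assms]] by (simp add: pathstart_def pathfinish_def)
qed

lemma delta: assumes v: "v \<in> X"
  shows "arc (\<delta> v)" "\<delta> v 0 = v" "path_image (\<delta> v) = bar v" "opp v \<in> X" "cir (opp v) = cir v"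
    "opp v \<noteq> v" "opp (opp v) = v" "\<delta> (opp v) = reversepath (\<delta> v)" "cir v \<inter> C = {v, opp v}"
proof -
  let ?E = "cir v"
  have E: "?E \<in> A - {C}" "v \<in> ?E" using cir v by auto
  have vv: "v = \<gamma> ?E 0 \<or> v = \<gamma> ?E 1" using gam(3)[OF E(1)] E v X_C by auto
  note ge = gam_ends[OF E(1)]
  show "arc (\<delta> v)" using gam(1)[OF E(1)] by (auto simp: \<delta>_def arc_reversepath)
  show 0: "\<delta> v 0 = v" using vv by (auto simp: \<delta>_def reversepath_def)
  show "path_image (\<delta> v) = bar v" using gam(2)[OF E(1)] by (auto simp: \<delta>_def bar_def)
  show o: "opp v \<in> X" "cir (opp v) = cir v" "opp v \<noteq> v" using vv ge by (auto simp: opp_def \<delta>_def reversepath_def)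
  show d: "\<delta> (opp v) = reversepath (\<delta> v)"
    unfolding \<delta>_def[of "opp v"] o(2) using vv ge by (auto simp: opp_def \<delta>_def reversepath_def)
  show "opp (opp v) = v" by (metis 0 d opp_def reversepath_def diff_self)
  show "cir v \<inter> C = {v, opp v}" using gam(3)[OF E(1)] vv ge by (auto simp: opp_def \<delta>_def reversepath_def)
qed

lemmas opp_X = delta(4) and cir_opp = delta(5) and opp_ne = delta(6) and opp_opp = delta(7)

lemma opp_eq: "v \<in> X \<Longrightarrow> u \<in> X \<Longrightarrow> cir u = cir v \<Longrightarrow> u = v \<or> u = opp v"
  using delta(9)[of v] cir(4)[of u] X_C[of u] by auto

lemma bar_opp: "v \<in> X \<Longrightarrow> bar (opp v) = bar v"
  by (simp add: bar_def cir_opp)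

lemma par: assumes "v \<in> X" "p \<in> bar v"
  shows "0 \<le> par v p" "par v p \<le> 1" "\<delta> v (par v p) = p"
proof -
  have "p \<in> \<delta> v ` {0..1}" using delta(3)[OF assms(1)] assms(2) by (simp add: path_image_def)
  then have "\<exists>!t. t \<in> {0..1} \<and> \<delta> v t = p"
    using delta(1)[OF assms(1)] unfolding arc_def inj_on_def by blast
  from theI'[OF this] show "0 \<le> par v p" "par v p \<le> 1" "\<delta> v (par v p) = p"
    by (auto simp: par_def)
qed

lemma delta_bar: "v \<in> X \<Longrightarrow> 0 \<le> t \<Longrightarrow> t \<le> 1 \<Longrightarrow> \<delta> v t \<in> bar v"
  using delta(3)[of v] by (force simp: path_image_def)

lemma par_delta: assumes "v \<in> X" "0 \<le> t" "t \<le> 1" shows "par v (\<delta> v t) = t"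
proof -
  have "par v (\<delta> v t) \<in> {0..1}" "\<delta> v (par v (\<delta> v t)) = \<delta> v t"
    using par[OF assms(1) delta_bar[OF assms]] by auto
  then show ?thesis using delta(1)[OF assms(1)] assms by (auto simp: arc_def inj_on_def)
qed

lemma par_inj: "v \<in> X \<Longrightarrow> p \<in> bar v \<Longrightarrow> p' \<in> bar v \<Longrightarrow> par v p = par v p' \<Longrightarrow> p = p'"
  by (metis par(3))

lemma X_bar: "v \<in> X \<Longrightarrow> v \<in> bar v" "v \<in> X \<Longrightarrow> opp v \<in> bar v"
  using cir X_C opp_X cir_opp by (fastforce simp: bar_def)+

lemma par_self: "v \<in> X \<Longrightarrow> par v v = 0" and par_at_opp: "v \<in> X \<Longrightarrow> par v (opp v) = 1"
  using par_delta[of v 0] par_delta[of v 1] delta(2)[of v] by (auto simp: opp_def)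

lemma par_opp: assumes "v \<in> X" "p \<in> bar v" shows "par (opp v) p = 1 - par v p"
proof -
  have "\<delta> (opp v) (1 - par v p) = p"
    using delta(8)[OF assms(1)] par[OF assms] by (simp add: reversepath_def)
  then show ?thesis using par_delta[of "opp v" "1 - par v p"] opp_X par[OF assms] assms by auto
qed

lemma bar_D: assumes "v \<in> X" "p \<in> bar v"
  shows "p \<in> D \<longleftrightarrow> 0 < par v p \<and> par v p < 1"
proof -
  have "p \<in> D \<longleftrightarrow> p \<noteq> v \<and> p \<noteq> opp v"
    using assms delta(9)[OF assms(1)] DC by (auto simp: bar_def)
  moreover have "p = v \<longleftrightarrow> par v p = 0" "p = opp v \<longleftrightarrow> par v p = 1"
    using par_inj[OF assms X_bar(1)[OF assms(1)]] par_inj[OF assms X_bar(2)[OF assms(1)]]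
      par_self[OF assms(1)] par_at_opp[OF assms(1)] by auto
  ultimately show ?thesis using par(1,2)[OF assms] by linarith
qed

lemma mid_image: assumes "v \<in> X" "a \<in> bar v" "b \<in> bar v"
  shows "mid v a b = \<delta> v ` {par v a..par v b}"
proof -
  have "0 \<le> par v a" "par v b \<le> 1" using par assms by auto
  show ?thesis
  proof (intro equalityI subsetI)
    fix p assume "p \<in> mid v a b"
    then have "par v p \<in> {par v a..par v b}" "\<delta> v (par v p) = p"
      using par(3)[OF assms(1)] by (auto simp: mid_def)
    then show "p \<in> \<delta> v ` {par v a..par v b}" by (metis imageI)
  next
    fix p assume "p \<in> \<delta> v ` {par v a..par v b}"
    then obtain t where "p = \<delta> v t" "par v a \<le> t" "t \<le> par v b" by auto
    then show "p \<in> mid v a b"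
      using delta_bar[OF assms(1), of t] par_delta[OF assms(1), of t] \<open>0 \<le> par v a\<close> \<open>par v b \<le> 1\<close>
      by (auto simp: mid_def)
  qed
qed

lemma mid_path_connected: assumes "v \<in> X" "a \<in> bar v" "b \<in> bar v"
  shows "path_connected (mid v a b)" "connected (mid v a b)"
proof -
  have "continuous_on {par v a..par v b} (\<delta> v)"
  proof (rule continuous_on_subset)
    show "continuous_on {0..1} (\<delta> v)" using delta(1)[OF assms(1)] by (simp add: arc_def path_def)
    show "{par v a..par v b} \<subseteq> {0..1}" using par[OF assms(1,2)] par[OF assms(1,3)] by auto
  qed
  then show "path_connected (mid v a b)"
    unfolding mid_image[OF assms] by (rule path_connected_continuous_image) (simp add: convex_imp_path_connected)
  then show "connected (mid v a b)" by (rule path_connected_imp_connected)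
qed

lemma ini_connected: assumes "v \<in> X" "p \<in> bar v"
  shows "path_connected (ini v p)" "connected (ini v p)"
  using mid_path_connected[OF assms(1) X_bar(1)[OF assms(1)] assms(2)] by auto

lemma mid_sub: "mid v a b \<subseteq> cir v" "mid v a b \<subseteq> D \<union> C" "mid v a b \<subseteq> bar v"
  by (auto simp: mid_def bar_def)

lemma mid_C: assumes "v \<in> X" "p \<in> mid v a b" "p \<in> C" shows "p = v \<or> p = opp v"
  using assms delta(9) by (auto simp: mid_def bar_def)

lemma ini_C: assumes "v \<in> X" "p \<in> mid v a b" "p \<in> C" "b \<in> D" "b \<in> bar v" shows "p = v"
  using mid_C[OF assms(1-3)] bar_D[OF assms(1), of b] assms par_at_opp by (auto simp: mid_def)

subsection \<open>Cyclic positions\<close>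

definition \<theta> where "\<theta> p = (THE t. 0 \<le> t \<and> t < 1 \<and> \<phi> t = p)"
text \<open>Leftwards is the direction in which \<open>\<phi>\<close> runs; \<open>pos w p\<close>
  is the leftward distance from \<open>w\<close> to \<open>p\<close>, a parameter difference modulo
  1.\<close>

definition pos where "pos w p = (if \<theta> w \<le> \<theta> p then \<theta> p - \<theta> w else \<theta> p - \<theta> w + 1)"
definition civ where "civ a b = {p \<in> C. pos a p \<le> pos a b}"

lemma phi_inj: "0 \<le> s \<Longrightarrow> s < 1 \<Longrightarrow> 0 \<le> t \<Longrightarrow> t < 1 \<Longrightarrow> \<phi> s = \<phi> t \<Longrightarrow> s = t"
  using phi(1) by (force simp: simple_path_def loop_free_def)

lemma theta: assumes "p \<in> C" shows "0 \<le> \<theta> p" "\<theta> p < 1" "\<phi> (\<theta> p) = p"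
proof -
  obtain t where t: "0 \<le> t" "t \<le> 1" "\<phi> t = p" using assms phi(3) by (auto simp: path_image_def)
  have "\<exists>t. 0 \<le> t \<and> t < 1 \<and> \<phi> t = p"
  proof (cases "t = 1")
    case True
    then have "\<phi> 0 = p" using t phi(2) by (simp add: pathfinish_def pathstart_def)
    then show ?thesis by (intro exI[of _ 0]) auto
  qed (use t in force)
  then have "\<exists>!t. 0 \<le> t \<and> t < 1 \<and> \<phi> t = p" using phi_inj by blast
  from theI'[OF this] show "0 \<le> \<theta> p" "\<theta> p < 1" "\<phi> (\<theta> p) = p" by (auto simp: \<theta>_def)
qed

lemma theta_phi: assumes "0 \<le> t" "t < 1" shows "\<theta> (\<phi> t) = t"
proof -
  have "\<phi> t \<in> C" using assms phi(3) by (force simp: path_image_def)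
  then show ?thesis using theta phi_inj assms by metis
qed

lemma theta_inj: "p \<in> C \<Longrightarrow> p' \<in> C \<Longrightarrow> \<theta> p = \<theta> p' \<Longrightarrow> p = p'" by (metis theta(3))

lemma pos_range: "w \<in> C \<Longrightarrow> p \<in> C \<Longrightarrow> 0 \<le> pos w p \<and> pos w p < 1"
  using theta[of w] theta[of p] by (auto simp: pos_def)

lemma pos_self [simp]: "pos w w = 0" by (simp add: pos_def)

lemma pos_eq: "w \<in> C \<Longrightarrow> p \<in> C \<Longrightarrow> p' \<in> C \<Longrightarrow> pos w p = pos w p' \<longleftrightarrow> p = p'"
  using theta[of w] theta[of p] theta[of p'] theta_inj[of p p'] by (auto simp: pos_def split: if_splits)

lemma pos_pos: "w \<in> C \<Longrightarrow> p \<in> C \<Longrightarrow> w \<noteq> p \<Longrightarrow> 0 < pos w p"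
  using pos_eq[of w w p] pos_range[of w p] by auto

text \<open>Change of base point. It reduces comparisons in the cyclic order to linear arithmetic
  over one base point.\<close>

lemma pos_shift: "x \<in> C \<Longrightarrow> w \<in> C \<Longrightarrow> p \<in> C \<Longrightarrow>
   pos w p = (if pos x w \<le> pos x p then pos x p - pos x w else pos x p - pos x w + 1)"
  using theta[of x] theta[of w] theta[of p] by (auto simp: pos_def)

lemma shift_pos: assumes "w \<in> C" "0 \<le> t" "t < 1"
  shows "shiftpath (\<theta> w) \<phi> t \<in> C" "pos w (shiftpath (\<theta> w) \<phi> t) = t"
proof -
  note tw = theta[OF assms(1)]
  have p0: "\<phi> 1 = \<phi> 0" using phi(2) by (simp add: pathfinish_def pathstart_def)
  consider "\<theta> w + t < 1" | "\<theta> w + t = 1" | "\<theta> w + t > 1" by linarith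
  then have "\<exists>s. 0 \<le> s \<and> s < 1 \<and> shiftpath (\<theta> w) \<phi> t = \<phi> s \<and> (s = \<theta> w + t \<or> s = \<theta> w + t - 1)"
  proof cases
    case 1 then show ?thesis using tw assms by (intro exI[of _ "\<theta> w + t"]) (auto simp: shiftpath_def)
  next
    case 2 then show ?thesis using tw assms p0 by (intro exI[of _ "0"]) (auto simp: shiftpath_def)
  next
    case 3 then show ?thesis using tw assms by (intro exI[of _ "\<theta> w + t - 1"]) (auto simp: shiftpath_def)
  qed
  then obtain s where s: "0 \<le> s" "s < 1" "shiftpath (\<theta> w) \<phi> t = \<phi> s" "s = \<theta> w + t \<or> s = \<theta> w + t - 1" by blast
  then show "shiftpath (\<theta> w) \<phi> t \<in> C" using phi(3) by (force simp: path_image_def)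
  show "pos w (shiftpath (\<theta> w) \<phi> t) = t" using s theta_phi[OF s(1,2)] assms by (auto simp: pos_def)
qed

lemma shift_loop: assumes "w \<in> C"
  shows "simple_path (shiftpath (\<theta> w) \<phi>)" "shiftpath (\<theta> w) \<phi> 0 = w" "shiftpath (\<theta> w) \<phi> 1 = w"
    "path_image (shiftpath (\<theta> w) \<phi>) = C"
  using theta[OF assms] phi
  by (auto intro: simple_path_shiftpath simp: path_image_shiftpath)
    (auto simp: shiftpath_def pathfinish_def pathstart_def)

lemma shift_at_pos: assumes "w \<in> C" "p \<in> C" shows "shiftpath (\<theta> w) \<phi> (pos w p) = p"
  using shift_pos[OF assms(1), of "pos w p"] pos_range[OF assms] pos_eq[OF assms(1) _ assms(2)] by auto

lemma civ_image: assumes "w \<in> C" "y \<in> C" shows "civ w y = shiftpath (\<theta> w) \<phi> ` {0..pos w y}"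
proof (intro equalityI subsetI)
  fix p assume "p \<in> civ w y"
  then show "p \<in> shiftpath (\<theta> w) \<phi> ` {0..pos w y}"
    using shift_at_pos[OF assms(1), of p] pos_range[OF assms(1), of p] by (force simp: civ_def)
next
  fix p assume "p \<in> shiftpath (\<theta> w) \<phi> ` {0..pos w y}"
  then show "p \<in> civ w y"
    using shift_pos[OF assms(1)] pos_range[OF assms] by (force simp: civ_def)
qed

text \<open>The end \<open>w\<close> of this interval has \<open>pos w w = 0\<close>; in the image
  it is supplied by the parameter 1, where the loop closes.\<close>

lemma civ_image2: assumes "w \<in> C" "y \<in> C" "w \<noteq> y" shows "civ y w = shiftpath (\<theta> w) \<phi> ` {pos w y..1}"
proof -
  have y0: "0 < pos w y" using pos_pos assms by auto
  have "p \<in> civ y w \<longleftrightarrow> p \<in> C \<and> (p = w \<or> pos w y \<le> pos w p)" for p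
  proof (cases "p \<in> C")
    case True
    show ?thesis
    proof (cases "p = w")
      case False
      then have "0 < pos w p" using pos_pos[OF assms(1) True] by auto
      then show ?thesis
        using pos_shift[OF assms(1,2) True] pos_shift[OF assms(1,2,1)] pos_range[OF assms(1) True] y0 True False
        by (auto simp: civ_def)
    qed (use True in \<open>auto simp: civ_def\<close>)
  qed (simp add: civ_def)
  moreover have "p \<in> C \<and> (p = w \<or> pos w y \<le> pos w p) \<longleftrightarrow> p \<in> shiftpath (\<theta> w) \<phi> ` {pos w y..1}" for p
  proof
    assume "p \<in> C \<and> (p = w \<or> pos w y \<le> pos w p)"
    then show "p \<in> shiftpath (\<theta> w) \<phi> ` {pos w y..1}"
      using shift_at_pos[OF assms(1), of p] pos_range[OF assms(1), of p] shift_loop(3)[OF assms(1)]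
        pos_range[OF assms(1,2)] 
      by (cases "p = w") (force simp: image_iff intro: bexI[of _ 1])+
  next
    assume "p \<in> shiftpath (\<theta> w) \<phi> ` {pos w y..1}"
    then obtain t where t: "p = shiftpath (\<theta> w) \<phi> t" "pos w y \<le> t" "t \<le> 1" by auto
    then show "p \<in> C \<and> (p = w \<or> pos w y \<le> pos w p)"
      using shift_pos[OF assms(1), of t] shift_loop(3)[OF assms(1)] y0 assms(1) by (cases "t = 1") auto
  qed
  ultimately show ?thesis by blast
qed

lemma civ_path_connected: assumes "w \<in> C" "y \<in> C"
  shows "path_connected (civ w y)" "connected (civ w y)" "w \<in> civ w y" "y \<in> civ w y" "civ w y \<subseteq> C"
proof -
  have "continuous_on {0..pos w y} (shiftpath (\<theta> w) \<phi>)"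
  proof (rule continuous_on_subset)
    show "continuous_on {0..1} (shiftpath (\<theta> w) \<phi>)"
      using shift_loop(1)[OF assms(1)] by (simp add: simple_path_def path_def)
    show "{0..pos w y} \<subseteq> {0..1}" using pos_range[OF assms] by auto
  qed
  then show "path_connected (civ w y)"
    unfolding civ_image[OF assms] by (rule path_connected_continuous_image) (simp add: convex_imp_path_connected)
  then show "connected (civ w y)" by (rule path_connected_imp_connected)
  show "w \<in> civ w y" "y \<in> civ w y" "civ w y \<subseteq> C" using assms pos_range[OF assms] by (auto simp: civ_def)
qed

lemma C_arcs: assumes "w \<in> C" "y \<in> C" "w \<noteq> y"
  obtains c1 c2 where "arc c1" "pathstart c1 = w" "pathfinish c1 = y" "path_image c1 = civ w y"
    "arc c2" "pathstart c2 = w" "pathfinish c2 = y" "path_image c2 = civ y w"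
    "path_image c1 \<inter> path_image c2 = {w, y}" "path_image c1 \<union> path_image c2 = C"
proof -
  let ?\<psi> = "shiftpath (\<theta> w) \<phi>"
  have y: "0 < pos w y" "pos w y < 1" using pos_pos pos_range assms by auto
  show thesis
  proof (rule that[of "subpath 0 (pos w y) ?\<psi>" "subpath 1 (pos w y) ?\<psi>"])
    note sl = shift_loop[OF assms(1)] and sp = shift_at_pos[OF assms(1,2)]
    show "arc (subpath 0 (pos w y) ?\<psi>)" "arc (subpath 1 (pos w y) ?\<psi>)"
      using arc_simple_path_subpath[OF sl(1)] y sl sp assms(3) by auto
    show 1: "path_image (subpath 0 (pos w y) ?\<psi>) = civ w y"
      using y civ_image[OF assms(1,2)] by (simp add: path_image_subpath)
    show 2: "path_image (subpath 1 (pos w y) ?\<psi>) = civ y w"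
      using y civ_image2[OF assms] by (simp add: path_image_subpath)
    have "{0..1} = {0..pos w y} \<union> {pos w y..1}" using y by auto
    then have "C = ?\<psi> ` {0..pos w y} \<union> ?\<psi> ` {pos w y..1}"
      using sl(4) unfolding path_image_def by (metis image_Un)
    then show "path_image (subpath 0 (pos w y) ?\<psi>) \<union> path_image (subpath 1 (pos w y) ?\<psi>) = C"
      using 1 2 civ_image[OF assms(1,2)] civ_image2[OF assms] by simp
    have "p \<in> civ w y \<and> p \<in> civ y w \<longleftrightarrow> p = w \<or> p = y" for p
    proof (cases "p \<in> C")
      case True
      show ?thesis
      proof (cases "p = w \<or> p = y")
        case False
        then have "0 < pos w p" "pos w p \<noteq> pos w y"
          using pos_pos[OF assms(1) True] pos_eq[OF assms(1) True assms(2)] by auto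
        then show ?thesis
          using pos_shift[OF assms(1,2) True] pos_shift[OF assms(1,2,1)] pos_range[OF assms(1) True] y False
          by (auto simp: civ_def)
      qed (use y pos_range[OF assms(2,1)] assms in \<open>auto simp: civ_def\<close>)
    qed (use assms in \<open>auto simp: civ_def\<close>)
    then show "path_image (subpath 0 (pos w y) ?\<psi>) \<inter> path_image (subpath 1 (pos w y) ?\<psi>) = {w, y}"
      unfolding 1 2 by blast
  qed (use shift_loop[OF assms(1)] shift_at_pos[OF assms(1,2)] in auto)
qed

section \<open>Crosscuts of a side of \<open>C\<close> and of a side of another pseudocircle\<close>

lemmas A_ne_S2 = arrangement_ne_sphere[OF arr]

text \<open>\<open>P\<close> acts as a crosscut of \<open>D\<close> from \<open>w\<close> to
  \<open>y\<close>; comparing with \<open>pos w y\<close> tells which of the two boundary arcs a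
  point of \<open>C\<close> is on.\<close>

lemma sep_C:
  assumes wy: "w \<in> C" "y \<in> C" "w \<noteq> y"
    and P: "path_connected P" "w \<in> P" "y \<in> P" "P \<subseteq> D \<union> {w, y}"
    and S: "connected S" "S \<subseteq> D \<union> C" "S \<inter> P = {}"
    and s: "s \<in> S" "s \<in> C" "pos w s < pos w y" and s': "s' \<in> S" "s' \<in> C" "pos w y < pos w s'"
    and CS: "C \<noteq> S2"
  shows False
proof -
  obtain c1 c2 where c: "arc c1" "pathstart c1 = w" "pathfinish c1 = y" "path_image c1 = civ w y"
    "arc c2" "pathstart c2 = w" "pathfinish c2 = y" "path_image c2 = civ y w"
    "path_image c1 \<inter> path_image c2 = {w, y}" "path_image c1 \<union> path_image c2 = C"
    using C_arcs[OF wy] by blast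
  have "s \<in> path_image c1" using s c by (simp add: civ_def)
  moreover have "s' \<notin> path_image c1" using s' c by (simp add: civ_def)
  ultimately show False
    using crosscut_separates[OF c(1-3) c(5-7) c(9,10) A_S2[OF CA] CS D P S s(1) _ s'(1)] c(10) s'(2) by blast
qed

text \<open>The analogue for the Jordan curve \<open>cir e\<close> and either of its sides. One
  boundary arc is \<open>ini e t\<close>; the other continues from \<open>t\<close> to
  \<open>opp e\<close> and returns to \<open>e\<close> on the other side of
  \<open>C\<close>.\<close>

lemma sep_circle:
  assumes e: "e \<in> X" "t \<in> cir e" "t \<in> D" and G: "G \<in> components (S2 - cir e)"
    and P: "path_connected P" "e \<in> P" "t \<in> P" "P \<subseteq> G \<union> {e, t}"
    and S: "connected S" "S \<subseteq> G \<union> cir e" "S \<inter> P = {}"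
    and s: "s \<in> S" "s \<in> ini e t" and s': "s' \<in> S" "s' \<in> cir e" "s' \<notin> ini e t"
  shows False
proof -
  let ?F = "cir e"
  have F: "?F \<in> A - {C}" using cir e by auto
  have tb: "t \<in> bar e" using e by (simp add: bar_def)
  define \<tau> where "\<tau> = par e t"
  have tau: "0 < \<tau>" "\<tau> < 1" "\<delta> e \<tau> = t" using bar_D[OF e(1) tb] e par[OF e(1) tb] by (auto simp: \<tau>_def)
  note de = delta[OF e(1)]
  \<comment> \<open>The outer arc, oriented from \<open>opp e\<close> to \<open>e\<close>, whichever
    end of \<open>\<gamma> ?F\<close> the point \<open>e\<close> is.\<close>
  define \<eta>' where "\<eta>' = (if \<gamma> ?F 0 = e then \<eta> ?F else reversepath (\<eta> ?F))"
  have vv: "e = \<gamma> ?F 0 \<or> e = \<gamma> ?F 1" using gam(3)[OF F] e X_C cir by auto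
  have oe: "opp e = (if \<gamma> ?F 0 = e then \<gamma> ?F 1 else \<gamma> ?F 0)"
    using vv gam_ends[OF F] opp_eq[OF e(1), of "\<gamma> ?F 0"] opp_eq[OF e(1), of "\<gamma> ?F 1"] by metis
  have pe: "path_image \<eta>' = path_image (\<eta> ?F)" by (simp add: \<eta>'_def)
  have "{e, opp e} = {\<gamma> ?F 0, \<gamma> ?F 1}" using vv oe by auto
  moreover have "bar e = path_image (\<gamma> ?F)" using gam(2)[OF F] by (simp add: bar_def)
  ultimately have eta': "path_image \<eta>' \<inter> bar e = {e, opp e}" "path_image \<eta>' \<union> bar e = ?F"
    using eta(4,5)[OF F] unfolding pe by blast+
  have eta'': "arc \<eta>'" "pathstart \<eta>' = opp e" "pathfinish \<eta>' = e"
    using eta(1-3)[OF F] vv oe by (auto simp: \<eta>'_def arc_reversepath pathstart_def[of "\<gamma> _"] pathfinish_def[of "\<gamma> _"])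
  note eta' = eta'' eta'
  define c1 where "c1 = subpath 0 \<tau> (\<delta> e)"
  define c0 where "c0 = subpath \<tau> 1 (\<delta> e)"
  define c2 where "c2 = reversepath (c0 +++ \<eta>')"
  have i1: "path_image c1 = ini e t"
    unfolding c1_def mid_image[OF e(1) X_bar(1)[OF e(1)] tb] using tau par_self[OF e(1)]
    by (simp add: path_image_subpath \<tau>_def)
  have i0: "path_image c0 = {p \<in> bar e. \<tau> \<le> par e p}"
    using mid_image[OF e(1) tb X_bar(2)[OF e(1)]] tau par_at_opp[OF e(1)] par[OF e(1)]
    by (auto simp: c0_def path_image_subpath mid_def \<tau>_def)
  have a: "arc c1" "pathstart c1 = e" "pathfinish c1 = t"
    unfolding c1_def using arc_subpath_arc[OF de(1)] tau de(2) by auto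
  have a0: "arc c0" "pathstart c0 = t" "pathfinish c0 = opp e"
    unfolding c0_def using arc_subpath_arc[OF de(1)] tau de(2) by (auto simp: opp_def)
  have ne: "e \<notin> path_image c0" using i0 par_self[OF e(1)] tau by auto
  have j: "path_image c0 \<inter> path_image \<eta>' \<subseteq> {pathstart \<eta>'}"
  proof -
    have "path_image c0 \<subseteq> bar e" using i0 by blast
    then have "path_image c0 \<inter> path_image \<eta>' \<subseteq> {e, opp e}" using eta'(4) by auto
    then show ?thesis using eta'(2) ne by auto
  qed
  have arcj: "arc (c0 +++ \<eta>')" using arc_join[OF a0(1) eta'(1) _ j] a0 eta' by simp
  have b: "arc c2" "pathstart c2 = e" "pathfinish c2 = t" "path_image c2 = path_image c0 \<union> path_image \<eta>'"
    using arc_reversepath[OF arcj] a0 eta' by (auto simp: c2_def path_image_join)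
  have un: "path_image c1 \<union> path_image c2 = ?F"
    unfolding b(4) i1 i0 using eta'(5) par[OF e(1)] by (auto simp: mid_def \<tau>_def par_self[OF e(1)])
  have it: "path_image c1 \<inter> path_image c2 = {e, t}"
  proof -
    have 1: "path_image c1 \<inter> path_image c0 = {t}"
      unfolding i1 i0 using par_inj[OF e(1) _ tb] tb par_self[OF e(1)] tau par[OF e(1) tb]
      by (auto simp: mid_def \<tau>_def)
    have "opp e \<notin> path_image c1" using i1 par_at_opp[OF e(1)] tau by (auto simp: mid_def \<tau>_def)
    moreover have "e \<in> path_image c1" "e \<in> path_image \<eta>'" using a eta' by (metis pathstart_in_path_image pathfinish_in_path_image)+
    moreover have "path_image c1 \<subseteq> bar e" using i1 by (auto simp: mid_def)
    moreover from this have "path_image c1 \<inter> path_image \<eta>' \<subseteq> {e, opp e}" using eta'(4) by auto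
    ultimately have "path_image c1 \<inter> path_image \<eta>' = {e}" by auto
    then show ?thesis using 1 b(4) by (simp add: Int_Un_distrib insert_commute)
  qed
  have "?F \<noteq> S2" using A_ne_S2[of ?F C] F CA by auto
  moreover have "?F \<subseteq> S2" using A_S2 F by auto
  ultimately show False
    using crosscut_separates[OF a b(1-3) it un _ _ G P S s(1) _ s'(1)] i1 s(2) s'(2,3) un by auto
qed


lemma eta_image: assumes "E \<in> A - {C}" shows "path_image (\<eta> E) = E - D"
proof -
  have 1: "{\<gamma> E 0, \<gamma> E 1} \<inter> D = {}" using gam(3)[OF assms] DC by auto
  have "path_image (\<eta> E) \<inter> D = {}"
  proof -
    have "path_image (\<eta> E) \<inter> D \<subseteq> path_image (\<gamma> E)" using eta(5)[OF assms] gam(2)[OF assms] by auto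
    then show ?thesis using eta(4)[OF assms] 1 by auto
  qed
  moreover have "E - D \<subseteq> path_image (\<eta> E)"
  proof
    fix p assume p: "p \<in> E - D"
    show "p \<in> path_image (\<eta> E)"
    proof (cases "p \<in> C")
      case True
      then have "p \<in> {\<gamma> E 0, \<gamma> E 1}" using p gam(3)[OF assms] by auto
      then show ?thesis using eta(4)[OF assms] by auto
    next
      case False
      then show ?thesis using p eta(5)[OF assms] gam(2)[OF assms] by auto
    qed
  qed
  ultimately show ?thesis using eta(5)[OF assms] by auto
qed

subsection \<open>Sides of a pseudocircle\<close>

definition same_side where "same_side F a b \<longleftrightarrow> connected_component (S2 - F) a b"

lemma same_side_connected: "connected T \<Longrightarrow> T \<subseteq> S2 - F \<Longrightarrow> a \<in> T \<Longrightarrow> b \<in> T \<Longrightarrow> same_side F a b"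
  unfolding same_side_def connected_component_def by blast

lemma same_side_sym: "same_side F a b \<Longrightarrow> same_side F b a"
  unfolding same_side_def by (rule connected_component_sym)

lemma same_side_trans: "same_side F a b \<Longrightarrow> same_side F b c \<Longrightarrow> same_side F a c"
  unfolding same_side_def by (rule connected_component_trans)

lemma C_S2: "C \<subseteq> S2" using A_S2 CA by auto

text \<open>By the Jordan curve theorem there are only two components to be distributed among the
  three points.\<close>

lemma two_sides:
  assumes F: "F \<in> A - {C}" and ab: "a \<in> S2 - F" "b \<in> S2 - F" "c \<in> S2 - F" "\<not> same_side F a b" "\<not> same_side F a c"
  shows "same_side F b c"
proof -
  have "pseudocircle F" using F arrangement_pseudocircle[OF arr] by auto
  then obtain g where g: "simple_path g" "pathfinish g = pathstart g" "path_image g = F"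
    unfolding pseudocircle_def by auto
  obtain U V where UV: "components (S2 - F) = {U, V}"
    using jordan_two_components[OF g] A_S2 A_ne_S2[of F C] F CA by (metis Diff_iff insertI1)
  have un: "S2 - F = U \<union> V" using UV Union_components[of "S2 - F"] by auto
  have W: "connected W" "W \<subseteq> S2 - F" if "W \<in> {U, V}" for W
    using that in_components_connected[of W "S2 - F"] in_components_subset[of W "S2 - F"] unfolding UV by auto
  have s: "same_side F p p'" if "p \<in> U \<and> p' \<in> U \<or> p \<in> V \<and> p' \<in> V" for p p'
    using that same_side_connected[OF W(1) W(2), of U p p'] same_side_connected[OF W(1) W(2), of V p p'] by auto
  show ?thesis using ab(1-3) s[of a b] s[of a c] s[of b c] ab(4,5) unfolding un by auto
qed

text \<open>Makes the local definition of crossing global. Near \<open>p\<close> only the stretch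
  from \<open>a\<close> to \<open>b\<close> of \<open>cir u\<close> is present, and each of its
  points off \<open>F\<close> is joined to \<open>a\<close> or to \<open>b\<close> along the arc. If
  \<open>a\<close> and \<open>b\<close> were on one side, \<open>F\<close> would separate no two of
  these points.\<close>

lemma opposite_sides_of_crossing:
  assumes u: "u \<in> X" and F: "F \<in> A" "F \<noteq> cir u" and p: "p \<in> F" "p \<in> bar u"
    and ab: "a \<in> bar u" "b \<in> bar u" "par u a < par u p" "par u p < par u b"
    and only: "\<And>x. x \<in> mid u a b \<Longrightarrow> x \<in> F \<Longrightarrow> x = p"
  shows "\<not> same_side F a b"
proof
  assume s: "same_side F a b"
  let ?k = "cir u"
  note k = cir[OF u]
  \<comment> \<open>The part of \<open>cir u\<close> outside the open stretch between
    \<open>a\<close> and \<open>b\<close>: a closed set that misses \<open>p\<close>, so a ball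
    around \<open>p\<close> avoids it.\<close>
  define R where "R = path_image (\<eta> ?k) \<union> ini u a \<union> mid u b (opp u)"
  have comp: "compact (mid u x y)" if "x \<in> bar u" "y \<in> bar u" for x y
  proof -
    have "continuous_on {par u x..par u y} (\<delta> u)"
    proof (rule continuous_on_subset)
      show "continuous_on {0..1} (\<delta> u)" using delta(1)[OF u] by (simp add: arc_def path_def)
      show "{par u x..par u y} \<subseteq> {0..1}" using par[OF u that(1)] par[OF u that(2)] by auto
    qed
    then show ?thesis unfolding mid_image[OF u that] by (intro compact_continuous_image) auto
  qed
  have "closed R"
    unfolding R_def using comp[OF X_bar(1)[OF u] ab(1)] comp[OF ab(2) X_bar(2)[OF u]] eta(1)[OF k(1)]
    by (intro closed_Un compact_imp_closed) (auto intro: compact_path_image arc_imp_path)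
  have pD: "p \<in> D" using bar_D[OF u p(2)] par[OF u ab(1)] par[OF u ab(2)] ab by auto
  then have "p \<notin> R" unfolding R_def eta_image[OF k(1)] using ab by (auto simp: mid_def)
  then obtain e where "e > 0" "ball p e \<subseteq> - R"
    using openE[OF open_Compl[OF \<open>closed R\<close>], of p] by auto
  then have e: "e > 0" "ball p e \<inter> R = {}" by auto
  have kR: "x \<in> mid u a b" if "x \<in> ?k" "x \<notin> R" for x
  proof -
    have "x \<in> D" using that eta_image[OF k(1)] by (auto simp: R_def)
    then have "x \<in> bar u" using that by (simp add: bar_def)
    then show ?thesis using that par[OF u] par_self[OF u] par_at_opp[OF u]
      by (auto simp: R_def mid_def)
  qed
  have "crosses_at F ?k p"
    using arrangement_crosses[OF arr F(1) k(2) F(2) p(1)] p(2) by (simp add: bar_def)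
  then obtain x y where xy: "x \<in> ?k \<inter> ball p e - F" "y \<in> ?k \<inter> ball p e - F" "\<not> same_side F x y"
    unfolding crosses_at_def same_side_def using e(1) by meson
  have "same_side F a x" if "x \<in> ?k \<inter> ball p e - F" for x
  proof -
    have "x \<notin> R" using e(2) that by blast
    then have x: "x \<in> mid u a b" "x \<notin> F" using that kR by auto
    then have xb: "x \<in> bar u" by (simp add: mid_def)
    have ne: "par u x \<noteq> par u p" using par_inj[OF u xb p(2)] x p by auto
    have sub: "mid u c d \<subseteq> S2" for c d using mid_sub A_S2[OF k(2)] by blast
    show ?thesis
    proof (cases "par u x < par u p")
      case True
      have "mid u a x \<subseteq> S2 - F"
      proof
        fix z assume z: "z \<in> mid u a x"
        then have "z \<in> mid u a b" "z \<noteq> p" using True x by (auto simp: mid_def)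
        then show "z \<in> S2 - F" using only sub by auto
      qed
      then show ?thesis
        using same_side_connected[OF mid_path_connected(2)[OF u ab(1) xb]] ab x xb by (auto simp: mid_def)
    next
      case False
      have "mid u x b \<subseteq> S2 - F"
      proof
        fix z assume z: "z \<in> mid u x b"
        then have "z \<in> mid u a b" "z \<noteq> p" using False x ne by (auto simp: mid_def)
        then show "z \<in> S2 - F" using only sub by auto
      qed
      then have "same_side F x b"
        using same_side_connected[OF mid_path_connected(2)[OF u xb ab(2)]] ab x xb by (auto simp: mid_def)
      then show ?thesis using s same_side_sym same_side_trans by blast
    qed
  qed
  then show False using xy same_side_sym same_side_trans by blast
qed

lemma civ_open: assumes "w \<in> C" "y \<in> C" "w \<noteq> y" shows "connected (civ w y - {w, y})"
proof -
  obtain c1 where "arc c1" "pathstart c1 = w" "pathfinish c1 = y" "path_image c1 = civ w y"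
    using C_arcs[OF assms] by metis
  then show ?thesis using connected_simple_path_endless[of c1] arc_imp_simple_path by auto
qed

text \<open>The two open intervals of \<open>C\<close> are connected and avoid \<open>cir e\<close>.
  If both lay on one side, \<open>C\<close> could not cross \<open>cir e\<close> at
  \<open>e\<close>.\<close>

lemma C_opposite_sides:
  assumes e: "e \<in> X" and s: "s \<in> civ e (opp e) - {e, opp e}" "s' \<in> civ (opp e) e - {e, opp e}"
  shows "\<not> same_side (cir e) s s'"
proof
  assume ss: "same_side (cir e) s s'"
  let ?e = "opp e" and ?F = "cir e"
  have C: "e \<in> C" "?e \<in> C" "e \<noteq> ?e" using e opp_X opp_ne X_C by (auto dest: not_sym) 
  have U: "C = civ e ?e \<union> civ ?e e" using C_arcs[OF C] by metis
  have FC: "?F \<inter> C = {e, ?e}" using delta(9)[OF e] .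
  let ?I = "civ e ?e - {e, ?e}" and ?J = "civ ?e e - {e, ?e}"
  have c: "connected ?I" "connected ?J"
    using civ_open[OF C] civ_open[OF C(2,1)] C(3) by (auto simp: insert_commute)
  have sub: "?I \<subseteq> S2 - ?F" "?J \<subseteq> S2 - ?F" using U FC C_S2 by blast+
  have "crosses_at ?F C e" using arrangement_crosses[OF arr _ CA _ _ C(1)] cir[OF e] by blast
  then obtain x y where xy: "x \<in> C - ?F" "y \<in> C - ?F" "\<not> same_side ?F x y"
    unfolding crosses_at_def same_side_def using zero_less_one by (metis DiffD1 DiffD2 DiffI IntD1)
  have "x \<in> ?I \<union> ?J" "y \<in> ?I \<union> ?J" using xy U FC by auto
  moreover have "same_side ?F s z" if "z \<in> ?I \<union> ?J" for z
    using that
  proof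
    assume "z \<in> ?I" then show ?thesis using same_side_connected[OF c(1) sub(1) s(1)] by blast
  next
    assume "z \<in> ?J" then show ?thesis using same_side_connected[OF c(2) sub(2) s(2)] ss same_side_trans by blast
  qed
  ultimately show False using xy same_side_sym same_side_trans by blast
qed

subsection \<open>The first crossing on an arc\<close>

definition crossings_on where "crossings_on v = {p \<in> bar v. p \<in> D \<and> (\<exists>F\<in>A. F \<noteq> cir v \<and> p \<in> F)}"
definition q where "q v = arg_min_on (par v) (crossings_on v)"
definition g where "g v = (THE F. F \<in> A \<and> F \<noteq> cir v \<and> q v \<in> F)"

lemma finite_meet: "E \<in> A \<Longrightarrow> F \<in> A \<Longrightarrow> E \<noteq> F \<Longrightarrow> finite (E \<inter> F)"
  using arrangement_card_2[OF arr] by (metis card.infinite zero_neq_numeral)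

text \<open>Here the choice of the side enters: by \<open>crossed\<close> every arc in
  \<open>D\<close> has a crossing there, so first crossings exist.\<close>

lemma crossings_on: assumes "v \<in> X" shows "finite (crossings_on v)" "crossings_on v \<noteq> {}"
proof -
  have "crossings_on v \<subseteq> (\<Union>F\<in>A - {cir v}. F \<inter> cir v)" by (auto simp: crossings_on_def bar_def)
  moreover have "finite (\<Union>F\<in>A - {cir v}. F \<inter> cir v)"
    by (rule finite_UN_I) (use arrangement_finite[OF arr] finite_meet cir[OF assms] in auto)
  ultimately show "finite (crossings_on v)" by (rule finite_subset)
  show "crossings_on v \<noteq> {}" using crossed[OF cir(1)[OF assms]] by (auto simp: crossings_on_def bar_def)
qed

lemma q: assumes "v \<in> X"
  shows "q v \<in> bar v" "q v \<in> D" "q v \<in> cir v" "q v \<in> S2"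
    "g v \<in> A - {C}" "g v \<in> A" "g v \<noteq> cir v" "q v \<in> g v"
proof -
  have "q v \<in> crossings_on v" unfolding q_def using crossings_on[OF assms] by (rule arg_min_if_finite(1))
  then obtain F where F: "F \<in> A" "F \<noteq> cir v" "q v \<in> F" and b: "q v \<in> bar v" "q v \<in> D"
    by (auto simp: crossings_on_def)
  then show "q v \<in> bar v" "q v \<in> D" "q v \<in> cir v" "q v \<in> S2" using DS2 by (auto simp: bar_def)
  have "\<exists>!F. F \<in> A \<and> F \<noteq> cir v \<and> q v \<in> F"
    using F triple[OF _ _ cir(2)[OF assms]] \<open>q v \<in> cir v\<close> by metis
  from theI'[OF this] show "g v \<in> A - {C}" "g v \<in> A" "g v \<noteq> cir v" "q v \<in> g v"
    using b DC by (auto simp: g_def)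
qed

lemma q_first: assumes "v \<in> X" "p \<in> bar v" "p \<in> D" "p \<in> F" "F \<in> A" "F \<noteq> cir v"
  shows "par v (q v) \<le> par v p"
proof -
  have "p \<in> crossings_on v" using assms by (auto simp: crossings_on_def)
  then show ?thesis using arg_min_if_finite(2)[OF crossings_on[OF assms(1)]] unfolding q_def by (metis not_le)
qed

lemma g_unique: "v \<in> X \<Longrightarrow> F \<in> A \<Longrightarrow> F \<noteq> cir v \<Longrightarrow> q v \<in> F \<Longrightarrow> F = g v"
  using q[of v] triple[of F "g v" "cir v" "q v"] cir by blast

text \<open>A meeting point before \<open>q v\<close> would be an earlier crossing in
  \<open>D\<close>, and at \<open>q v\<close> itself simplicity leaves only
  \<open>g v\<close>.\<close>

lemma ini_q: assumes "v \<in> X" "p \<in> ini v (q v)" "p \<in> F" "F \<in> A - {C}" "F \<noteq> cir v"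
  shows "p = q v" "F = g v"
proof -
  have pb: "p \<in> bar v" using assms by (simp add: mid_def)
  have "p \<notin> C"
  proof
    assume "p \<in> C"
    then have "p = v" using ini_C[OF assms(1,2)] q[OF assms(1)] by blast
    then show False using cir_eq[of v F] assms \<open>p \<in> C\<close> by auto
  qed
  then have "p \<in> D" using pb by (auto simp: bar_def)
  then have "par v (q v) \<le> par v p" using q_first[OF assms(1) pb _ assms(3)] assms by auto
  then show "p = q v" using par_inj[OF assms(1) pb q(1)[OF assms(1)]] assms(2) by (auto simp: mid_def)
  then show "F = g v" using g_unique[OF assms(1)] assms by auto
qed

lemma ini_I: "v \<in> X \<Longrightarrow> p \<in> bar v \<Longrightarrow> v \<in> ini v p \<and> p \<in> ini v p"
  using X_bar par_self par by (auto simp: mid_def)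

text \<open>Of the two ends of \<open>g v\<close>, \<open>nend v\<close> is met first when going leftwards from \<open>v\<close>; \<open>far v\<close>
  is the open interval of \<open>C\<close> between the two ends that does not contain \<open>v\<close>.\<close>

definition nend where "nend v = (let e = \<gamma> (g v) 0 in if pos v e < pos v (opp e) then e else opp e)"

lemma nend: assumes "v \<in> X"
  shows "nend v \<in> X" "cir (nend v) = g v" "pos v (nend v) < pos v (opp (nend v))" "0 < pos v (nend v)"
    "opp (nend v) \<in> X" "cir (opp (nend v)) = g v" "nend v \<in> C" "opp (nend v) \<in> C" "nend v \<noteq> v" "opp (nend v) \<noteq> v"
    "g v \<inter> C = {nend v, opp (nend v)}"
proof -
  let ?e = "\<gamma> (g v) 0"
  note ge = gam_ends[OF q(5)[OF assms]]
  have vC: "v \<in> C" using assms X_C by auto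
  have ne: "pos v ?e \<noteq> pos v (opp ?e)"
    using pos_eq[OF vC, of ?e "opp ?e"] ge opp_X opp_ne X_C by metis
  show n: "nend v \<in> X" "cir (nend v) = g v" using ge opp_X cir_opp by (auto simp: nend_def Let_def)
  show "pos v (nend v) < pos v (opp (nend v))"
    using ne ge opp_opp by (auto simp: nend_def Let_def)
  show o: "opp (nend v) \<in> X" "cir (opp (nend v)) = g v" using n opp_X cir_opp by auto
  show c: "nend v \<in> C" "opp (nend v) \<in> C" using n o X_C by auto
  show "nend v \<noteq> v" "opp (nend v) \<noteq> v" using n o q(7)[OF assms] by auto
  then show "0 < pos v (nend v)" using pos_pos[OF vC c(1)] by auto
  show "g v \<inter> C = {nend v, opp (nend v)}" using delta(9)[OF n(1)] n by simp
qed

lemma g_C: "v \<in> X \<Longrightarrow> p \<in> C \<Longrightarrow> p \<in> g v \<Longrightarrow> p = nend v \<or> p = opp (nend v)"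
  using nend(11)[of v] by blast

lemma end_cases: "v \<in> X \<Longrightarrow> u \<in> X \<Longrightarrow> cir u = g v \<Longrightarrow> u = nend v \<or> u = opp (nend v)"
  using opp_eq[of "nend v" u] nend by metis

definition far where "far v = {p \<in> C. pos v (nend v) < pos v p \<and> pos v p < pos v (opp (nend v))}"

text \<open>Describes \<open>far\<close> by \<open>nend v\<close> alone. This makes the intervals of
  different endpoints comparable when they have the same near end.\<close>

lemma far_civ: assumes v: "v \<in> X"
  shows "far v = civ (nend v) (opp (nend v)) - {nend v, opp (nend v)}"
    "C - far v - g v = civ (opp (nend v)) (nend v) - {nend v, opp (nend v)}"
proof -
  let ?e = "nend v" and ?e' = "opp (nend v)"
  have vC: "v \<in> C" using v X_C by auto
  note n = nend[OF v]
  have "(p \<in> far v \<longleftrightarrow> p \<in> civ ?e ?e' - {?e, ?e'}) \<and>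
     (p \<notin> far v \<and> p \<noteq> ?e \<and> p \<noteq> ?e' \<longleftrightarrow> p \<in> civ ?e' ?e - {?e, ?e'})" if p: "p \<in> C" for p
    using pos_shift[OF vC n(7) p] pos_shift[OF vC n(8) p] pos_shift[OF vC n(7,8)] pos_shift[OF vC n(8,7)]
      pos_range[OF vC p] pos_range[OF vC n(7)] pos_range[OF vC n(8)] pos_eq[OF vC p n(7)] pos_eq[OF vC p n(8)] n(3) p
    by (auto simp: far_def civ_def split: if_splits)
  then show "far v = civ ?e ?e' - {?e, ?e'}" "C - far v - g v = civ ?e' ?e - {?e, ?e'}"
    using n(11) by (auto simp: civ_def far_def)
qed

lemma far_notin: "v \<in> X \<Longrightarrow> p \<in> far v \<Longrightarrow> p \<notin> g v"
  using g_C[of v p] by (auto simp: far_def)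

lemma far_same_side: assumes "v \<in> X" "p \<in> far v" "p' \<in> far v" shows "same_side (g v) p p'"
proof (rule same_side_connected)
  show "connected (far v)"
    unfolding far_civ(1)[OF assms(1)] using nend[OF assms(1)] opp_ne by (intro civ_open) (auto dest: not_sym)
  show "far v \<subseteq> S2 - g v" using far_notin[OF assms(1)] C_S2 by (auto simp: far_def)
qed (use assms in auto)

lemma near_same_side: assumes "v \<in> X" "p \<in> C" "p \<notin> far v" "p \<notin> g v" "p' \<in> C" "p' \<notin> far v" "p' \<notin> g v"
  shows "same_side (g v) p p'"
proof (rule same_side_connected)
  have "connected (civ (opp (nend v)) (nend v) - {opp (nend v), nend v})"
    using nend[OF assms(1)] opp_ne by (intro civ_open) auto
  then show "connected (C - far v - g v)"
    unfolding far_civ(2)[OF assms(1)] by (simp add: insert_commute)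
  show "C - far v - g v \<subseteq> S2 - g v" using C_S2 by auto
qed (use assms in auto)

lemma far_near: assumes "v \<in> X" "p \<in> far v" "p' \<in> C" "p' \<notin> far v" "p' \<notin> g v"
  shows "\<not> same_side (g v) p p'"
proof -
  have "p \<in> civ (nend v) (opp (nend v)) - {nend v, opp (nend v)}" using assms(2) far_civ(1)[OF assms(1)] by simp
  moreover have "p' \<in> civ (opp (nend v)) (nend v) - {nend v, opp (nend v)}"
    using assms far_civ(2)[OF assms(1)] by blast
  ultimately show ?thesis using C_opposite_sides[OF nend(1)[OF assms(1)]] nend(2)[OF assms(1)] by simp
qed

lemma self_near: "v \<in> X \<Longrightarrow> v \<notin> far v \<and> v \<notin> g v \<and> v \<in> C"
  using nend(4,9,10)[of v] g_C[of v v] X_C[of v] by (auto simp: far_def)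

lemma q_nend: "v \<in> X \<Longrightarrow> q v \<in> bar (nend v)"
  using q[of v] nend[of v] by (simp add: bar_def)

text \<open>Initial segments on different pseudocircles can only meet in a first crossing of both.
  For the two ends of one arc, the first crossing seen from \<open>w\<close> does not come after the
  one seen from \<open>v\<close>.\<close>

lemma ini_disjoint: assumes "v \<in> X" "w \<in> X" "v \<noteq> w" "q v \<noteq> q w"
  shows "ini v (q v) \<inter> ini w (q w) = {}"
proof (rule ccontr)
  assume "\<not> ?thesis"
  then obtain p where p: "p \<in> ini v (q v)" "p \<in> ini w (q w)" by blast
  show False
  proof (cases "cir v = cir w")
    case True
    then have vo: "v = opp w" using opp_eq assms by blast
    have b: "bar v = bar w" using True by (simp add: bar_def)
    have pb: "p \<in> bar w" using p by (simp add: mid_def)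
    have "par w (q v) \<le> par w p"
      using p(1) par_opp[OF assms(2) pb] par_opp[OF assms(2), of "q v"] q(1)[OF assms(1)] b vo by (simp add: mid_def)
    moreover have "par w p \<le> par w (q w)" using p by (simp add: mid_def)
    moreover have "par w (q w) \<le> par w (q v)"
      using q[OF assms(1)] b True by (intro q_first[OF assms(2), of _ "g v"]) auto
    ultimately show False using par_inj[OF assms(2) q(1)[OF assms(2)], of "q v"] q(1)[OF assms(1)] b assms by auto
  next
    case False
    have "p \<in> cir v" "p \<in> cir w" using p mid_sub by blast+
    then show False using ini_q(1)[OF assms(1) p(1) _ cir(1)[OF assms(2)]] ini_q(1)[OF assms(2) p(2) _ cir(1)[OF assms(1)]] False assms by auto
  qed
qed

lemma ini_same_side:
  assumes v: "v \<in> X" and b: "b \<in> bar v" and only: "\<And>p. p \<in> ini v b \<Longrightarrow> p \<in> h \<Longrightarrow> p = b"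
    and p: "p \<in> ini v b" "p \<noteq> b"
  shows "same_side h v p"
proof (rule same_side_connected)
  have pb: "p \<in> bar v" using p by (simp add: mid_def)
  then show "connected (ini v p)" "v \<in> ini v p" "p \<in> ini v p"
    using mid_path_connected(2)[OF v X_bar(1)[OF v]] ini_I[OF v] by auto
  show "ini v p \<subseteq> S2 - h"
  proof
    fix x assume x: "x \<in> ini v p"
    then have x': "x \<in> ini v b" using p by (auto simp: mid_def)
    have "x \<noteq> b"
    proof
      assume "x = b"
      then have "par v p = par v b" using x p by (auto simp: mid_def)
      then show False using p par_inj[OF v pb b] by auto
    qed
    then have "x \<notin> h" using only[OF x'] by auto
    then show "x \<in> S2 - h" using x mid_sub(1) A_S2[OF cir(2)[OF v]] by blast
  qed
qed

text \<open>The two segments up to \<open>q w\<close> form a crosscut of \<open>D\<close> from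
  \<open>w\<close> to \<open>nend w\<close>. They bound the corner region together with the base,
  and \<open>S\<close> starts on the base.\<close>

lemma sep_corner:
  assumes w: "w \<in> X" and S: "connected S" "S \<subseteq> D \<union> C" "S \<inter> ini w (q w) = {}" "S \<inter> ini (nend w) (q w) = {}"
    and s: "s \<in> S" "s \<in> C" "pos w s < pos w (nend w)" and s': "s' \<in> S" "s' \<in> C"
  shows "pos w s' < pos w (nend w)"
proof (rule ccontr)
  assume no: "\<not> ?thesis"
  let ?P = "ini w (q w) \<union> ini (nend w) (q w)"
  note n = nend[OF w]
  have b: "q w \<in> bar w" "q w \<in> bar (nend w)" using q[OF w] q_nend[OF w] by auto
  have wC: "w \<in> C" using w X_C by auto
  have 1: "path_connected ?P"
    by (rule path_connected_Un)
      (use ini_connected(1)[OF w b(1)] ini_connected(1)[OF n(1) b(2)]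
        ini_I[OF w b(1)] ini_I[OF n(1) b(2)] in auto)
  have 2: "w \<in> ?P" "nend w \<in> ?P" using ini_I[OF w b(1)] ini_I[OF n(1) b(2)] by auto
  have 3: "?P \<subseteq> D \<union> {w, nend w}"
    using ini_C[OF w _ _ q(2)[OF w] b(1)] ini_C[OF n(1) _ _ q(2)[OF w] b(2)] mid_sub by blast
  have "s' \<noteq> nend w" using s' 2 S by auto
  then have "pos w (nend w) < pos w s'" using no pos_eq[OF wC s'(2) n(7)] by auto
  moreover have "C \<noteq> S2" using A_ne_S2[OF CA cir(2)[OF w]] cir[OF w] by auto
  moreover have "w \<noteq> nend w" using n by auto
  ultimately show False
    using sep_C[OF wC n(7) _ 1 2 3 S(1,2) _ s s'] S by blast
qed

lemma between: assumes "w \<in> X" "v \<in> X" "0 < pos w v" "pos w v < pos w (nend w)"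
  shows "v \<notin> far w" "v \<notin> g w" "cir v \<noteq> g w" "v \<in> C" "v \<noteq> w"
proof -
  note n = nend[OF assms(1)]
  show "v \<notin> far w" using assms by (auto simp: far_def)
  show vC: "v \<in> C" using assms X_C by auto
  show "v \<notin> g w" using n(3) g_C[OF assms(1) vC] assms by auto
  then show "cir v \<noteq> g w" using cir[OF assms(2)] by auto
  show "v \<noteq> w" using assms by auto
qed

text \<open>The delicate case is \<open>g v = cir w\<close>, where the branch lies on the arc of
  \<open>w\<close>. Seen from \<open>w\<close>, the crossing \<open>q v\<close> is not before
  \<open>q w\<close>, so a stretch ending at \<open>q v\<close> that touches
  \<open>ini w (q w)\<close> contains \<open>q w\<close>, whichever its direction.\<close>

lemma first_crossing_on_branch:
  assumes w: "w \<in> X" and v: "v \<in> X" and u: "u \<in> X" "cir u = g v"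
    and p: "p \<in> mid u a (q v)" "p \<in> ini w (q w)"
  shows "q w \<in> mid u a (q v)"
proof -
  note Qv = q[OF v] and Qw = q[OF w]
  have bu: "q v \<in> bar u" using Qv u by (simp add: bar_def)
  have pk: "p \<in> g v" using p u mid_sub by blast
  show ?thesis
  proof (cases "g v = cir w")
    case False
    then have "p = q w" using ini_q(1)[OF w p(2) pk Qv(5)] by auto
    then show ?thesis using p by auto
  next
    case True
    have b: "bar u = bar w" using u True by (simp add: bar_def)
    have f: "par w (q w) \<le> par w (q v)"
      using Qv b bu True by (intro q_first[OF w, of _ "cir v"]) (auto simp: cir[OF v])
    have pb: "p \<in> bar w" using p(2) by (simp add: mid_def)
    have "u = w \<or> u = opp w" using opp_eq[OF w u(1)] u True by auto
    then show ?thesis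
    proof
      assume "u = w"
      then show ?thesis using f p Qw by (auto simp: mid_def)
    next
      assume uo: "u = opp w"
      then have "par w (q v) \<le> par w p"
        using p(1) par_opp[OF w pb] par_opp[OF w, of "q v"] bu b by (simp add: mid_def)
      then have "par w p = par w (q w)" using f p(2) by (simp add: mid_def)
      then show ?thesis using p par_inj[OF w pb Qw(1)] by auto
    qed
  qed
qed

text \<open>The arc of \<open>v\<close> up to \<open>q v\<close>, followed by the branch to
  \<open>u\<close>, avoids the boundary of the corner: it misses \<open>g w\<close>, and touching
  the arc of \<open>w\<close> would force the branch through \<open>q w\<close>, which is on
  \<open>g w\<close>.\<close>

lemma branch_stays:
  assumes w: "w \<in> X" and v: "v \<in> X" "0 < pos w v" "pos w v < pos w (nend w)" "g v \<noteq> g w"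
    and u: "u \<in> X" "cir u = g v" "ini u (q v) \<inter> g w = {}"
  shows "pos w u < pos w (nend w)"
proof -
  note bt = between[OF w v(1-3)]
  have qn: "q v \<notin> g w" using g_unique[OF v(1), of "g w"] q[OF w] bt(3) v(4) by auto
  then have qq: "q v \<noteq> q w" using q[OF w] by auto
  have bu: "q v \<in> bar u" using q[OF v(1)] u by (simp add: bar_def)
  have bv: "q v \<in> bar v" using q[OF v(1)] by auto
  let ?S = "ini v (q v) \<union> ini u (q v)"
  have 1: "connected ?S"
    by (rule connected_Un)
      (use ini_connected(2)[OF v(1) bv] ini_connected(2)[OF u(1) bu]
        ini_I[OF v(1) bv] ini_I[OF u(1) bu] in auto)
  have 2: "?S \<subseteq> D \<union> C" using mid_sub by blast
  have "ini u (q v) \<inter> ini w (q w) = {}"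
    using first_crossing_on_branch[OF w v(1) u(1,2)] u(3) q(8)[OF w] by blast
  then have 3: "?S \<inter> ini w (q w) = {}" using ini_disjoint[OF v(1) w bt(5) qq] by auto
  have "ini (nend w) (q w) \<subseteq> g w" using mid_sub nend(2)[OF w] by metis
  moreover have "p \<notin> g w" if "p \<in> ini v (q v)" for p
    using ini_q(1)[OF v(1) that _ q(5)[OF w]] bt(3) qn by auto
  moreover have "p \<notin> g w" if "p \<in> ini u (q v)" for p using that u(3) by auto
  ultimately have 4: "?S \<inter> ini (nend w) (q w) = {}" by auto
  show ?thesis
    using sep_corner[OF w 1 2 3 4 _ bt(4) v(3), of u] ini_I[OF v(1) bv] ini_I[OF u(1) bu] X_C[OF u(1)] by auto
qed


subsection \<open>Humps\<close>

text \<open>The arc blocking \<open>v\<close> enters and leaves the corner region of \<open>w\<close> through \<open>g w\<close>, with \<open>q v\<close>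
  between the two crossings \<open>r\<close> and \<open>r'\<close> and both ends beyond \<open>g w\<close>.\<close>

inductive hump for w v where
  hump_I: "g v \<noteq> g w \<Longrightarrow> u \<in> X \<Longrightarrow> cir u = g v \<Longrightarrow> u \<in> far w \<Longrightarrow> opp u \<in> far w \<Longrightarrow>
   r \<in> ini (nend w) (q w) \<Longrightarrow> r' \<in> ini (nend w) (q w) \<Longrightarrow> r \<in> g v \<Longrightarrow> r' \<in> g v \<Longrightarrow> r \<in> D \<Longrightarrow> r' \<in> D \<Longrightarrow>
   r \<noteq> q w \<Longrightarrow> r' \<noteq> q w \<Longrightarrow> par u r < par u r' \<Longrightarrow> par u r \<le> par u (q v) \<Longrightarrow> par u (q v) \<le> par u r' \<Longrightarrow> hump w v"

lemma civ_pos: assumes "x \<in> C" "a \<in> C" "b \<in> C" "pos x a \<le> pos x b"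
  shows "civ a b = {p \<in> C. pos x a \<le> pos x p \<and> pos x p \<le> pos x b}"
proof -
  have "p \<in> civ a b \<longleftrightarrow> pos x a \<le> pos x p \<and> pos x p \<le> pos x b" if p: "p \<in> C" for p
  proof -
    have "pos a b = pos x b - pos x a" "pos x b < 1" "0 \<le> pos x p"
      using pos_shift[OF assms(1,2,3)] pos_range[OF assms(1) p] pos_range[OF assms(1,3)] assms(4) by auto
    then show ?thesis using pos_shift[OF assms(1,2) p] p by (cases "pos x a \<le> pos x p") (auto simp: civ_def)
  qed
  moreover have "civ a b \<subseteq> C" by (auto simp: civ_def)
  ultimately show ?thesis by blast
qed

lemma two_points: assumes "E \<in> A" "F \<in> A" "E \<noteq> F" "a \<in> E \<inter> F" "b \<in> E \<inter> F" "a \<noteq> b" "p \<in> E" "p \<in> F"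
  shows "p = a \<or> p = b"
proof -
  have "card (E \<inter> F) = 2" using arrangement_card_2[OF arr assms(1-3)] .
  then obtain x y where xy: "E \<inter> F = {x, y}" by (meson card_2_iff)
  have "a \<in> {x, y}" "b \<in> {x, y}" "p \<in> {x, y}" using assms(4,5,7,8) unfolding xy[symmetric] by auto
  then show ?thesis using assms(6) by auto
qed

lemma meet_in_D: assumes "u \<in> X" "F \<in> A - {C}" "F \<noteq> cir u" "p \<in> mid u a b" "p \<in> F"
  shows "p \<in> D" "p \<in> bar u" "p \<in> cir u" "0 < par u p" "par u p < 1"
proof -
  show b: "p \<in> bar u" "p \<in> cir u" using assms mid_sub by (auto simp: mid_def)
  have "p \<notin> C" using mid_C[OF assms(1,4)] assms cir_eq[OF _ assms(2,5)] cir_opp[OF assms(1)] by metis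
  then show "p \<in> D" using b by (auto simp: bar_def)
  then show "0 < par u p" "par u p < 1" using bar_D[OF assms(1) b(1)] by auto
qed

text \<open>Seen from \<open>nend w\<close>, the point \<open>r\<close> comes after
  \<open>q w\<close>. So \<open>S\<close> could be continued along \<open>g w\<close>, away from the
  corner, to \<open>opp (nend w)\<close>, which lies beyond the base.\<close>

lemma blocked_before_corner:
  assumes w: "w \<in> X" and v: "v \<in> X" "0 < pos w v" "pos w v < pos w (nend w)"
    and S: "connected S" "S \<subseteq> D \<union> C" "v \<in> S" "S \<inter> ini w (q w) = {}" "S \<inter> ini (nend w) (q w) = {}"
    and r: "r \<in> S" "r \<in> g w" "r \<in> D"
  shows False
proof -
  note n = nend[OF w] and Qw = q[OF w]
  let ?y = "nend w" and ?z = "opp (nend w)"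
  have rb: "r \<in> bar ?y" "r \<in> bar ?z" using r n by (auto simp: bar_def)
  have qb: "q w \<in> bar ?y" using q_nend[OF w] .
  have lt: "par ?y (q w) < par ?y r"
    using r S(5) rb par[OF n(1) rb(1)] par_self[OF n(1)] by (auto simp: mid_def)
  have z_ge: "par ?y r \<le> par ?y p" if "p \<in> ini ?z r" for p
  proof -
    have "p \<in> bar ?y" using that bar_opp[OF n(1)] by (auto simp: mid_def)
    then show ?thesis using that par_opp[OF n(1)] rb by (auto simp: mid_def)
  qed
  let ?S = "S \<union> ini ?z r"
  have 1: "connected ?S"
    by (rule connected_Un) (use S(1) r(1) ini_connected(2)[OF n(5) rb(2)] ini_I[OF n(5) rb(2)] in auto)
  have 2: "?S \<subseteq> D \<union> C" using S(2) mid_sub by blast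
  have "p \<notin> ini w (q w)" if p: "p \<in> ini ?z r" for p
  proof
    assume pw: "p \<in> ini w (q w)"
    have "p \<in> g w" using p n mid_sub by blast
    then have "p = q w" using ini_q(1)[OF w pw _ Qw(5,7)] by auto
    then show False using z_ge[OF p] lt by auto
  qed
  then have 3: "?S \<inter> ini w (q w) = {}" using S(4) by auto
  have "p \<notin> ini ?y (q w)" if p: "p \<in> ini ?z r" for p
    using z_ge[OF p] lt by (auto simp: mid_def)
  then have 4: "?S \<inter> ini ?y (q w) = {}" using S(5) by auto
  have "pos w ?z < pos w ?y"
    using sep_corner[OF w 1 2 3 4 _ X_C[OF v(1)] v(3), of ?z] S(3) ini_I[OF n(5) rb(2)] n by auto
  then show False using n(3) by auto
qed

text \<open>One half of a hump; exchanging \<open>u\<close> and \<open>opp u\<close> gives the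
  other. Since \<open>r\<close> and \<open>r'\<close> are all common points of \<open>g v\<close>
  and \<open>g w\<close>, each branch from \<open>q v\<close> crosses \<open>g w\<close> exactly
  once and ends on the side away from \<open>w\<close>.\<close>

lemma hump_branch:
  assumes w: "w \<in> X" and v: "v \<in> X" "0 < pos w v" "pos w v < pos w (nend w)" "g v \<noteq> g w"
    and u: "u \<in> X" "cir u = g v"
    and r: "r \<in> ini u (q v)" "r \<in> g w" and r': "r' \<in> ini (opp u) (q v)" "r' \<in> g w"
  shows "r \<in> D" "r \<in> ini (nend w) (q w)" "r \<noteq> q w" "par u r < par u (q v)" "par u (q v) < par u r'" "u \<in> far w"
proof -
  note bt = between[OF w v(1-3)] and n = nend[OF w] and Qw = q[OF w] and Qv = q[OF v(1)]
  have ou: "opp u \<in> X" "cir (opp u) = g v" "opp (opp u) = u" using u opp_X cir_opp opp_opp by auto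
  have bu: "q v \<in> bar u" "q v \<in> bar (opp u)" using Qv u ou by (auto simp: bar_def)
  have qn: "q v \<notin> g w" using g_unique[OF v(1), of "g w"] Qw bt(3) v(4) by auto
  have qq: "q v \<noteq> q w" using Qw qn by auto
  have ne: "g w \<noteq> cir u" "g w \<noteq> cir (opp u)" using u ou v by auto
  note rD = meet_in_D[OF u(1) Qw(5) ne(1) r] and rD' = meet_in_D[OF ou(1) Qw(5) ne(2) r']
  show "r \<in> D" using rD by auto
  have rb': "r' \<in> bar u" using rD' bar_opp[OF u(1)] by auto
  show lt: "par u r < par u (q v)"
    using r qn par_inj[OF u(1) rD(2) bu(1)] by (auto simp: mid_def order_le_less)
  have "par u (q v) \<noteq> par u r'" using r' qn par_inj[OF u(1) rb' bu(1)] by auto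
  then show lt': "par u (q v) < par u r'"
    using r' par_opp[OF u(1) rb'] par_opp[OF u(1) bu(1)] by (auto simp: mid_def)
  have rne: "r \<noteq> r'" using lt lt' by auto
  have in_k: "r \<in> g v \<inter> g w" "r' \<in> g v \<inter> g w" using r r' rD rD' u ou by auto
  have only: "p = r \<or> p = r'" if "p \<in> cir u" "p \<in> g w" for p
    using two_points[OF Qv(6) Qw(6) v(4) in_k rne] that u by auto
  have only2: "p = r" if "p \<in> mid u a (q v)" "p \<in> g w" for p a
  proof -
    have "p \<in> cir u" using that mid_sub by blast
    then show ?thesis using only[of p] that lt' by (auto simp: mid_def)
  qed
  \<comment> \<open>The arc of \<open>v\<close> does not change sides of \<open>g w\<close> before
    \<open>q v\<close>.\<close>
  have vq: "same_side (g w) w (q v)"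
  proof -
    have "same_side (g w) w v" using near_same_side[OF w] self_near[OF w] bt by auto
    moreover have "same_side (g w) v (q v)"
    proof (rule same_side_connected)
      have "p \<notin> g w" if "p \<in> ini v (q v)" for p
        using ini_q(1)[OF v(1) that _ Qw(5)] bt(3) qn by auto
      then show "ini v (q v) \<subseteq> S2 - g w" using mid_sub(1)[of v] A_S2[OF cir(2)[OF v(1)]] by blast
    qed (use ini_connected(2)[OF v(1) Qv(1)] ini_I[OF v(1) Qv(1)] in auto)
    ultimately show ?thesis using same_side_trans by blast
  qed
  \<comment> \<open>If \<open>r = q w\<close>, then \<open>g v = cir w\<close> by simplicity, and
    the order of first crossings leaves \<open>u = w\<close>. But then the arc of \<open>w\<close>
    changes sides of \<open>g w\<close> at \<open>q w\<close>, before it reaches \<open>q v\<close>,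
    against \<open>vq\<close>.\<close>
  show rq: "r \<noteq> q w"
  proof
    assume rqw: "r = q w"
    then have "g v = cir w" using g_unique[OF w Qv(6)] in_k v by auto
    then have uw: "u = w \<or> u = opp w" and cu: "cir u = cir w" using opp_eq[OF w u(1)] u by auto
    have b: "bar u = bar w" using cu by (simp add: bar_def)
    have f: "par w (q w) \<le> par w (q v)"
      using Qv b bu cu u by (intro q_first[OF w, of _ "cir v"]) (auto simp: cir[OF v(1)])
    have "u = w"
      using uw f lt rqw par_opp[OF w Qw(1)] par_opp[OF w, of "q v"] bu b by auto
    then have "\<not> same_side (g w) w (q v)"
      using lt rD rqw X_bar[OF w] bu only2 ne Qw par_self[OF w]
      by (intro opposite_sides_of_crossing[OF w Qw(6) _ Qw(8) Qw(1)]) auto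
    then show False using vq by simp
  qed
  \<comment> \<open>Otherwise the arc of \<open>v\<close> and the branch up to \<open>r\<close>
    would reach \<open>g w\<close> without touching the boundary of the corner.\<close>
  show "r \<in> ini (nend w) (q w)"
  proof (rule ccontr)
    assume no: "r \<notin> ini (nend w) (q w)"
    let ?y = "nend w" and ?S = "ini v (q v) \<union> mid u r (q v)"
    have m: "q v \<in> mid u r (q v)" "r \<in> mid u r (q v)" using lt rD bu by (auto simp: mid_def)
    have 1: "connected ?S"
      by (rule connected_Un)
        (use ini_connected(2)[OF v(1) Qv(1)] mid_path_connected(2)[OF u(1) rD(2) bu(1)] m ini_I[OF v(1) Qv(1)] in auto)
    have 2: "?S \<subseteq> D \<union> C" using mid_sub by blast
    have "p \<notin> ini w (q w)" if p: "p \<in> mid u r (q v)" for p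
    proof
      assume pw: "p \<in> ini w (q w)"
      have "q w \<in> mid u r (q v)" using first_crossing_on_branch[OF w v(1) u p pw] .
      then show False using only2[OF _ Qw(8)] rq by auto
    qed
    then have 3: "?S \<inter> ini w (q w) = {}" using ini_disjoint[OF v(1) w bt(5) qq] by blast
    have "p \<notin> ini ?y (q w)" if p: "p \<in> ini v (q v)" for p
    proof
      assume "p \<in> ini ?y (q w)"
      then have "p \<in> g w" using n(2) mid_sub by blast
      then show False using ini_q(1)[OF v(1) p _ Qw(5)] bt(3) qn by auto
    qed
    moreover have "p \<notin> ini ?y (q w)" if p: "p \<in> mid u r (q v)" for p
    proof
      assume py: "p \<in> ini ?y (q w)"
      then have "p \<in> g w" using n(2) mid_sub by blast
      then have "p = r" using only2[OF p] by auto
      then show False using py no by auto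
    qed
    ultimately have 4: "?S \<inter> ini ?y (q w) = {}" by blast
    show False
      using blocked_before_corner[OF w v(1-3) 1 2 _ 3 4, of r] ini_I[OF v(1) Qv(1)] m r(2) rD(1) by auto
  qed
  have "\<not> same_side (g w) u (q v)"
    using lt rD X_bar[OF u(1)] bu only2 ne Qw r(2) par_self[OF u(1)] 
    by (intro opposite_sides_of_crossing[OF u(1) Qw(6) ne(1) r(2) rD(2)]) auto
  then have "\<not> same_side (g w) w u" using vq same_side_sym same_side_trans by blast
  moreover have "u \<in> C" "u \<notin> g w" using u(1) X_C cir_eq[OF X_C[OF u(1)] Qw(5)] u(2) v(4) by auto
  ultimately show "u \<in> far w" using near_same_side[OF w] self_near[OF w] by blast
qed

lemma hump_if_branches_meet:
  assumes w: "w \<in> X" and v: "v \<in> X" "0 < pos w v" "pos w v < pos w (nend w)" "g v \<noteq> g w"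
    and u: "u \<in> X" "cir u = g v"
    and m: "ini u (q v) \<inter> g w \<noteq> {}" "ini (opp u) (q v) \<inter> g w \<noteq> {}"
  shows "hump w v"
proof -
  obtain r r' where r: "r \<in> ini u (q v)" "r \<in> g w" and r': "r' \<in> ini (opp u) (q v)" "r' \<in> g w" using m by blast
  have ou: "opp u \<in> X" "cir (opp u) = g v" "opp (opp u) = u" using u opp_X cir_opp opp_opp by auto
  note h1 = hump_branch[OF w v u r r']
  note h2 = hump_branch[OF w v ou(1,2) r', unfolded ou(3), OF r]
  have "r \<in> g v" "r' \<in> g v" using r r' u ou mid_sub by blast+
  then show ?thesis
    using hump_I[OF v(4) u h1(6) h2(6) h1(2) h2(2) _ _ h1(1) h2(1) h1(3) h2(3)] h1(4,5) by auto
qed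

text \<open>The blocker \<open>k\<close> of \<open>nend w\<close> enters the corner at
  \<open>s\<close>. A branch that did so without meeting \<open>g w\<close> again would be trapped,
  but the base has no endpoint inside; hence \<open>k\<close> returns through \<open>g w\<close>. In
  this hump \<open>q (nend w)\<close> is itself one of the two crossings, which is why
  \<open>hump\<close> allows equality there.\<close>

lemma hump_if_adjacent:
  assumes w: "w \<in> X" and adj: "\<And>v. v \<in> X \<Longrightarrow> \<not> (0 < pos w v \<and> pos w v < pos w (nend w))"
    and qn: "q (nend w) \<noteq> q w"
  shows "hump w (nend w)"
proof -
  note n = nend[OF w] and Qw = q[OF w]
  define y z h k s where "y = nend w" and "z = opp (nend w)" and "h = g w" and "k = g (nend w)" and "s = q (nend w)"
  note n = n[folded z_def, folded y_def, folded h_def]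
  note Qw = Qw[folded h_def] and Qy = q[OF n(1), unfolded y_def, folded k_def s_def, folded y_def]
  have wC: "w \<in> C" using w X_C by auto
  have kh: "k \<noteq> h" using Qy(7) n(2) by auto
  have sh: "s \<in> h" using Qy n(2) by auto
  have qb: "q w \<in> bar y" using q_nend[OF w] by (simp add: y_def)
  have sy: "s \<in> ini y (q w)" "s \<noteq> q w"
    using q_first[OF n(1) qb Qw(2,3) cir(2)[OF w]] n(2) Qw(7) Qy(1) par[OF n(1) Qy(1)] par_self[OF n(1)] qn
    by (auto simp: mid_def s_def y_def)
  have nw: "w \<notin> far w" "w \<notin> h" using self_near[OF w] by (auto simp: h_def)
  have wS: "w \<in> S2 - h" using nw wC C_S2 by auto
  define G where "G = connected_component_set (S2 - h) w"
  have G: "G \<in> components (S2 - h)" using wS by (auto simp: G_def components_def)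
  have G_same_side: "p \<in> G" if "same_side h w p" for p using that by (simp add: G_def same_side_def)
  have near: "same_side h w p" if "p \<in> C" "p \<notin> far w" "p \<notin> h" for p
    using near_same_side[OF w _ _ _ that(1,2)] that nw wC by (auto simp: h_def)
  have hC: "p = y \<or> p = z" if "p \<in> C" "p \<in> h" for p using g_C[OF w] that by (auto simp: y_def z_def h_def)
  \<comment> \<open>A crosscut, from \<open>y\<close> to \<open>q w\<close>, of the side
    \<open>G\<close> of \<open>h\<close> that contains \<open>w\<close>; the corner that it cuts off
    has \<open>ini y (q w)\<close> as its boundary on \<open>h\<close>.\<close>
  let ?P = "civ w y \<union> ini w (q w)"
  have iw: "same_side h w p" if p: "p \<in> ini w (q w)" "p \<noteq> q w" for p
    using ini_same_side[OF w Qw(1) ini_q(1)[OF w _ _ Qw(5,7)] p] .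
  have P: "path_connected ?P" "y \<in> ?P" "q w \<in> ?P" "?P \<subseteq> G \<union> {y, q w}"
  proof -
    note cv = civ_path_connected[OF wC n(7)]
    show "path_connected ?P"
      using ini_connected(1)[OF w Qw(1)] cv ini_I[OF w Qw(1)]
      by (intro path_connected_Un) auto
    show "y \<in> ?P" "q w \<in> ?P" using cv ini_I[OF w Qw(1)] by auto
    have "p \<in> G" if "p \<in> civ w y" "p \<noteq> y" for p
    proof -
      have p: "p \<in> C" "pos w p < pos w y" using that pos_eq[OF wC _ n(7), of p] by (auto simp: civ_def)
      then have "p \<notin> far w" by (auto simp: far_def y_def)
      moreover have "p \<notin> h" using hC[of p] p n(3) by auto
      ultimately show ?thesis using near p G_same_side by auto
    qed
    then show "?P \<subseteq> G \<union> {y, q w}" using iw G_same_side by blast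
  qed
  have qh: "q w \<in> cir y" "q w \<in> D" using Qw n by auto
  have Z: "s' \<in> ini y (q w)"
    if "connected S" "S \<subseteq> G \<union> h" "S \<inter> ?P = {}" "s \<in> S" "s' \<in> S" "s' \<in> h" for S s'
    using sep_circle[OF n(1) qh _ P that(1) _ that(3,4) sy(1) that(5)] G that n(2) by auto
  have zq: "z \<notin> ini y (q w)"
    using par_at_opp[OF n(1)] bar_D[OF n(1) qb] qh by (auto simp: mid_def z_def y_def)
  \<comment> \<open>The end \<open>u\<close> would lie left of \<open>z\<close>. Following the
    branch from \<open>s\<close> to \<open>u\<close> and then \<open>C\<close> back to
    \<open>z\<close> joins \<open>s\<close> to \<open>z\<close> without meeting the crosscut
    \<open>?P\<close>.\<close>
  have W: False if u: "u \<in> X" "cir u = k" and only: "\<And>p. p \<in> ini u s \<Longrightarrow> p \<in> h \<Longrightarrow> p = s" and uw: "same_side h u w" for u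
  proof -
    have uC: "u \<in> C" using u X_C by auto
    have sb: "s \<in> bar u" using Qy u by (auto simp: bar_def)
    have unh: "u \<notin> h" using cir_eq[OF uC Qw(5)] u kh by auto
    have une: "u \<noteq> y" "u \<noteq> z" using u n kh by auto
    have unw: "u \<noteq> w"
    proof
      assume u_w: "u = w"
      have "par w (q w) \<le> par w s"
        using q_first[OF w _ Qy(2) sh Qw(6,7)] sb u_w by simp
      then have "q w \<in> ini u s" using u_w Qw par[OF w Qw(1)] par_self[OF w] by (auto simp: mid_def)
      then show False using only Qw sy by auto
    qed
    have "u \<notin> far w" using far_near[OF w _ wC] nw uw by (auto simp: h_def)
    moreover have "0 < pos w u" using pos_pos[OF wC uC] unw by auto
    moreover have "pos w u \<noteq> pos w z" "pos w u \<noteq> pos w y" using pos_eq[OF wC uC] n une by auto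
    moreover have "\<not> pos w u < pos w y" using adj[OF u(1)] \<open>0 < pos w u\<close> by (auto simp: y_def)
    ultimately have uz: "pos w z < pos w u" using uC by (auto simp: far_def y_def z_def)
    have civ: "civ z u = {p \<in> C. pos w z \<le> pos w p \<and> pos w p \<le> pos w u}"
      using civ_pos[OF wC n(8) uC] uz by simp
    let ?S = "ini u s \<union> civ z u"
    note cv = civ_path_connected[OF n(8) uC]
    have 1: "connected ?S"
      using ini_connected(2)[OF u(1) sb] cv ini_I[OF u(1) sb]
      by (intro connected_Un) auto
    have "p \<in> G" if p: "p \<in> ini u s" "p \<noteq> s" for p
      using ini_same_side[OF u(1) sb only p] G_same_side uw same_side_sym same_side_trans by blast
    moreover have "p \<in> G" if p: "p \<in> civ z u" "p \<noteq> z" for p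
    proof -
      have pC: "p \<in> C" and pz: "pos w z < pos w p" using p civ pos_eq[OF wC _ n(8), of p] by auto
      have "p \<notin> far w" "p \<noteq> y" using pz n(3) by (auto simp: far_def z_def)
      then show ?thesis using near[OF pC] hC[OF pC] p G_same_side by auto
    qed
    ultimately have 2: "?S \<subseteq> G \<union> h" using sh n(8,11) by blast
    have wyz: "p \<notin> civ z u" if "p \<in> civ w y" for p using that n(3) by (auto simp: civ) (auto simp: civ_def)
    have "p \<notin> civ w y" if p: "p \<in> ini u s" for p
    proof
      assume "p \<in> civ w y"
      then have "p \<in> C" "pos w p \<le> pos w y" by (auto simp: civ_def)
      moreover have "p = u" using ini_C[OF u(1) p \<open>p \<in> C\<close> Qy(2) sb] .
      ultimately show False using uz n(3) by auto
    qed
    moreover have "p \<notin> ini w (q w)" if p: "p \<in> ini u s" for p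
    proof
      assume pw: "p \<in> ini w (q w)"
      have "q w \<in> ini u s"
        using first_crossing_on_branch[OF w n(1) u(1) _ _ pw] p u by (simp add: k_def s_def y_def)
      then show False using only Qw sy by auto
    qed
    moreover have "p \<notin> ini w (q w)" if p: "p \<in> civ z u" for p
    proof
      assume "p \<in> ini w (q w)"
      moreover have "p \<in> C" using p by (simp add: civ_def)
      ultimately have "p = w" using ini_C[OF w _ _ Qw(2,1)] by blast
      then show False using p n(3,4) by (simp add: civ)
    qed
    ultimately have 3: "?S \<inter> ?P = {}" using wyz by blast
    show False
      using Z[OF 1 2 3, of z] ini_I[OF u(1) sb] cv n(11) zq by blast
  qed
  obtain u0 where u0: "u0 \<in> X" "cir u0 = k" using gam_ends[OF Qy(5)] by blast
  obtain s2 where s2: "s2 \<in> k \<inter> h" "s2 \<noteq> s"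
  proof -
    have "card (k \<inter> h) = 2" using arrangement_card_2[OF arr Qy(6) Qw(6) kh] .
    then obtain x1 x2 where x: "k \<inter> h = {x1, x2}" "x1 \<noteq> x2" by (meson card_2_iff)
    then have "x1 \<in> k \<inter> h" "x2 \<in> k \<inter> h" by auto
    then show thesis using that[of x1] that[of x2] x(2) by metis
  qed
  have kh2: "p = s \<or> p = s2" if "p \<in> k" "p \<in> h" for p
    using two_points[OF Qy(6) Qw(6) kh, of s s2 p] s2 sh Qy that by auto
  have notS: "u \<notin> h \<and> u \<in> S2 - h \<and> u \<in> C" if "u \<in> X" "cir u = k" for u
    using cir_eq[OF X_C[OF that(1)] Qw(5)] that kh X_C[OF that(1)] C_S2 by auto
  have sbu: "s \<in> bar u" if "u \<in> X" "cir u = k" for u using that Qy by (simp add: bar_def)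
  have spar: "0 < par u s" "par u s < 1" if "u \<in> X" "cir u = k" for u
    using that bar_D[OF that(1) sbu[OF that]] Qy by auto
  show ?thesis
  proof (cases "s2 \<in> D")
    \<comment> \<open>Both branches from \<open>s\<close> meet \<open>h\<close> only at
      \<open>s\<close>, and one of them ends on the side of \<open>w\<close>, against
      \<open>W\<close>.\<close>
    case False
    have only: "p = s" if "u \<in> X" "cir u = k" "p \<in> mid u a b" "p \<in> h" for u p a b
    proof -
      have "p \<in> D" using meet_in_D(1)[OF that(1) Qw(5) _ that(3,4)] that kh by auto
      then show ?thesis using kh2[of p] that False mid_sub by blast
    qed
    have o0: "opp u0 \<in> X" "cir (opp u0) = k" using u0 opp_X cir_opp by auto
    have "\<not> same_side h u0 (opp u0)"
      using opposite_sides_of_crossing[OF u0(1) Qw(6) _ sh sbu[OF u0] X_bar[OF u0(1)]] spar[OF u0] par_self[OF u0(1)]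
        par_at_opp[OF u0(1)] only[OF u0] u0 kh by auto
    then have "same_side h u0 w \<or> same_side h (opp u0) w"
      using two_sides[OF Qw(5), of u0 "opp u0" w] notS[OF u0] notS[OF o0] wS by blast
    then show ?thesis using W[OF u0] W[OF o0] only[OF u0] only[OF o0] by blast
  next
    case True
    have s2b: "s2 \<in> bar u" if "u \<in> X" "cir u = k" for u using that s2 True by (simp add: bar_def)
    have "\<exists>u\<in>X. cir u = k \<and> par u s < par u s2"
    proof (cases "par u0 s < par u0 s2")
      case False
      then have "par u0 s2 < par u0 s" using par_inj[OF u0(1) s2b[OF u0] sbu[OF u0]] s2 by fastforce
      then show ?thesis using par_opp[OF u0(1)] s2b[OF u0] sbu[OF u0] u0 opp_X cir_opp
        by (intro bexI[of _ "opp u0"]) auto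
    qed (use u0 in blast)
    then obtain u where u: "u \<in> X" "cir u = k" and lt: "par u s < par u s2" by blast
    have ou: "opp u \<in> X" "cir (opp u) = k" using u opp_X cir_opp by auto
    note sb = sbu[OF u] and s2b = s2b[OF u]
    have only1: "p = s" if "p \<in> mid u a b" "p \<in> h" "par u b < par u s2" for p a b
    proof -
      have "p \<in> k" using that mid_sub u by blast
      then show ?thesis using kh2[of p] that by (auto simp: mid_def)
    qed
    have only2: "p = s2" if "p \<in> mid u a b" "p \<in> h" "par u s < par u a" for p a b
    proof -
      have "p \<in> k" using that mid_sub u by blast
      then show ?thesis using kh2[of p] that by (auto simp: mid_def)
    qed
    \<comment> \<open>Any point strictly between the two crossings serves as a test point: this
      stretch is on the side of \<open>w\<close>, and therefore both ends of \<open>k\<close> are on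
      the other side.\<close>
    define m where "m = \<delta> u ((par u s + par u s2) / 2)"
    have pb: "0 \<le> par u s" "par u s2 \<le> 1" using par u sb s2b by auto
    have mb: "m \<in> bar u" and pm: "par u m = (par u s + par u s2) / 2"
      using delta_bar[OF u(1)] par_delta[OF u(1)] pb lt by (auto simp: m_def)
    have mlt: "par u s < par u m" "par u m < par u s2" using lt pm by auto
    have mS: "m \<in> S2 - h"
    proof -
      have "m \<in> k" using mb u by (simp add: bar_def)
      then show ?thesis using kh2[of m] mlt A_S2[OF Qy(6)] by auto
    qed
    have um: "\<not> same_side h u m"
      using opposite_sides_of_crossing[OF u(1) Qw(6) _ sh sb X_bar(1)[OF u(1)] mb] spar[OF u] par_self[OF u(1)] mlt only1 u kh by auto
    have mo: "\<not> same_side h m (opp u)"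
    proof -
      have "par u s2 < 1" using bar_D[OF u(1) s2b] True by auto
      then show ?thesis
        using opposite_sides_of_crossing[OF u(1) Qw(6) _ _ s2b mb X_bar(2)[OF u(1)]] s2 par_at_opp[OF u(1)] mlt only2 u kh by auto
    qed
    have "\<not> same_side h u w" using W[OF u] only1[OF _ _ lt] by blast
    then have mw: "same_side h m w" using two_sides[OF Qw(5), of u m w] um notS[OF u] mS wS by blast
    have "\<not> same_side h (opp u) w" using mo mw same_side_sym same_side_trans by blast
    then have ufar: "u \<in> far w" "opp u \<in> far w"
      using near[of u] near[of "opp u"] notS[OF u] notS[OF ou] \<open>\<not> same_side h u w\<close> same_side_sym by blast+
    have qk: "q w \<notin> k"
    proof
      assume qk: "q w \<in> k"
      have kw: "k = cir w"
      proof (rule ccontr)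
        assume "k \<noteq> cir w"
        then show False using g_unique[OF w Qy(6) _ qk] kh by (simp add: h_def)
      qed
      have q2: "q w = s2" using kh2[OF qk] Qw sy by auto
      have b: "bar u = bar w" using u kw by (simp add: bar_def)
      have f: "par w (q w) \<le> par w s" using q_first[OF w _ Qy(2) sh Qw(6,7)] sb b by simp
      have "u = w \<or> u = opp w" using opp_eq[OF w u(1)] u kw by auto
      then show False
      proof
        assume "u = w" then show False using f lt q2 by simp
      next
        assume "u = opp w"
        then show False using mo mw opp_opp[OF w] by simp
      qed
    qed
    let ?S = "mid u s s2"
    have kw: "p \<notin> ini w (q w)" if p: "p \<in> ?S" for p
    proof
      assume pw: "p \<in> ini w (q w)"
      have pk: "p \<in> k" using p u mid_sub by blast
      show False
      proof (cases "k = cir w")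
        case False
        then show False using ini_q(1)[OF w pw pk Qy(5)] pk qk by auto
      next
        case True
        then show False using qk Qw by auto
      qed
    qed
    have "p \<notin> C" if p: "p \<in> ?S" for p
    proof -
      have "p \<in> bar u" "0 < par u p" "par u p < 1"
        using p spar[OF u] bar_D[OF u(1) s2b] True by (auto simp: mid_def)
      then show ?thesis using bar_D[OF u(1)] DC by blast
    qed
    then have 3: "?S \<inter> ?P = {}" using kw by (auto simp: civ_def)
    have 2: "?S \<subseteq> G \<union> h"
    proof
      fix p assume p: "p \<in> ?S"
      show "p \<in> G \<union> h"
      proof (cases "p \<in> h")
        case False
        have pbu: "p \<in> bar u" using p by (simp add: mid_def)
        have ps: "par u s < par u p" "par u p < par u s2"
        proof -
          have "p \<noteq> s" "p \<noteq> s2" using False sh s2 by auto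
          then have "par u p \<noteq> par u s" "par u p \<noteq> par u s2"
            using par_inj[OF u(1) pbu sb] par_inj[OF u(1) pbu s2b] by blast+
          then show "par u s < par u p" "par u p < par u s2" using p by (auto simp: mid_def)
        qed
        have *: "same_side h a b" if "a \<in> bar u" "b \<in> bar u" "par u s < par u a" "par u a \<le> par u b" "par u b < par u s2" for a b
        proof (rule same_side_connected)
          show "connected (mid u a b)" using mid_path_connected(2)[OF u(1)] that by auto
          show "mid u a b \<subseteq> S2 - h"
          proof
            fix x assume x: "x \<in> mid u a b"
            then have "x \<noteq> s" "x \<noteq> s2" using that by (auto simp: mid_def)
            moreover have "x \<in> k" using x mid_sub u by blast
            ultimately show "x \<in> S2 - h" using kh2[of x] A_S2[OF Qy(6)] by auto
          qed
        qed (use that in \<open>auto simp: mid_def\<close>)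
        have "same_side h m p"
        proof (cases "par u m \<le> par u p")
          case True then show ?thesis using *[OF mb pbu] mlt ps by auto
        next
          case False then show ?thesis using *[OF pbu mb] mlt ps same_side_sym by auto
        qed
        then show ?thesis using G_same_side mw same_side_sym same_side_trans by blast
      qed auto
    qed
    have 4: "s \<in> ?S" "s2 \<in> ?S" using lt sb s2b by (auto simp: mid_def)
    have "s2 \<in> ini y (q w)"
      using Z[OF mid_path_connected(2)[OF u(1) sb s2b] 2 3 4] s2 by auto
    moreover have "s2 \<noteq> q w" using qk s2 by auto
    ultimately show ?thesis
      using hump_I[of y w u s s2] kh u ufar sy s2 Qy True lt by (simp add: k_def s_def h_def flip: y_def)
  qed
qed

text \<open>If a branch of a hump over \<open>g w\<close> ended beyond \<open>y\<close>, it would form a crosscut of the far side of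
  \<open>g w\<close>, interleaving with the one that follows \<open>C\<close> from \<open>nend w\<close> to \<open>y\<close> and then \<open>cir y\<close>.\<close>

lemma hump_end_before:
  assumes w: "w \<in> X" and u: "u \<in> X" "cir u \<noteq> g w" "u \<in> far w"
    and r: "r \<in> ini (nend w) (q w)" "r \<in> bar u" "r \<noteq> q w" "\<And>p. p \<in> ini u r \<Longrightarrow> p \<in> g w \<Longrightarrow> p = r"
    and y: "y \<in> X" "cir y \<noteq> g w" "y \<in> far w"
    and dis: "ini u r \<inter> cir y = {}" "cir y \<inter> ini (nend w) (q w) = {}" and t0: "t0 \<in> cir y" "t0 \<in> g w" "t0 \<in> D"
  shows "pos w u < pos w y"
proof (rule ccontr)
  assume no: "\<not> ?thesis"
  note n = nend[OF w] and Qw = q[OF w]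
  define e z h where "e = nend w" and "z = opp (nend w)" and "h = g w"
  note n = n[folded z_def, folded e_def, folded h_def] and Qw = Qw[folded h_def]
  have C: "w \<in> C" "u \<in> C" "y \<in> C" using w u y X_C by auto
  have uy: "u \<noteq> y"
  proof
    assume "u = y"
    then have "u \<in> ini u r \<inter> cir y" using ini_I[OF u(1) r(2)] cir(4)[OF y(1)] by auto
    then show False using dis by auto
  qed
  then have lt: "pos w y < pos w u" using no pos_eq[OF C(1) C(2,3)] by auto
  have fy: "pos w e < pos w y" "pos w y < pos w z" and fu: "pos w e < pos w u" "pos w u < pos w z"
    using y u by (auto simp: far_def e_def z_def)
  define T where "T = {p \<in> bar y. p \<in> D \<and> p \<in> h}"
  have "T \<subseteq> cir y \<inter> h" by (auto simp: T_def bar_def)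
  then have T: "finite T" by (rule finite_subset) (use finite_meet[OF cir(2)[OF y(1)] Qw(6)] y in \<open>simp add: h_def\<close>)
  have "t0 \<in> T" using t0 by (auto simp: T_def bar_def h_def)
  then have Tn: "T \<noteq> {}" by auto
  \<comment> \<open>\<open>cir y\<close> is followed only to its first meeting with \<open>h\<close>
    in \<open>D\<close>, so that the crosscut touches \<open>h\<close> nowhere but at its
    ends.\<close>
  define t where "t = arg_min_on (par y) T"
  have "t \<in> T" unfolding t_def using T Tn by (rule arg_min_if_finite(1))
  then have t: "t \<in> bar y" "t \<in> D" "t \<in> h" "t \<in> cir y" by (auto simp: T_def bar_def)
  have tmin: "par y t \<le> par y p" if "p \<in> T" for p
    using arg_min_if_finite(2)[OF T Tn] that unfolding t_def by (metis not_le)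
  have only_t: "p = t" if p: "p \<in> ini y t" "p \<in> h" for p
  proof -
    have "p \<in> D" "p \<in> bar y" using meet_in_D[OF y(1) Qw(5) _ p] y by (auto simp: h_def)
    then have "par y t \<le> par y p" using tmin p by (auto simp: T_def)
    then show ?thesis using p par_inj[OF y(1) \<open>p \<in> bar y\<close> t(1)] by (auto simp: mid_def)
  qed
  have tbe: "t \<in> bar e" using t n by (simp add: bar_def)
  have qbe: "q w \<in> bar e" using q_nend[OF w] by (simp add: e_def)
  have tgt: "par e (q w) < par e t"
  proof (rule ccontr)
    assume "\<not> ?thesis"
    then have "t \<in> ini e (q w)" using tbe par[OF n(1) tbe] par_self[OF n(1)] by (auto simp: mid_def)
    then show False using dis t by (auto simp: e_def)
  qed
  have ynh: "y \<notin> h" using y cir_eq[OF C(3) Qw(5)] by (auto simp: h_def)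
  have unh: "u \<notin> h" using u cir_eq[OF C(2) Qw(5)] by (auto simp: h_def)
  define G where "G = connected_component_set (S2 - h) y"
  have G: "G \<in> components (S2 - h)" using ynh C C_S2 by (auto simp: G_def components_def)
  have G_same_side: "p \<in> G" if "same_side h y p" for p using that by (simp add: G_def same_side_def)
  have far: "p \<in> G" if "p \<in> far w" for p using far_same_side[OF w y(3) that] G_same_side by (simp add: h_def)
  have inG: "p \<in> G" if v: "v \<in> X" "v \<in> far w" and b: "b \<in> bar v" "\<And>p. p \<in> ini v b \<Longrightarrow> p \<in> h \<Longrightarrow> p = b"
    and p: "p \<in> ini v b" "p \<noteq> b" for v b p
  proof -
    have "same_side h v p" using ini_same_side[OF v(1) b p] .
    moreover have "same_side h y v" using far_same_side[OF w y(3) v(2)] by (simp add: h_def)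
    ultimately show ?thesis using G_same_side same_side_trans by blast
  qed
  have civ1: "civ e y = {p \<in> C. pos w e \<le> pos w p \<and> pos w p \<le> pos w y}"
    using civ_pos[OF C(1) n(7) C(3)] fy by simp
  have civ2: "civ u z = {p \<in> C. pos w u \<le> pos w p \<and> pos w p \<le> pos w z}"
    using civ_pos[OF C(1,2) n(8)] fu by simp
  note cv1 = civ_path_connected[OF n(7) C(3)] and cv2 = civ_path_connected[OF C(2) n(8)]
  \<comment> \<open>The interleaving pair: \<open>?P\<close> ends at \<open>e\<close> and
    \<open>t\<close>, while \<open>?S\<close> touches \<open>cir e\<close> at \<open>r\<close> and
    \<open>z\<close>, and the order along the arc is \<open>e\<close>, \<open>r\<close>,
    \<open>t\<close>, \<open>z\<close>.\<close>
  let ?P = "civ e y \<union> ini y t" and ?S = "ini u r \<union> civ u z"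
  have P1: "path_connected ?P"
    using ini_connected(1)[OF y(1) t(1)] cv1 ini_I[OF y(1) t(1)]
    by (intro path_connected_Un) auto
  have P2: "e \<in> ?P" "t \<in> ?P" using cv1 ini_I[OF y(1) t(1)] by auto
  have c1G: "p \<in> G" if "p \<in> civ e y" "p \<noteq> e" for p
  proof -
    have "p \<in> C" "pos w e < pos w p" "pos w p < pos w z"
      using that fy pos_eq[OF C(1) _ n(7), of p] by (auto simp: civ1)
    then show ?thesis by (intro far) (simp add: far_def e_def z_def)
  qed
  have P3: "?P \<subseteq> G \<union> {e, t}" using c1G inG[OF y(1,3) t(1) only_t] by blast
  have S1: "connected ?S"
    using ini_connected(2)[OF u(1) r(2)] cv2 ini_I[OF u(1) r(2)]
    by (intro connected_Un) auto
  have c2G: "p \<in> G" if "p \<in> civ u z" "p \<noteq> z" for p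
  proof -
    have "p \<in> C" "pos w e < pos w p" "pos w p < pos w z"
      using that fu pos_eq[OF C(1) _ n(8), of p] by (auto simp: civ2)
    then show ?thesis by (intro far) (simp add: far_def e_def z_def)
  qed
  have rh: "r \<in> h" using r(1) mid_sub(1) n(2) by (auto simp: e_def)
  have zh: "z \<in> h" using n(11) by blast
  have "p \<in> G" if "p \<in> ini u r" "p \<noteq> r" for p
    using inG[OF u(1,3) r(2) _ that] r(4) by (auto simp: h_def)
  then have S2: "?S \<subseteq> G \<union> cir e" using c2G rh zh n(2) by blast
  have "p \<notin> ?P" if p: "p \<in> ini u r" for p
  proof
    assume "p \<in> ?P"
    then show False
    proof
      assume pc: "p \<in> civ e y"
      then have "p = u"
      proof -
        have "r \<in> D" using meet_in_D(1)[OF u(1) Qw(5) _ _ rh] ini_I[OF u(1) r(2)] u by (auto simp: h_def)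
        then show ?thesis using ini_C[OF u(1) p _ _ r(2)] pc by (auto simp: civ_def)
      qed
      then show False using pc lt by (auto simp: civ1)
    next
      assume "p \<in> ini y t"
      then have "p \<in> cir y" using mid_sub by blast
      then show False using dis p by auto
    qed
  qed
  moreover have "p \<notin> ?P" if p: "p \<in> civ u z" for p
  proof
    assume "p \<in> ?P"
    then show False
    proof
      assume "p \<in> civ e y" then show False using p lt by (auto simp: civ1 civ2)
    next
      assume "p \<in> ini y t"
      then have "p = y" using ini_C[OF y(1) _ _ t(2,1)] p by (auto simp: civ_def)
      then show False using p lt by (auto simp: civ2)
    qed
  qed
  ultimately have S3: "?S \<inter> ?P = {}" by auto
  have rt: "r \<in> ini e t" using r(1) tgt by (auto simp: mid_def e_def)
  have zt: "z \<notin> ini e t"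
    using par_at_opp[OF n(1)] bar_D[OF n(1) tbe] t by (auto simp: mid_def z_def e_def)
  have te: "t \<in> cir e" using t n by auto
  have Gc: "G \<in> components (S2 - cir e)" using G n by simp
  have rS: "r \<in> ?S" using ini_I[OF u(1) r(2)] by blast
  have zS: "z \<in> ?S" using cv2 by blast
  have ze: "z \<in> cir e" using zh n(2) by simp
  show False
    by (rule sep_circle[OF n(1) te t(2) Gc P1 P2 P3 S1 S2 S3 rS rt zS ze zt])
qed


subsection \<open>Triangles on one side\<close>

text \<open>\<open>w\<close> and \<open>nend w\<close> are the right and left corners on
  \<open>C\<close> of a future triangle, whose third corner is \<open>q w\<close>.\<close>

definition triangle_base where "triangle_base w \<longleftrightarrow> w \<in> X \<and> (\<forall>v\<in>X. \<not> (0 < pos w v \<and> pos w v < pos w (nend w))) \<and> q (nend w) = q w"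

text \<open>The arc of \<open>v\<close> first reaches \<open>g w\<close> from within the corner,
  hence on the boundary of the corner.\<close>

lemma same_blocker:
  assumes w: "w \<in> X" and v: "v \<in> X" "0 < pos w v" "pos w v < pos w (nend w)" "g v = g w"
  shows "q v \<in> ini (nend w) (q w)"
proof (rule ccontr)
  assume no: "\<not> ?thesis"
  note bt = between[OF w v(1-3)] and n = nend[OF w] and Qw = q[OF w] and Qv = q[OF v(1)]
  let ?y = "nend w" and ?S = "ini v (q v)"
  have qb: "q v \<in> bar ?y" "q w \<in> bar ?y" using Qv Qw n v(4) by (auto simp: bar_def)
  have "q w \<in> ini ?y (q w)" using ini_I[OF n(1) qb(2)] by simp
  then have qq: "q v \<noteq> q w" using no by auto
  have "p \<notin> ini ?y (q w)" if p: "p \<in> ?S" for p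
  proof
    assume py: "p \<in> ini ?y (q w)"
    then have "p \<in> g w" using n(2) mid_sub by blast
    then have "p = q v" using ini_q(1)[OF v(1) p _ Qw(5)] bt(3) by auto
    then show False using py no by simp
  qed
  then have "?S \<inter> ini ?y (q w) = {}" by blast
  moreover have "?S \<subseteq> D \<union> C" using mid_sub by blast
  ultimately show False
    using blocked_before_corner[OF w v(1-3) ini_connected(2)[OF v(1) Qv(1)], of "q v"]
      ini_disjoint[OF v(1) w bt(5) qq] ini_I[OF v(1) Qv(1)] Qv v(4) by auto
qed

text \<open>On the arc of \<open>w\<close> the crossing \<open>q w\<close> is not after
  \<open>q v\<close>, so a branch starting at \<open>w\<close> would meet \<open>g w\<close>
  there.\<close>

lemma branch_not_start:
  assumes w: "w \<in> X" and v: "v \<in> X" "g v \<noteq> g w"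
    and u: "u \<in> X" "cir u = g v" "ini u (q v) \<inter> g w = {}"
  shows "u \<noteq> w"
proof
  assume uw: "u = w"
  note Qw = q[OF w] and Qv = q[OF v(1)]
  have b: "q v \<in> bar w" using Qv u uw by (simp add: bar_def)
  have "par w (q w) \<le> par w (q v)"
    using q_first[OF w b Qv(2,3) cir(2)[OF v(1)]] Qv(7) u uw by auto
  then have "q w \<in> ini w (q v)" using Qw par[OF w Qw(1)] par_self[OF w] by (auto simp: mid_def)
  then show False using u uw Qw by auto
qed

lemma X_finite: "finite X"
proof -
  have "X \<subseteq> (\<Union>E\<in>A - {C}. E \<inter> C)" by (auto simp: X_def)
  moreover have "finite (\<Union>E\<in>A - {C}. E \<inter> C)"
    by (rule finite_UN_I) (use arrangement_finite[OF arr] finite_meet CA in auto)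
  ultimately show ?thesis by (rule finite_subset)
qed

text \<open>Betweenness is independent of the base point as long as the interval from
  \<open>w\<close> to \<open>y\<close> does not run past \<open>x\<close>.\<close>

lemma pos_rel: assumes "x \<in> C" "w \<in> C" "p \<in> C" "y \<in> C" "pos x w < pos x y"
  shows "(0 < pos w p \<and> pos w p < pos w y) \<longleftrightarrow> (pos x w < pos x p \<and> pos x p < pos x y)"
  using pos_shift[OF assms(1,2,3)] pos_shift[OF assms(1,2,4)] pos_range[OF assms(1,3)] pos_range[OF assms(1,4)] assms(5)
  by (cases "pos x w \<le> pos x p") auto

text \<open>The inequality \<open>pos x w < pos x (nend w)\<close> says that the base does not run
  past \<open>x\<close>. It is needed to carry a base found in $K_v$ over to $K_x$, and again to
  tell the two final triangles apart. The proof assumes that $K_x$ contains no base.\<close>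

lemma exists_triangle_base_aux:
  assumes x: "x \<in> X"
    and IH: "\<And>v. v \<in> X \<Longrightarrow> pos v (opp (nend v)) < pos x (opp (nend x)) \<Longrightarrow>
      \<exists>w. triangle_base w \<and> pos v w < pos v (nend w) \<and> pos v (nend w) \<le> pos v (opp (nend v))"
  shows "\<exists>w. triangle_base w \<and> pos x w < pos x (nend w) \<and> pos x (nend w) \<le> pos x (opp (nend x))"
proof (rule ccontr)
  assume noS: "\<not> ?thesis"
  define a where "a = pos x"
  define Y Z where "Y = a (nend x)" and "Z = a (opp (nend x))"
  have xC: "x \<in> C" using x X_C by auto
  have YZ: "Y < Z" "Z < 1" using nend[OF x] pos_range[OF xC] by (auto simp: Y_def Z_def a_def)
  have ar: "0 \<le> a p" "a p < 1" if "p \<in> C" for p using pos_range[OF xC that] by (auto simp: a_def)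
  have sh: "pos v p = (if a v \<le> a p then a p - a v else a p - a v + 1)" if "v \<in> C" "p \<in> C" for v p
    using pos_shift[OF xC that] by (simp add: a_def)
  have ainj: "a p = a p' \<longleftrightarrow> p = p'" if "p \<in> C" "p' \<in> C" for p p' using pos_eq[OF xC that] by (simp add: a_def)
  have noS': False if "triangle_base w" "a w < a (nend w)" "a (nend w) \<le> Z" for w
    using noS that by (auto simp: a_def Z_def)
  have baseX: "w \<in> X" if "triangle_base w" for w using that by (simp add: triangle_base_def)
  \<comment> \<open>Such a $K_v$ starts strictly left of \<open>x\<close> and ends within $K_x$, so
    it is shorter and the induction hypothesis gives a base.\<close>
  have short0: False if v: "v \<in> X" "0 < a v" "a v < a (nend v)" "a (nend v) \<le> Z" "a v < a (opp (nend v))" "a (opp (nend v)) \<le> Z" for v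
  proof -
    have vC: "v \<in> C" using v X_C by auto
    note n = nend[OF v(1)]
    have l: "pos v (opp (nend v)) = a (opp (nend v)) - a v" using sh[OF vC n(8)] v by auto
    then have "pos v (opp (nend v)) < pos x (opp (nend x))" using v by (simp add: Z_def a_def)
    then obtain w where w: "triangle_base w" "pos v w < pos v (nend w)" "pos v (nend w) \<le> pos v (opp (nend v))"
      using IH[OF v(1)] by blast
    have wC: "w \<in> C" "nend w \<in> C" using baseX[OF w(1)] nend X_C by auto
    have "a w < a (nend w) \<and> a (nend w) \<le> Z"
      using w sh[OF vC wC(1)] sh[OF vC wC(2)] l ar[OF wC(1)] ar[OF wC(2)] ar[OF n(8)] v by (auto split: if_splits)
    then show False using noS' w by blast
  qed
  have short: False if v: "v \<in> X" "0 < a v" and u: "u \<in> X" "cir u = g v" "a v < a u" "a u \<le> Z" "a v < a (opp u)" "a (opp u) \<le> Z" for v u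
  proof -
    have "u = nend v \<or> u = opp (nend v)" using end_cases[OF v(1) u(1,2)] .
    then show False using short0[OF v] u opp_opp[OF nend(1)[OF v(1)]] by auto
  qed
  define valid where "valid w \<longleftrightarrow> w \<in> X \<and> a w < a (nend w) \<and> a (nend w) \<le> Y" for w
  \<comment> \<open>The range includes \<open>v = nend w\<close>, which matters when the base has no
    endpoint inside.\<close>
  define clean where "clean w \<longleftrightarrow> (\<forall>v\<in>X. a w < a v \<and> a v \<le> a (nend w) \<longrightarrow> \<not> hump w v)" for w
  have ax: "a x = 0" by (simp add: a_def)
  have "valid x" using x nend[OF x] ax by (simp add: valid_def Y_def a_def)
  \<comment> \<open>The ends of a hump over the corner of \<open>x\<close> lie strictly between
    \<open>Y\<close> and \<open>Z\<close>, hence left of \<open>v\<close>, so \<open>short\<close>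
    applies.\<close>
  moreover have "clean x"
    unfolding clean_def
  proof (intro ballI impI notI)
    fix v assume v: "v \<in> X" "a x < a v \<and> a v \<le> a (nend x)" "hump x v"
    then obtain u where u: "u \<in> X" "cir u = g v" "u \<in> far x" "opp u \<in> far x" by (meson hump.cases)
    have "Y < a u" "a u < Z" "Y < a (opp u)" "a (opp u) < Z" using u by (auto simp: far_def Y_def Z_def a_def)
    then show False using short[OF v(1) _ u(1,2)] v ax by (auto simp: Y_def)
  qed
  ultimately have xin: "x \<in> {w. valid w \<and> clean w}" by simp
  have fin: "finite {w. valid w \<and> clean w}"
    by (rule finite_subset[OF _ X_finite]) (auto simp: valid_def)
  obtain w where w: "valid w" "clean w" and wmax: "\<And>w'. valid w' \<Longrightarrow> clean w' \<Longrightarrow> a w' \<le> a w"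
  proof -
    let ?W = "{w. valid w \<and> clean w}"
    have "Max (a ` ?W) \<in> a ` ?W" using fin xin by (intro Max_in) auto
    then obtain w where "w \<in> ?W" "a w = Max (a ` ?W)" by auto
    moreover have "a w' \<le> Max (a ` ?W)" if "w' \<in> ?W" for w' using fin that by (intro Max_ge) auto
    ultimately show thesis using that by auto
  qed
  have wX: "w \<in> X" and wv: "a w < a (nend w)" "a (nend w) \<le> Y" using w by (auto simp: valid_def)
  have wC: "w \<in> C" using wX X_C by auto
  note n = nend[OF wX] and Qw = q[OF wX]
  define y h where "y = nend w" and "h = g w"
  have yX: "y \<in> X" "y \<in> C" "cir y = h" using n by (auto simp: y_def h_def)
  have wy: "a w < a y" "a y \<le> Y" using wv by (auto simp: y_def)
  have btw: "0 < pos w p \<and> pos w p < pos w y \<longleftrightarrow> a w < a p \<and> a p < a y" if "p \<in> C" for p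
    using pos_rel[OF xC wC that yX(2)] wy by (simp add: a_def)
  have no_hump: "\<not> hump w v" if "v \<in> X" "a w < a v" "a v \<le> a y" for v
    using w(2) that by (auto simp: clean_def y_def)
  \<comment> \<open>Obstructions that yield a better \<open>w\<close>: the arc of \<open>v\<close>
    is blocked by \<open>h\<close> itself, or one branch of its blocker falls back on the base to
    the left of \<open>v\<close> while the other leaves through \<open>h\<close>.\<close>
  define L where "L = {v \<in> X. a w < a v \<and> a v < a y \<and> (g v = h \<or> (g v \<noteq> h \<and>
      (\<exists>u\<in>X. cir u = g v \<and> ini u (q v) \<inter> h = {} \<and> a v < a u \<and> a u < a y \<and> ini (opp u) (q v) \<inter> h \<noteq> {})))}"
  have meets: "\<not> (ini u (q v) \<inter> h \<noteq> {} \<and> ini (opp u) (q v) \<inter> h \<noteq> {})"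
    if v: "v \<in> X" "a w < a v" "a v < a y" "g v \<noteq> h" and u: "u \<in> X" "cir u = g v" for v u
  proof
    assume m: "ini u (q v) \<inter> h \<noteq> {} \<and> ini (opp u) (q v) \<inter> h \<noteq> {}"
    have "0 < pos w v" "pos w v < pos w (nend w)" using btw[of v] v X_C by (auto simp: y_def)
    then have "hump w v" using hump_if_branches_meet[OF wX v(1) _ _ _ u] v(4) m by (auto simp: h_def)
    then show False using no_hump v by auto
  qed
  have L0: "L = {}"
  proof (rule ccontr)
    assume "L \<noteq> {}"
    have "finite L" by (rule finite_subset[OF _ X_finite]) (auto simp: L_def)
    \<comment> \<open>The leftmost element of \<open>L\<close> turns out to be valid and clean,
      against the choice of \<open>w\<close>.\<close>
    then obtain w' where w': "w' \<in> L" and wlast: "\<And>v. v \<in> L \<Longrightarrow> a v \<le> a w'"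
      using \<open>L \<noteq> {}\<close> arg_min_if_finite[of L "\<lambda>v. - a v"] by (metis not_le neg_less_iff_less)
    have w'X: "w' \<in> X" "a w < a w'" "a w' < a y" using w' by (auto simp: L_def)
    have w'C: "w' \<in> C" using w'X X_C by auto
    note n' = nend[OF w'X(1)] and Q' = q[OF w'X(1)]
    have bt': "0 < pos w w'" "pos w w' < pos w (nend w)" using btw[OF w'C] w'X by (auto simp: y_def)
    have "valid w' \<and> clean w'"
    proof (cases "g w' = h")
      case True
      have ne: "nend w' = y"
      proof (rule ccontr)
        assume "nend w' \<noteq> y"
        then have "nend w' = opp y" using end_cases[OF wX n'(1)] n' True by (auto simp: y_def h_def)
        then have "opp (nend w') = y" using opp_opp[OF yX(1)] by simp
        then have "pos w' (opp y) < pos w' y" using n'(3) \<open>nend w' = opp y\<close> by simp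
        moreover have "pos w y < pos w (opp y)" using n by (simp add: y_def)
        moreover have "opp y \<in> C" using n by (simp add: y_def)
        ultimately show False using sh[OF w'C, of y] sh[OF w'C, of "opp y"] sh[OF wC, of y] sh[OF wC, of "opp y"] yX w'X ar[of "opp y"] ar[of y]
          by (auto split: if_splits)
      qed
      have "valid w'" using w'X ne wy by (simp add: valid_def)
      moreover have "clean w'"
        unfolding clean_def
      proof (intro ballI impI notI)
        fix v assume v: "v \<in> X" "a w' < a v \<and> a v \<le> a (nend w')" "hump w' v"
        from v(3) show False
        proof cases
          case (hump_I u r r')
          note H = this
        \<comment> \<open>The corner of \<open>w'\<close> has the same far interval as that of
          \<open>w\<close> and a shorter piece of \<open>h\<close> as boundary, so a hump over it is
          also a hump over the corner of \<open>w\<close>.\<close>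
        have far: "far w' = far w" using far_civ(1)[OF w'X(1)] far_civ(1)[OF wX] ne by (simp add: y_def)
        have qle: "par y (q w') \<le> par y (q w)"
          using same_blocker[OF wX w'X(1) bt'] True by (simp add: h_def y_def mid_def)
        have rr: "p \<in> ini y (q w)" "p \<noteq> q w" if p: "p \<in> ini y (q w')" "p \<noteq> q w'" for p
        proof -
          show "p \<in> ini y (q w)" using p qle by (auto simp: mid_def)
          have pb: "p \<in> bar y" using p by (simp add: mid_def)
          have qb: "q w' \<in> bar y" using q_nend[OF w'X(1)] ne by simp
          show "p \<noteq> q w" using p qle par_inj[OF yX(1) pb qb] by (auto simp: mid_def)
        qed
        have "hump w v"
          using hump.intros[of v w u r r'] H rr[of r] rr[of r'] True far ne by (simp add: h_def flip: y_def)
        then show False using no_hump v ne w'X by auto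
        qed
      qed
      ultimately show ?thesis by simp
    next
      case False
      then obtain e where e: "e \<in> X" "cir e = g w'" "ini e (q w') \<inter> h = {}" "a w' < a e" "a e < a y" "ini (opp e) (q w') \<inter> h \<noteq> {}"
        using w' by (auto simp: L_def)
      define e' where "e' = opp e"
      have e'X: "e' \<in> X" "cir e' = g w'" using e opp_X cir_opp by (auto simp: e'_def)
      have eC: "e \<in> C" "e' \<in> C" using e e'X X_C by auto
      \<comment> \<open>If the other end also lay in $K_x$ to the left of \<open>w'\<close>,
        \<open>short\<close> would apply. So it lies elsewhere, and \<open>e\<close> is the near
        end.\<close>
      have "\<not> (a w' < a e' \<and> a e' \<le> Z)"
        using short[OF w'X(1) _ e(1,2)] e wy YZ w'X ar[OF wC] by (auto simp: e'_def)
      moreover have "a e' \<noteq> a w'" using ainj[OF eC(2) w'C] e'X Q' by auto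
      ultimately have e'out: "a e' < a w' \<or> Z < a e'" by auto
      have pe: "pos w' e = a e - a w'" using sh[OF w'C eC(1)] e by auto
      have py: "pos w' y = a y - a w'" using sh[OF w'C yX(2)] w'X by auto
      have pe': "a y - a w' < pos w' e'" using sh[OF w'C eC(2)] e'out wy YZ ar[OF eC(2)] ar[OF yX(2)] by (auto split: if_splits)
      have ne: "nend w' = e"
      proof (rule ccontr)
        assume "nend w' \<noteq> e"
        then have "nend w' = e'" using end_cases[OF w'X(1) e(1,2)] opp_opp[OF n'(1)] by (auto simp: e'_def)
        then have "pos w' e' < pos w' e" using n'(3) opp_opp[OF e(1)] by (simp add: e'_def)
        then show False using pe pe' e by auto
      qed
      have "valid w'" using w'X ne e wy by (simp add: valid_def)
      have yfar: "y \<in> far w'" using pe py pe' e yX ne by (simp add: far_def e'_def)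
      obtain t0 where t0: "t0 \<in> ini e' (q w')" "t0 \<in> h" using e by (auto simp: e'_def)
      have hA: "h \<in> A - {C}" using Qw by (simp add: h_def)
      have t0': "t0 \<in> D" "t0 \<in> g w'"
        using meet_in_D[OF e'X(1) hA _ t0] e'X False by auto
      have "clean w'"
        unfolding clean_def
      proof (intro ballI impI notI)
        fix v assume v: "v \<in> X" "a w' < a v \<and> a v \<le> a (nend w')" "hump w' v"
        from v(3) show False
        proof cases
          case (hump_I u r r')
          note H = this
        note Qv = q[OF v(1)]
        have kh: "g v \<noteq> h"
        proof
          assume "g v = h"
          then have "r \<in> ini e (q w') \<inter> h" using H ne by auto
          then show False using e by auto
        qed
        have rg: "r \<in> g w'" "r' \<in> g w'" using H(6,7) n'(2) mid_sub by blast+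
        have only: "p = r \<or> p = r'" if "p \<in> g v" "p \<in> g w'" for p
          using two_points[OF Qv(6) Q'(6) H(1), of r r' p] H rg that by auto
        have av: "a w < a v" "a v < a y" "0 < a v" using v w'X ne e ar[OF w'C] by auto
        have bu: "p \<in> bar u" "p \<in> bar (opp u)" if "p \<in> g v" "p \<in> D" for p
          using that H cir_opp by (auto simp: bar_def)
        \<comment> \<open>A branch of the hump that avoids \<open>h\<close> must end before
          \<open>y\<close>: \<open>hump_end_before\<close> is applied to the corner of
          \<open>w'\<close>, with \<open>h\<close> running from \<open>y\<close> to a meeting point
          with \<open>g w'\<close>, which exists because of \<open>t0\<close>.\<close>
        have esc: "a e < a U \<and> a U < a y"
          if U: "U \<in> X" "cir U = g v" "U \<in> far w'" "ini U (q v) \<inter> h = {}"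
            and R: "R \<in> ini e (q w')" "R \<in> g v" "R \<in> D" "R \<noteq> q w'" "par U R \<le> par U (q v)"
              "\<And>p. p \<in> ini U R \<Longrightarrow> p \<in> g w' \<Longrightarrow> p = R" for U R
        proof -
          have UC: "U \<in> C" using U X_C by auto
          have Rb: "R \<in> bar U" using R U by (simp add: bar_def)
          have d1: "ini U R \<inter> cir y = {}"
          proof -
            have "ini U R \<subseteq> ini U (q v)" using R by (auto simp: mid_def)
            then show ?thesis using U yX by auto
          qed
          have d2: "cir y \<inter> ini (nend w') (q w') = {}" using e ne yX by auto
          have "pos w' U < pos w' y"
            by (rule hump_end_before[OF w'X(1) U(1) _ U(3) _ Rb R(4) R(6) yX(1) _ yfar d1 d2 _ t0'(2,1)])
              (use U H ne R yX False t0 in auto)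
          moreover have "pos w' e < pos w' U" using U ne by (simp add: far_def)
          ultimately show ?thesis
            using pe py sh[OF w'C UC] e e'out ar[OF UC] ar[OF yX(2)] by (auto split: if_splits)
        qed
        have c1: "a e < a u \<and> a u < a y" if "ini u (q v) \<inter> h = {}"
        proof (rule esc[OF H(2,3,4) that])
          show "p = r" if p: "p \<in> ini u r" "p \<in> g w'" for p
          proof -
            have "p \<in> g v" using p H(3) mid_sub by blast
            then have "p = r \<or> p = r'" using only p by blast
            then show ?thesis using p H(14) by (auto simp: mid_def)
          qed
        qed (use H ne in auto)
        have oX: "opp u \<in> X" "cir (opp u) = g v" using H opp_X cir_opp by auto
        have po: "par (opp u) p = 1 - par u p" if "p \<in> g v" "p \<in> D" for p
          using par_opp[OF H(2) bu(1)[OF that]] .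
        have qvD: "q v \<in> g v" "q v \<in> D" using Qv by auto
        have c2: "a e < a (opp u) \<and> a (opp u) < a y" if "ini (opp u) (q v) \<inter> h = {}"
        proof (rule esc[OF oX H(5) that])
          show "p = r'" if p: "p \<in> ini (opp u) r'" "p \<in> g w'" for p
          proof -
            have "p \<in> g v" using p oX mid_sub by blast
            then have "p = r \<or> p = r'" using only p by blast
            then show ?thesis using p H(14) po[OF H(8,10)] po[OF H(9,11)] by (auto simp: mid_def)
          qed
          show "par (opp u) r' \<le> par (opp u) (q v)"
            using po[OF H(9,11)] po[OF qvD] H by auto
        qed (use H ne in auto)
        have ve: "a v \<le> a e" using v ne by auto
        have vL: "v \<notin> L" using wlast[of v] v by auto
        \<comment> \<open>If both branches avoid \<open>h\<close>, \<open>short\<close> applies; if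
          exactly one does, \<open>v\<close> is an element of \<open>L\<close> left of
          \<open>w'\<close>; if none does, there is a hump over the corner of
          \<open>w\<close>.\<close>
        consider "ini u (q v) \<inter> h = {}" "ini (opp u) (q v) \<inter> h = {}"
          | "ini u (q v) \<inter> h = {}" "ini (opp u) (q v) \<inter> h \<noteq> {}"
          | "ini u (q v) \<inter> h \<noteq> {}" "ini (opp u) (q v) \<inter> h = {}"
          | "ini u (q v) \<inter> h \<noteq> {}" "ini (opp u) (q v) \<inter> h \<noteq> {}" by blast
        then show False
        proof cases
          case 1
          then show False using short[OF v(1) av(3) H(2,3)] c1 c2 ve wy YZ by auto
        next
          case 2
          then have "v \<in> L" unfolding L_def using v(1) av kh H(2,3) c1 ve by auto
          then show False using vL by simp
        next
          case 3
          have "opp (opp u) = u" using opp_opp H by auto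
          then have "v \<in> L" unfolding L_def using 3 v(1) av kh oX c2 ve by (auto intro!: bexI[of _ "opp u"])
          then show False using vL by simp
        next
          case 4
          then show False using meets[OF v(1) av(1,2) kh H(2,3)] by blast
        qed
        qed
      qed
      then show ?thesis using \<open>valid w'\<close> by simp
    qed
    then have "a w' \<le> a w" using wmax by blast
    then show False using w'X by simp
  qed
  \<comment> \<open>As \<open>L\<close> is empty, the left neighbour of \<open>w\<close> decides. If
    it is \<open>y\<close>, then \<open>w\<close> is a base or the blocker of \<open>y\<close> makes
    a hump; otherwise every trapped branch of its blocker ends left of it, and the same four cases
    are contradictory.\<close>
  let ?N = "{v \<in> X. a w < a v \<and> a v \<le> a y}"
  have "finite ?N" using X_finite by auto
  moreover have "?N \<noteq> {}" using yX wy by blast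
  ultimately obtain v where v: "v \<in> ?N" and vmin: "\<And>v'. v' \<in> ?N \<Longrightarrow> a v \<le> a v'"
    using arg_min_if_finite[of ?N a] by (metis (no_types, lifting) not_le)
  have vX: "v \<in> X" "a w < a v" "a v \<le> a y" and vC: "v \<in> C" using v X_C by auto
  show False
  proof (cases "v = y")
    case True
    have adj: "\<not> (0 < pos w v' \<and> pos w v' < pos w (nend w))" if "v' \<in> X" for v'
    proof -
      have "\<not> (a w < a v' \<and> a v' < a y)" using vmin[of v'] that True by auto
      then show ?thesis using btw[of v'] that X_C by (auto simp: y_def)
    qed
    show False
    proof (cases "q (nend w) = q w")
      case True
      then have "triangle_base w" using wX adj by (simp add: triangle_base_def)
      then show False using noS'[of w] wy YZ by (simp add: y_def)
    next
      case False
      then have "hump w y" using hump_if_adjacent[OF wX adj] by (simp add: y_def)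
      then show False using no_hump[OF yX(1)] wy by auto
    qed
  next
    case False
    then have vy: "a v < a y" using vX ainj[OF vC yX(2)] by auto
    have vb: "0 < pos w v" "pos w v < pos w (nend w)" using btw[OF vC] vX vy by (auto simp: y_def)
    have gv: "g v \<noteq> h" using L0 vX vy by (auto simp: L_def)
    have inside: "a v < a u \<and> a u < a y" if u: "u \<in> X" "cir u = g v" "ini u (q v) \<inter> h = {}" for u
    proof -
      have gvw: "g v \<noteq> g w" "ini u (q v) \<inter> g w = {}" using gv u by (auto simp: h_def)
      have uC: "u \<in> C" using u X_C by auto
      have "pos w u < pos w y" using branch_stays[OF wX vX(1) vb gvw(1) u(1,2) gvw(2)] by (simp add: y_def)
      moreover have "u \<noteq> w" using branch_not_start[OF wX vX(1) gvw(1) u(1,2) gvw(2)] .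
      then have "0 < pos w u" using pos_pos[OF wC uC] by auto
      ultimately have "a w < a u" "a u < a y" using btw[OF uC] by auto
      then have "a v \<le> a u" using vmin[of u] u by auto
      moreover have "a v \<noteq> a u" using ainj[OF vC uC] u q(7)[OF vX(1)] by auto
      ultimately show ?thesis using \<open>a u < a y\<close> by auto
    qed
    obtain u where u: "u \<in> X" "cir u = g v" using nend[OF vX(1)] by blast
    have ou: "opp u \<in> X" "cir (opp u) = g v" "opp (opp u) = u" using u opp_X cir_opp opp_opp by auto
    have vL: "v \<notin> L" using L0 by simp
    have v0: "0 < a v" using vX ar[OF wC] by auto
    consider "ini u (q v) \<inter> h = {}" "ini (opp u) (q v) \<inter> h = {}"
      | "ini u (q v) \<inter> h = {}" "ini (opp u) (q v) \<inter> h \<noteq> {}"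
      | "ini u (q v) \<inter> h \<noteq> {}" "ini (opp u) (q v) \<inter> h = {}"
      | "ini u (q v) \<inter> h \<noteq> {}" "ini (opp u) (q v) \<inter> h \<noteq> {}" by blast
    then show False
    proof cases
      case 1
      then show False using short[OF vX(1) v0 u] inside[OF u] inside[OF ou(1,2)] wy YZ by auto
    next
      case 2
      then have "v \<in> L" unfolding L_def using vX vy gv u inside[OF u] by auto
      then show False using vL by simp
    next
      case 3
      then have "v \<in> L" unfolding L_def using vX vy gv ou inside[OF ou(1,2)] by (auto intro!: bexI[of _ "opp u"])
      then show False using vL by simp
    next
      case 4
      then show False using meets[OF vX(1,2) vy gv u] by blast
    qed
  qed
qed

text \<open>Interval lengths are real numbers, so the induction counts the endpoints with a shorter
  interval.\<close>

lemma exists_triangle_base: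
  assumes "x \<in> X"
  shows "\<exists>w. triangle_base w \<and> pos x w < pos x (nend w) \<and> pos x (nend w) \<le> pos x (opp (nend x))"
  using assms
proof (induction "card {v \<in> X. pos v (opp (nend v)) < pos x (opp (nend x))}" arbitrary: x rule: less_induct)
  case (less x)
  show ?case
  proof (rule exists_triangle_base_aux[OF less.prems])
    fix v assume v: "v \<in> X" "pos v (opp (nend v)) < pos x (opp (nend x))"
    have "{u \<in> X. pos u (opp (nend u)) < pos v (opp (nend v))} \<subset> {u \<in> X. pos u (opp (nend u)) < pos x (opp (nend x))}"
      using v by force
    then show "\<exists>w. triangle_base w \<and> pos v w < pos v (nend w) \<and> pos v (nend w) \<le> pos v (opp (nend v))"
      using less.hyps[OF psubset_card_mono v(1)] X_finite by simp
  qed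
qed


section \<open>The triangular cell over a base\<close>

lemma crossing_other: assumes "x \<in> crossings A" "x \<in> E" "E \<in> A"
  obtains F where "F \<in> A" "F \<noteq> E" "x \<in> F"
  using assms unfolding crossings_iff by metis

text \<open>The crosscut from \<open>w\<close> over \<open>q w\<close> to \<open>nend w\<close> cuts
  a region \<open>I1\<close> off \<open>D\<close>, with no crossing on its boundary besides these
  three points. A pseudocircle inside \<open>I1\<close> could not leave it to reach an end on
  \<open>C\<close>.\<close>

lemma triangle_base_cell:
  assumes t: "triangle_base w"
  shows "\<exists>T\<in>triangles A. closure T \<inter> crossings A \<inter> C = {w, nend w}"
proof -
  have w: "w \<in> X" and adj: "\<And>v. v \<in> X \<Longrightarrow> \<not> (0 < pos w v \<and> pos w v < pos w (nend w))"
    and qq: "q (nend w) = q w" using t by (auto simp: triangle_base_def)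
  define y p d h where "y = nend w" and "p = q w" and "d = cir w" and "h = g w"
  note n = nend[OF w, folded y_def h_def] and Qw = q[OF w, folded p_def h_def d_def]
  note Qy = q[OF n(1)]
  have wC: "w \<in> C" using w X_C by auto
  have wy: "w \<noteq> y" using n by auto
  have dA: "d \<in> A - {C}" "d \<in> A" "w \<in> d" using cir[OF w] by (auto simp: d_def)
  have yq: "q y = p" using qq by (simp add: y_def p_def)
  have gy: "g y = d" using g_unique[OF n(1) dA(2)] n(2) Qw yq by auto
  have pb: "p \<in> bar w" "p \<in> bar y" using Qw q_nend[OF w] by (auto simp: y_def p_def)
  have pr: "0 < par w p" "par w p < 1" "0 < par y p" "par y p < 1"
    using bar_D[OF w pb(1)] bar_D[OF n(1) pb(2)] Qw by auto
  define c where "c = subpath 0 (par w p) (\<delta> w) +++ reversepath (subpath 0 (par y p) (\<delta> y))"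
  have im: "path_image (subpath 0 (par v p) (\<delta> v)) = ini v p" if "v \<in> X" "p \<in> bar v" for v
    using mid_image[OF that(1) X_bar(1)[OF that(1)] that(2)] par[OF that] par_self[OF that(1)]
    by (simp add: path_image_subpath)
  have iw: "x = p" if "x \<in> ini w p" "x \<in> F" "F \<in> A - {C}" "F \<noteq> d" for x F
    using ini_q(1)[OF w, of x F] that by (simp add: p_def d_def)
  have iw': "F = h" if "x \<in> ini w p" "x \<in> F" "F \<in> A - {C}" "F \<noteq> d" for x F
    using ini_q(2)[OF w, of x F] that by (simp add: p_def d_def h_def)
  have iy: "x = p" if "x \<in> ini y p" "x \<in> F" "F \<in> A - {C}" "F \<noteq> h" for x F
    using ini_q(1)[OF n(1), of x F] that yq n(2) by simp
  have iy': "F = d" if "x \<in> ini y p" "x \<in> F" "F \<in> A - {C}" "F \<noteq> h" for x F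
    using ini_q(2)[OF n(1), of x F] that yq n(2) gy by simp
  have sub: "ini w p \<subseteq> d" "ini y p \<subseteq> h" using mid_sub(1) n(2) by (auto simp: d_def)
  have int: "ini w p \<inter> ini y p = {p}"
    using iw[OF _ _ Qw(5,7)] sub ini_I[OF w pb(1)] ini_I[OF n(1) pb(2)] by blast
  have cP: "path_image c = ini w p \<union> ini y p"
    using im[OF w pb(1)] im[OF n(1) pb(2)] par(3)[OF w pb(1)] par(3)[OF n(1) pb(2)]
    unfolding c_def by (subst path_image_join) auto
  have c: "arc c" "pathstart c = w" "pathfinish c = y"
    unfolding c_def
    using im[OF w pb(1)] im[OF n(1) pb(2)] par(3)[OF w pb(1)] par(3)[OF n(1) pb(2)] pr int
      delta(1,2)[OF w] delta(1,2)[OF n(1)]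
    by (auto intro!: arc_join arc_reversepath arc_subpath_arc)
  obtain c1 c2 where cc: "arc c1" "pathstart c1 = w" "pathfinish c1 = y" "path_image c1 = civ w y"
    "arc c2" "pathstart c2 = w" "pathfinish c2 = y" "path_image c2 = civ y w"
    "path_image c1 \<inter> path_image c2 = {w, y}" "path_image c1 \<union> path_image c2 = C"
    using C_arcs[OF wC n(7) wy] by metis
  have PC: "path_image c \<inter> C = {w, y}"
    using ini_C[OF w _ _ Qw(2) pb(1)] ini_C[OF n(1) _ _ Qw(2) pb(2)] ini_I[OF w pb(1)] ini_I[OF n(1) pb(2)] wC n(7)
    unfolding cP by blast
  have PDC: "path_image c \<subseteq> D \<union> C" using mid_sub(2)[of w w p] mid_sub(2)[of y y p] unfolding cP by auto
  have i1: "path_image c1 \<inter> path_image c = {w, y}" and i2: "path_image c2 \<inter> path_image c = {w, y}"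
    using PC cc(9,10) by blast+
  have CS: "C \<noteq> S2" using A_ne_S2[OF CA dA(2)] dA by auto
  have PD: "path_image c - {w, y} \<subseteq> D" using PC PDC by blast
  obtain I1 I2 where I: "connected I1" "I1 \<noteq> {}" "I1 \<inter> I2 = {}"
    "I1 \<union> I2 \<union> (path_image c - {w,y}) = D"
    "closure I1 = I1 \<union> path_image c1 \<union> path_image c" "I1 \<inter> (path_image c1 \<union> path_image c) = {}"
    "closure I2 = I2 \<union> path_image c2 \<union> path_image c" "I2 \<inter> (path_image c2 \<union> path_image c) = {}"
    using crosscut_regions[OF cc(1-3) cc(5-7) c cc(9) i1 i2 cc(10) C_S2 CS D PD] by metis
  have I1D: "I1 \<subseteq> D" using I(4) by blast
  \<comment> \<open>\<open>S\<close> cannot pass from one region to the other. \<open>I2\<close> is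
    taken with its boundary because \<open>S\<close> may touch \<open>C\<close> outside the
    base.\<close>
  have dich: "S \<inter> I1 = {} \<or> S \<inter> closure I2 = {}"
    if S: "connected S" "S \<subseteq> D \<union> C" "S \<inter> path_image c = {}" "S \<inter> civ w y = {}" for S
  proof -
    have s: "S \<subseteq> closure I1 \<union> closure I2" using S(2) I(4,5,7) cc(10) by blast
    have "I1 \<inter> path_image c2 = {}" using I1D DC cc(10) by blast
    then have e: "closure I1 \<inter> closure I2 \<inter> S = {}"
      unfolding I(5,7) using I(3) S(3,4) cc(4) by auto
    have "closure I1 \<inter> S = {} \<or> closure I2 \<inter> S = {}"
      using connected_closedD[OF S(1) e s] by auto
    then show ?thesis unfolding I(5) by auto
  qed
  have XI: "v \<notin> civ w y" if "v \<in> X" "v \<noteq> w" "v \<noteq> y" for v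
  proof
    assume v: "v \<in> civ w y"
    have vC: "v \<in> C" using that X_C by auto
    have "0 < pos w v" "pos w v \<noteq> pos w y" using pos_pos[OF wC vC] pos_eq[OF wC vC n(7)] that by auto
    then show False using v adj[OF that(1)] by (auto simp: civ_def y_def)
  qed
  have XI2: "v \<in> closure I2" if "v \<in> X" "v \<noteq> w" "v \<noteq> y" for v
    using XI[OF that] X_C[OF that(1)] cc(4,10) I(7) by auto
  \<comment> \<open>The parts of \<open>cir w\<close> and \<open>g w\<close> beyond \<open>p\<close>
    are treated together: \<open>v\<close> is one of \<open>w\<close>, \<open>y\<close> and
    \<open>v'\<close> the other. Their ends on \<open>C\<close> are off the base, hence in
    \<open>closure I2\<close>.\<close>
  have tail: "x \<notin> I1"
    if v: "v \<in> X" "p \<in> bar v" "v = w \<or> v = y" and v': "v' \<in> X" "p \<in> bar v'" "{v, v'} = {w, y}"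
      and x: "x \<in> cir v" for v v' x
  proof
    assume xI: "x \<in> I1"
    have xb: "x \<in> bar v" using xI I1D x by (auto simp: bar_def)
    have vv: "cir v \<noteq> cir v'" using v'(3) Qw(7) n(2) by (auto simp: d_def doubleton_eq_iff)
    have "x \<notin> path_image c" using I(6) xI by auto
    then have "x \<notin> ini v p" using v cP by auto
    then have lt: "par v p < par v x" using xb par[OF v(1) xb] par_self[OF v(1)] by (auto simp: mid_def)
    let ?S = "mid v x (opp v)"
    have ov: "opp v \<in> X" "opp v \<noteq> w" "opp v \<noteq> y" "cir (opp v) = cir v"
    proof -
      have "w \<in> {v, v'}" "y \<in> {v, v'}" unfolding v'(3) by auto
      moreover have "opp v \<noteq> v" "opp v \<noteq> v'" using cir_opp[OF v(1)] opp_ne[OF v(1)] vv by auto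
      ultimately show "opp v \<noteq> w" "opp v \<noteq> y" by auto
    qed (use opp_X[OF v(1)] cir_opp[OF v(1)] in auto)
    have "z \<notin> ini v p" if "z \<in> ?S" for z using that lt by (auto simp: mid_def)
    moreover have "z \<notin> ini v' p" if z: "z \<in> ?S" for z
    proof
      assume z': "z \<in> ini v' p"
      have qv: "q v' = p" using v'(3) yq by (auto simp: p_def doubleton_eq_iff)
      have "z \<in> cir v" using z mid_sub by blast
      then have "z = p" using ini_q(1)[OF v'(1) _ _ cir(1)[OF v(1)] vv] z' qv by auto
      then show False using z lt by (auto simp: mid_def)
    qed
    moreover have "path_image c = ini v p \<union> ini v' p" using cP v'(3) by (auto simp: doubleton_eq_iff)
    ultimately have "?S \<inter> path_image c = {}" by auto
    moreover have "z \<notin> civ w y" if z: "z \<in> ?S" for z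
    proof
      assume zc: "z \<in> civ w y"
      then have "z = v \<or> z = opp v" using mid_C[OF v(1) z] by (auto simp: civ_def)
      moreover have "z \<noteq> v" using z lt par_self[OF v(1)] par[OF v(1,2)] by (auto simp: mid_def)
      ultimately show False using XI[OF ov(1-3)] zc by auto
    qed
    moreover have "connected ?S" using mid_path_connected(2)[OF v(1) xb X_bar(2)[OF v(1)]] .
    moreover have "?S \<subseteq> D \<union> C" using mid_sub by blast
    ultimately have "?S \<inter> I1 = {} \<or> ?S \<inter> closure I2 = {}" by (intro dich) auto
    moreover have "x \<in> ?S" "opp v \<in> ?S"
      using xb X_bar[OF v(1)] par[OF v(1) xb] par_at_opp[OF v(1)] by (auto simp: mid_def)
    ultimately show False using xI XI2[OF ov(1-3)] by blast
  qed
  have free: "x \<notin> E" if "x \<in> I1" "E \<in> A" for x E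
  proof
    assume xE: "x \<in> E"
    have xD: "x \<in> D" using that I1D by auto
    have E: "E \<in> A - {C}" using xE xD DC that by auto
    consider "E = d" | "E = h" | "E \<noteq> d" "E \<noteq> h" by blast
    then show False
    proof cases
      case 1
      then show False using tail[OF w pb(1) _ n(1) pb(2) refl] xE that by (simp add: d_def)
    next
      case 2
      then show False using tail[OF n(1) pb(2) _ w pb(1), of x] xE that n(2) by auto
    next
      \<comment> \<open>Only \<open>d\<close> and \<open>h\<close> meet the two sides through
        \<open>p\<close>, so the whole arc of a third pseudocircle avoids the boundary of
        \<open>I1\<close>, and its ends are outside.\<close>
      case 3
      define e where "e = \<gamma> E 0"
      have e: "e \<in> X" "cir e = E" using gam_ends[OF E] by (auto simp: e_def)
      let ?S = "mid e e (opp e)"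
      have S: "z \<in> ?S \<longleftrightarrow> z \<in> bar e" for z
        using par[OF e(1)] par_self[OF e(1)] par_at_opp[OF e(1)] by (auto simp: mid_def)
      have "z \<notin> path_image c" if "z \<in> ?S" for z
        using that iw'[OF _ _ E] iy'[OF _ _ E] 3 e cP by (auto simp: S bar_def)
      then have "?S \<inter> path_image c = {}" by auto
      moreover have ewy: "v \<noteq> w" "v \<noteq> y" if "v \<in> X" "cir v = E" for v using that 3 n(2) by (auto simp: d_def)
      then have "z \<notin> civ w y" if "z \<in> ?S" for z
        using that mid_C[OF e(1) that] XI[OF e(1)] XI[OF opp_X[OF e(1)]] e cir_opp[OF e(1)] opp_X[OF e(1)]
        by (auto simp: civ_def)
      then have "?S \<inter> civ w y = {}" by auto
      moreover have "connected ?S" using mid_path_connected(2)[OF e(1) X_bar[OF e(1)]] .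
      moreover have "?S \<subseteq> D \<union> C" using mid_sub by blast
      ultimately have "?S \<inter> I1 = {} \<or> ?S \<inter> closure I2 = {}" by (intro dich) auto
      moreover have "x \<in> ?S" unfolding S using xE xD e by (simp add: bar_def)
      moreover have "e \<in> ?S" unfolding S using X_bar(1)[OF e(1)] .
      ultimately show False using that XI2[OF e(1) ewy[OF e]] by blast
    qed
  qed
  have cA: "path_image c \<subseteq> \<Union>A" using cP sub dA(2) Qw(6) by blast
  have "I1 \<in> cells A"
    unfolding cells_def in_components_maximal
  proof (intro conjI allI impI)
    show "I1 \<noteq> {}" "connected I1" using I by auto
    show "I1 \<subseteq> S2 - \<Union>A" using free I1D DS2 by blast
    fix W assume W: "W \<noteq> {} \<and> I1 \<subseteq> W \<and> W \<subseteq> S2 - \<Union>A \<and> connected W"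
    have "W \<subseteq> D"
      using components_maximal[OF D, of W] W I(2) I1D CA by blast
    moreover have "W \<inter> path_image c = {}" "W \<inter> civ w y = {}" using W cA CA by (auto simp: civ_def)
    ultimately have "W \<inter> I1 = {} \<or> W \<inter> closure I2 = {}" using W by (intro dich) auto
    then have "W \<inter> closure I2 = {}" using W I(2) by blast
    then have "W \<inter> I2 = {}" unfolding I(7) by auto
    then show "W = I1" using W \<open>W \<subseteq> D\<close> I(4) \<open>W \<inter> path_image c = {}\<close> by blast
  qed
  moreover have cl: "closure I1 \<inter> crossings A = {w, y, p}"
  proof (intro equalityI subsetI)
    fix x assume x: "x \<in> closure I1 \<inter> crossings A"
    have "x \<notin> I1" using x free by (auto simp: crossings_iff)
    then have "x \<in> civ w y \<or> x \<in> ini w p \<or> x \<in> ini y p" using x I(5) cc(4) cP by auto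
    then show "x \<in> {w, y, p}"
    proof (elim disjE)
      assume xc: "x \<in> civ w y"
      then have xC: "x \<in> C" by (simp add: civ_def)
      obtain F where "F \<in> A" "F \<noteq> C" "x \<in> F" using crossing_other[of x C] x xC CA by blast
      then have "x \<in> X" using X_I[OF xC, of F] by auto
      then show ?thesis using XI xc by auto
    next
      assume xi: "x \<in> ini w p"
      then obtain F where F: "F \<in> A" "F \<noteq> d" "x \<in> F" using crossing_other[of x d] x sub dA by blast
      show ?thesis
      proof (cases "F = C")
        case True
        then show ?thesis using ini_C[OF w xi _ Qw(2) pb(1)] F by auto
      next
        case False
        then show ?thesis using iw[OF xi F(3)] F by auto
      qed
    next
      assume xi: "x \<in> ini y p"
      then obtain F where F: "F \<in> A" "F \<noteq> h" "x \<in> F" using crossing_other[of x h] x sub Qw by blast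
      show ?thesis
      proof (cases "F = C")
        case True
        then show ?thesis using ini_C[OF n(1) xi _ Qw(2) pb(2)] F by auto
      next
        case False
        then show ?thesis using iy[OF xi F(3)] F by auto
      qed
    qed
  next
    fix x assume x: "x \<in> {w, y, p}"
    have "x \<in> closure I1" using x I(5) cP ini_I[OF w pb(1)] ini_I[OF n(1) pb(2)] by auto
    moreover have "w \<in> crossings A" unfolding crossings_iff using CA dA wC by blast
    moreover have "y \<in> crossings A" unfolding crossings_iff using CA Qw(5,6) n(7) cir(4)[OF n(1)] n(2) by blast
    moreover have "p \<in> crossings A" unfolding crossings_iff using dA Qw(3,6,7,8) by metis
    ultimately show "x \<in> closure I1 \<inter> crossings A" using x by auto
  qed
  moreover have pC: "p \<notin> C" using Qw(2) DC by auto
  then have "card {w, y, p} = 3" using wy wC n(7) by (auto simp: card_insert_if)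
  ultimately have "I1 \<in> triangles A" by (simp add: triangles_def)
  moreover have "closure I1 \<inter> crossings A \<inter> C = {w, y}" unfolding cl using wC n(7) pC by auto
  ultimately show ?thesis unfolding y_def by blast
qed

text \<open>The second search starts at \<open>nend w\<close>. As its base does not run past
  \<open>nend w\<close>, it is not the first base again. Nor is it the first with \<open>w\<close>
  and \<open>nend w\<close> exchanged: then these would be the only endpoints, but
  \<open>opp w\<close> is a third.\<close>

lemma two_triangles:
  assumes "X \<noteq> {}"
  shows "\<exists>T\<in>triangles A. \<exists>T'\<in>triangles A. T \<noteq> T' \<and>
    2 \<le> card (closure T \<inter> crossings A \<inter> C) \<and> 2 \<le> card (closure T' \<inter> crossings A \<inter> C)"
proof -
  obtain x where "x \<in> X" using assms by blast
  then obtain w where w: "triangle_base w" using exists_triangle_base by blast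
  then have wX: "w \<in> X" by (simp add: triangle_base_def)
  note n = nend[OF wX]
  obtain w' where w': "triangle_base w'" "pos (nend w) w' < pos (nend w) (nend w')" using exists_triangle_base[OF n(1)] by blast
  then have w'X: "w' \<in> X" by (simp add: triangle_base_def)
  note n' = nend[OF w'X]
  have wC: "w \<in> C" "w' \<in> C" using wX w'X X_C by auto
  have ne: "{w, nend w} \<noteq> {w', nend w'}"
  proof
    assume "{w, nend w} = {w', nend w'}"
    then consider "w' = w" "nend w' = nend w" | "w' = nend w" "nend w' = w" by (auto simp: doubleton_eq_iff)
    then show False
    proof cases
      case 1
      then show False using w'(2) pos_range[OF n(7) wC(1)] by simp
    next
      case 2
      let ?o = "opp w"
      have o: "?o \<in> X" "?o \<in> C" "?o \<noteq> w" using opp_X[OF wX] opp_ne[OF wX] X_C by auto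
      have "?o \<noteq> nend w" using cir_opp[OF wX] n(2) q(7)[OF wX] by auto
      then have ne: "pos w ?o \<noteq> pos w (nend w)" using pos_eq[OF wC(1) o(2) n(7)] by auto
      have "0 < pos w ?o" using pos_pos[OF wC(1) o(2)] o by auto
      then have "pos w (nend w) < pos w ?o" using w o(1) ne unfolding triangle_base_def by fastforce
      moreover have "\<not> (0 < pos (nend w) ?o \<and> pos (nend w) ?o < pos (nend w) w)"
        using w'(1) o(1) 2 unfolding triangle_base_def by metis
      ultimately show False
        using pos_shift[OF wC(1) n(7) o(2)] pos_shift[OF wC(1) n(7) wC(1)] pos_range[OF wC(1) o(2)] n(4) by auto
    qed
  qed
  obtain T where T: "T \<in> triangles A" "closure T \<inter> crossings A \<inter> C = {w, nend w}" using triangle_base_cell[OF w] by blast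
  obtain T' where T': "T' \<in> triangles A" "closure T' \<inter> crossings A \<inter> C = {w', nend w'}" using triangle_base_cell[OF w'(1)] by blast
  have "T \<noteq> T'" using T T' ne by auto
  moreover have "card {w, nend w} = 2" "card {w', nend w'} = 2" using n(9) n'(9) by auto
  ultimately show ?thesis using T T' by (intro bexI[of _ T] bexI[of _ T'] conjI) auto
qed

end

section \<open>Complements of curves and of finite sets on the sphere\<close>

lemma sphere_component_open:
  assumes "closed K" "W \<in> components (S2 - K)"
  shows "openin (top_of_set S2) W"
proof -
  have o: "openin (top_of_set S2) (S2 - K)" using assms(1) by (metis Diff_eq open_Compl openin_open)
  have "locally connected S2" unfolding S2_def by (rule locally_connected_sphere)
  then have "locally connected (S2 - K)" using o locally_open_subset by blast
  then have "openin (top_of_set (S2 - K)) W"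
    using assms(2) openin_components_locally_connected by blast
  then show ?thesis using o openin_trans by blast
qed

text \<open>Pulls back the planar fact that the curve is the frontier of its inside, after
  puncturing in the other component.\<close>

lemma jordan_subset_closure:
  assumes g: "simple_path g" "pathfinish g = pathstart g" "path_image g = F" "F \<subseteq> S2" "F \<noteq> S2"
    and W: "W \<in> components (S2 - F)"
  shows "F \<subseteq> closure W"
proof -
  obtain p h k where p: "p \<in> S2 - F" "p \<notin> W"
    and hom: "homeomorphism (S2 - {p}) (UNIV :: complex set) h k" and Wk: "W = k ` inside (h ` F)"
    using jordan_component_puncture[OF g W] by metis
  have FS: "F \<subseteq> S2 - {p}" using g p by auto
  have ch: "continuous_on (S2 - {p}) h" and ck: "continuous_on UNIV k"
    and kh: "\<And>x. x \<in> S2 - {p} \<Longrightarrow> k (h x) = x"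
    using hom by (auto simp: homeomorphism_def)
  have ih: "inj_on h (S2 - {p})" using kh by (metis inj_onI)
  have s: "simple_path (h \<circ> g)"
    using g FS ch ih by (intro simple_path_continuous_image) (auto intro: continuous_on_subset inj_on_subset)
  have l: "pathfinish (h \<circ> g) = pathstart (h \<circ> g)" "path_image (h \<circ> g) = h ` F"
    using g by (simp_all add: pathstart_compose pathfinish_compose path_image_compose)
  have "frontier (inside (h ` F)) = h ` F" using Jordan_inside_outside[OF s l(1)] l(2) by simp
  then have "h ` F \<subseteq> closure (inside (h ` F))" by (auto simp: frontier_def)
  moreover have "k ` closure (inside (h ` F)) \<subseteq> closure W"
    unfolding Wk using closure_subset[of "k ` inside (h ` F)"] ck by (intro image_closure_subset) (auto intro: continuous_on_subset)
  moreover have "k ` h ` F = F" using kh FS by (force simp: image_image)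
  ultimately show ?thesis by (metis image_mono order_trans)
qed

text \<open>A finite Baire argument: each \<open>E\<close> is closed with dense complement, so
  removing it leaves a nonempty relatively open set.\<close>

lemma open_not_covered:
  assumes "finite B" "\<And>E. E \<in> B \<Longrightarrow> closed E \<and> E \<subseteq> closure (S2 - E)"
    and "openin (top_of_set S2) V" "V \<noteq> {}"
  shows "V - \<Union>B \<noteq> {}"
  using assms
proof (induction B arbitrary: V rule: finite_induct)
  case (insert E B)
  obtain O' where O: "open O'" "V = S2 \<inter> O'" using insert.prems(2) by (auto simp: openin_open)
  have V1: "V - E \<noteq> {}"
  proof
    assume "V - E = {}"
    then obtain x where x: "x \<in> V" "x \<in> E" using insert.prems by blast
    then have "x \<in> closure (S2 - E)" "x \<in> O'" using insert.prems(1)[of E] O by auto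
    then have "O' \<inter> (S2 - E) \<noteq> {}" using O(1) open_Int_closure_eq_empty by blast
    then show False using \<open>V - E = {}\<close> O by auto
  qed
  have "V - E = V \<inter> - E" by auto
  moreover have "openin (top_of_set S2) (V \<inter> - E)"
    using insert.prems(1)[of E] insert.prems(2) by (intro openin_Int_open) auto
  ultimately have "(V - E) - \<Union>B \<noteq> {}"
    using insert.IH[of "V - E"] insert.prems V1 by auto
  then show ?case by auto
qed auto

text \<open>In the application \<open>s\<close> and \<open>s'\<close> lie on \<open>S\<close>, so
  nearby points of \<open>W\<close> and \<open>W'\<close> are used instead. Small balls around
  \<open>s\<close> and \<open>s'\<close> together with \<open>e\<close> join them off
  \<open>T\<close>, and the connectedness of \<open>S \<inter> T\<close> gives a connection off both
  sets.\<close>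

lemma Janiszewski_near:
  fixes S T :: "complex set"
  assumes "compact S" "closed T" "connected (S \<inter> T)"
    and e: "connected e" "e \<subseteq> - T" "s \<in> e" "s' \<in> e" and W: "s \<in> closure W" "s' \<in> closure W'"
    and c: "\<And>a b. a \<in> W \<Longrightarrow> b \<in> W' \<Longrightarrow> connected_component (- S) a b"
  shows "\<exists>a\<in>W. \<exists>b\<in>W'. connected_component (- (S \<union> T)) a b"
proof -
  have o: "open (- T)" using assms by auto
  obtain r where r: "r > 0" "ball s r \<subseteq> - T" using openE[OF o] e by (metis subsetD)
  obtain r' where r': "r' > 0" "ball s' r' \<subseteq> - T" using openE[OF o] e by (metis subsetD)
  obtain a where a: "a \<in> W" "a \<in> ball s r" using W(1) r(1) by (auto simp: closure_approachable dist_commute)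
  obtain b where b: "b \<in> W'" "b \<in> ball s' r'" using W(2) r'(1) by (auto simp: closure_approachable dist_commute)
  have sr: "s \<in> ball s r \<inter> e" "s' \<in> (ball s r \<union> e) \<inter> ball s' r'" using e r r' by auto
  have 1: "connected (ball s r \<union> e)" by (rule connected_Un[OF connected_ball e(1)]) (use sr(1) in blast)
  have "connected ((ball s r \<union> e) \<union> ball s' r')" by (rule connected_Un[OF 1 connected_ball]) (use sr(2) in blast)
  then have "connected_component (- T) a b"
    unfolding connected_component_def using a b r r' e by (intro exI[of _ "(ball s r \<union> e) \<union> ball s' r'"]) auto
  then have "connected_component (- (S \<union> T)) a b"
    using Janiszewski assms(1-3) c[OF a(1) b(1)] by blast
  then show ?thesis using a b by blast
qed

lemma connected_sphere_minus_finite: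
  assumes "finite Q" "Q \<subseteq> S2" "Q \<noteq> {}"
  shows "connected (S2 - Q)"
proof -
  obtain p where p: "p \<in> Q" using assms by blast
  obtain h k where hom: "homeomorphism (S2 - {p}) (UNIV :: complex set) h k"
    using punctured_sphere_homeomorphism p assms by blast
  have ck: "continuous_on UNIV k" and kh: "\<And>x. x \<in> S2 - {p} \<Longrightarrow> k (h x) = x" and hk: "\<And>z. h (k z) = z"
    and ki: "range k = S2 - {p}"
    using hom by (auto simp: homeomorphism_def)
  have "S2 - Q = k ` (- h ` (Q - {p}))"
  proof (intro equalityI subsetI)
    fix x assume x: "x \<in> S2 - Q"
    then have "x \<in> S2 - {p}" using p by auto
    then have "x = k (h x)" using kh[of x] by simp
    moreover have "h x \<notin> h ` (Q - {p})"
    proof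
      assume "h x \<in> h ` (Q - {p})"
      then obtain y where "y \<in> Q - {p}" "h x = h y" by auto
      then have "x = y" using kh[of x] kh[of y] x p assms by auto
      then show False using x \<open>y \<in> Q - {p}\<close> by auto
    qed
    ultimately show "x \<in> k ` (- h ` (Q - {p}))" by blast
  next
    fix x assume "x \<in> k ` (- h ` (Q - {p}))"
    then obtain z where z: "x = k z" "z \<notin> h ` (Q - {p})" by auto
    have "x \<in> S2 - {p}" using z ki by auto
    moreover have "x \<notin> Q - {p}" using z hk by (metis imageI)
    ultimately show "x \<in> S2 - Q" by auto
  qed
  moreover have "connected (- h ` (Q - {p}))"
    using assms by (intro path_connected_imp_connected path_connected_complement_countable) (auto intro: countable_finite)
  ultimately show ?thesis using ck by (metis connected_continuous_image continuous_on_subset subset_UNIV)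
qed

subsection \<open>The number of cells is finite\<close>

text \<open>Needed because \<open>card\<close> of an infinite set is 0. The boundary of a cell contains a point of an
  edge, and the edge and the side of its pseudocircle \<open>E\<close> determine the cell: apply Janiszewski's
  theorem to \<open>E\<close> and to the union of the pseudocircles without this edge. An edge is encoded by the
  number of elements of \<open>Z E\<close> below the parameter of its points.\<close>

context
  fixes A :: "(real^3) set set" and \<gamma> :: "(real^3) set \<Rightarrow> real \<Rightarrow> real^3"
  assumes arr: "simple_pi_arrangement A" and two: "\<And>E. E \<in> A \<Longrightarrow> \<exists>F\<in>A. F \<noteq> E" and Ane: "A \<noteq> {}"
    and loop: "\<And>E. E \<in> A \<Longrightarrow> simple_path (\<gamma> E)" "\<And>E. E \<in> A \<Longrightarrow> pathfinish (\<gamma> E) = pathstart (\<gamma> E)"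
      "\<And>E. E \<in> A \<Longrightarrow> path_image (\<gamma> E) = E"
begin

text \<open>The values 0 and 1 make the base point of the loop an extra vertex, so no edge wraps
  around in the parameter.\<close>

definition Z where "Z E = {t \<in> {0..1}. \<gamma> E t \<in> crossings A} \<union> {0, 1}"

lemma circle_subset_S2: "E \<in> A \<Longrightarrow> E \<subseteq> S2"
  using arrangement_pseudocircle[OF arr] by (auto simp: pseudocircle_def)

lemma circle_ne_S2: "E \<in> A \<Longrightarrow> E \<noteq> S2"
  using two arrangement_ne_sphere[OF arr] by metis

lemma loop_inj: "E \<in> A \<Longrightarrow> 0 < s \<Longrightarrow> s < 1 \<Longrightarrow> 0 \<le> t \<Longrightarrow> t \<le> 1 \<Longrightarrow> \<gamma> E s = \<gamma> E t \<Longrightarrow> s = t"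
  using loop(1)[of E] by (force simp: simple_path_def loop_free_def)

lemma Z_finite: assumes "E \<in> A" shows "finite (Z E)"
proof -
  have "inj_on (\<gamma> E) {0<..<1}" using loop_inj[OF assms] by (auto simp: inj_on_def)
  then have "finite ((\<gamma> E) -` crossings A \<inter> {0<..<1})"
    using crossings_finite[OF arr] by (rule finite_vimage_IntI[rotated])
  moreover have "Z E \<subseteq> ((\<gamma> E) -` crossings A \<inter> {0<..<1}) \<union> {0, 1}" by (auto simp: Z_def)
  ultimately show ?thesis by (meson finite_Un finite.emptyI finite_insert finite_subset)
qed

lemma union_closed: "closed (\<Union>A)"
  using arrangement_finite[OF arr] pseudocircle_closed arrangement_pseudocircle[OF arr] by (intro closed_Union) auto

lemma cell_open: "W \<in> cells A \<Longrightarrow> openin (top_of_set S2) W"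
  unfolding cells_def by (rule sphere_component_open[OF union_closed])

text \<open>If the closure of \<open>W\<close> met the curves only in the finite vertex set
  \<open>Q\<close>, then \<open>W\<close> would be open and closed in the connected set
  \<open>S2 - Q\<close>, hence equal to it. A pseudocircle would then be contained in
  \<open>Q\<close>.\<close>

lemma cell_touches_edge:
  assumes W: "W \<in> cells A"
  shows "\<exists>E\<in>A. \<exists>t\<in>{0<..<1} - Z E. \<gamma> E t \<in> closure W"
proof (rule ccontr)
  assume no: "\<not> ?thesis"
  define Q where "Q = crossings A \<union> (\<lambda>E. \<gamma> E 0) ` A"
  have Qf: "finite Q" using crossings_finite[OF arr] arrangement_finite[OF arr] by (simp add: Q_def)
  have in_E: "x \<in> E \<Longrightarrow> \<exists>t\<in>{0..1}. x = \<gamma> E t" if "E \<in> A" for E x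
    using loop[OF that] by (auto simp: path_image_def)
  have QA: "Q \<subseteq> \<Union>A"
  proof -
    have "\<gamma> E 0 \<in> E" if "E \<in> A" for E using loop[OF that] pathstart_in_path_image[of "\<gamma> E"] by (simp add: pathstart_def)
    then show ?thesis by (auto simp: Q_def crossings_iff)
  qed
  have Qne: "Q \<noteq> {}" using Ane by (auto simp: Q_def)
  have WA: "W \<subseteq> S2 - \<Union>A" "W \<noteq> {}" using W in_components_subset in_components_nonempty unfolding cells_def by blast+
  have "closed S2" by (simp add: S2_def)
  then have "closure W \<subseteq> S2" using WA by (intro closure_minimal) auto
  have touch: "x \<in> Q" if x: "x \<in> closure W" "x \<in> \<Union>A" for x
  proof -
    obtain E t where E: "E \<in> A" "t \<in> {0..1}" "x = \<gamma> E t" using x in_E by blast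
    show ?thesis
    proof (cases "t \<in> {0<..<1}")
      case True
      then have "t \<in> Z E" using no E x by blast
      then show ?thesis using True E by (auto simp: Z_def Q_def)
    next
      case False
      then have "t = 0 \<or> t = 1" using E by auto
      then have "x = \<gamma> E 0" using loop[OF E(1)] E by (auto simp: pathstart_def pathfinish_def)
      then show ?thesis using E by (auto simp: Q_def)
    qed
  qed
  have cW: "closure W \<inter> (S2 - \<Union>A) = W"
  proof -
    obtain T where T: "closed T" "W = (S2 - \<Union>A) \<inter> T"
      using closedin_component W unfolding cells_def closedin_closed by blast
    then have "closure W \<subseteq> T" by (intro closure_minimal) auto
    moreover have "W \<subseteq> closure W" by (rule closure_subset)
    ultimately show ?thesis using T(2) by auto
  qed
  have "closure W \<inter> (S2 - Q) = W"
  proof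
    show "W \<subseteq> closure W \<inter> (S2 - Q)" using closure_subset[of W] WA(1) QA by auto
    show "closure W \<inter> (S2 - Q) \<subseteq> W"
    proof
      fix x assume x: "x \<in> closure W \<inter> (S2 - Q)"
      then have "x \<notin> \<Union>A" using touch[of x] by auto
      then have "x \<in> closure W \<inter> (S2 - \<Union>A)" using x by simp
      then show "x \<in> W" unfolding cW .
    qed
  qed
  then have "closedin (top_of_set (S2 - Q)) W" by (metis closed_closure closedin_closed_Int inf_commute)
  moreover have "openin (top_of_set (S2 - Q)) W"
    by (rule openin_subset_trans[OF cell_open[OF W]]) (use WA QA in auto)
  moreover have "connected (S2 - Q)" using connected_sphere_minus_finite Qf Qne QA circle_subset_S2 by blast
  ultimately have WQ: "W = S2 - Q" using WA(2) unfolding connected_clopen by blast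
  obtain E where E: "E \<in> A" using Ane by blast
  have "E \<subseteq> Q" using WQ WA E circle_subset_S2[OF E] by blast
  then have "finite E" using Qf finite_subset by blast
  moreover have "\<gamma> E ` {0<..<1} \<subseteq> E" using loop[OF E] by (force simp: path_image_def)
  moreover have "inj_on (\<gamma> E) {0<..<1}" using loop_inj[OF E] by (auto simp: inj_on_def)
  ultimately have "finite {0<..<1::real}" by (meson finite_imageD finite_subset)
  then show False by (simp add: infinite_Ioo)
qed

lemma same_edge_same_cell:
  assumes W: "W \<in> cells A" "W' \<in> cells A" and E: "E \<in> A" and U: "U \<in> components (S2 - E)" "W \<subseteq> U" "W' \<subseteq> U"
    and t: "t \<in> {0<..<1} - Z E" "\<gamma> E t \<in> closure W" "t' \<in> {0<..<1} - Z E" "\<gamma> E t' \<in> closure W'" "t \<le> t'"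
    and N: "card {z \<in> Z E. z < t} = card {z \<in> Z E. z < t'}"
  shows "W = W'"
proof -
  let ?g = "\<gamma> E"
  note Zf = Z_finite[OF E]
  \<comment> \<open>Equal counts leave no vertex between \<open>t\<close> and \<open>t'\<close>, so
    both parameters belong to one edge.\<close>
  have noZ: "z \<notin> Z E" if z: "t \<le> z" "z \<le> t'" for z
  proof
    assume zZ: "z \<in> Z E"
    have "t < z" "z < t'" using zZ z t by (auto simp: order_le_less)
    have "{z \<in> Z E. z < t} \<subset> {z \<in> Z E. z < t'}"     proof
      show "{z \<in> Z E. z < t} \<subseteq> {z \<in> Z E. z < t'}" using t(5) by auto
      have "z \<in> {z \<in> Z E. z < t'}" "z \<notin> {z \<in> Z E. z < t}" using zZ \<open>t < z\<close> \<open>z < t'\<close> by auto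
      then show "{z \<in> Z E. z < t} \<noteq> {z \<in> Z E. z < t'}" by metis
    qed
    then have "card {z \<in> Z E. z < t} < card {z \<in> Z E. z < t'}"
      by (rule psubset_card_mono[rotated]) (use Zf in auto)
    then show False using N by simp
  qed
  define t0 where "t0 = Max {z \<in> Z E. z < t}"
  define t1 where "t1 = Min {z \<in> Z E. t' < z}"
  have f0: "finite {z \<in> Z E. z < t}" "{z \<in> Z E. z < t} \<noteq> {}" "finite {z \<in> Z E. t' < z}" "{z \<in> Z E. t' < z} \<noteq> {}"
    using Zf t by (auto simp: Z_def)
  have t0: "t0 < t" "0 \<le> t0" using Max_in[OF f0(1,2)] by (auto simp: t0_def Z_def)
  have t1: "t' < t1" "t1 \<le> 1" using Min_in[OF f0(3,4)] by (auto simp: t1_def Z_def)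
  have gap: "z \<le> t0 \<or> t1 \<le> z" if "z \<in> Z E" for z
  proof -
    consider "z < t" | "t \<le> z" "z \<le> t'" | "t' < z" by linarith
    then show ?thesis
      using Max_ge[OF f0(1), of z] Min_le[OF f0(3), of z] noZ[of z] that by cases (auto simp: t0_def t1_def)
  qed
  define e where "e = ?g ` {t..t'}"
  \<comment> \<open>\<open>E\<close> without the open edge: connected because the two pieces share
    the base point, and containing all crossings on \<open>E\<close>. Hence \<open>E\<close> meets
    the rest \<open>T\<close> in the connected set \<open>R\<close>.\<close>
  define R where "R = ?g ` {0..t0} \<union> ?g ` {t1..1}"
  have cg: "continuous_on {0..1} ?g" using loop[OF E] by (simp add: simple_path_def path_def)
  have sub: "{t..t'} \<subseteq> {0..1}" "{0..t0} \<subseteq> {0..1}" "{t1..1} \<subseteq> {0..1}" using t0 t1 t by auto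
  have co: "connected (?g ` {a..b}) \<and> compact (?g ` {a..b})" if "{a..b} \<subseteq> {0..1}" for a b
    using continuous_on_subset[OF cg that] by (auto intro: connected_continuous_image compact_continuous_image)
  have Rc: "compact R" using co sub by (auto simp: R_def)
  have g01: "?g 0 = ?g 1" using loop[OF E] by (simp add: pathstart_def pathfinish_def)
  have Rconn: "connected R"
    unfolding R_def
  proof (rule connected_Un)
    have "?g 0 \<in> ?g ` {0..t0}" "?g 1 \<in> ?g ` {t1..1}" using t0 t1 by auto
    then show "?g ` {0..t0} \<inter> ?g ` {t1..1} \<noteq> {}" using g01 by auto
  qed (use co sub in auto)
  have gi: "x \<in> E \<longleftrightarrow> (\<exists>s\<in>{0..1}. x = ?g s)" for x
    using loop[OF E] unfolding path_image_def by (metis image_iff)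
  have RE: "R \<subseteq> E" "e \<subseteq> E"
  proof -
    have "?g s \<in> E" if "s \<in> {0..1}" for s using gi that by blast
    then show "R \<subseteq> E" "e \<subseteq> E" unfolding R_def e_def using sub by blast+
  qed
  have eR: "e \<inter> R = {}"
  proof (rule ccontr)
    assume "e \<inter> R \<noteq> {}"
    then obtain x where x: "x \<in> e" "x \<in> R" by blast
    obtain s where s1: "s \<in> {t..t'}" "x = ?g s" using x(1) unfolding e_def by blast
    obtain s' where s2: "s' \<in> {0..t0} \<union> {t1..1}" "x = ?g s'" using x(2) unfolding R_def by blast
    have s: "s \<in> {t..t'}" "s' \<in> {0..t0} \<union> {t1..1}" "?g s = ?g s'" using s1 s2 by auto
    have "s = s'" using loop_inj[OF E, of s s'] s t t0 t1 by auto
    then show False using s t0 t1 t by auto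
  qed
  define O' where "O' = \<Union>(A - {E})"
  have Oc: "compact O'" unfolding O'_def
    using arrangement_finite[OF arr] pseudocircle_closed arrangement_pseudocircle[OF arr] by (intro compact_Union) auto
  have EO: "s \<in> Z E" if s: "s \<in> {0..1}" "?g s \<in> O'" for s
  proof -
    obtain F where "F \<in> A" "F \<noteq> E" "?g s \<in> F" using s(2) unfolding O'_def by blast
    moreover have "?g s \<in> E" using s(1) gi by blast
    ultimately have "?g s \<in> crossings A" using E unfolding crossings_iff by blast
    then show ?thesis using that by (auto simp: Z_def)
  qed
  define T where "T = R \<union> O'"
  have EOR: "E \<inter> O' \<subseteq> R"
  proof
    fix x assume x: "x \<in> E \<inter> O'"
    then obtain s where s: "s \<in> {0..1}" "x = ?g s" using gi by blast
    then have "s \<le> t0 \<or> t1 \<le> s" using gap EO x by auto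
    then show "x \<in> R" using s by (auto simp: R_def)
  qed
  then have ET: "E \<inter> T = R" using RE by (auto simp: T_def)
  have eT: "e \<inter> T = {}"
  proof -
    have "x \<notin> O'" if x: "x \<in> e" for x
    proof
      assume xO: "x \<in> O'"
      obtain s where s: "s \<in> {t..t'}" "x = ?g s" using x by (auto simp: e_def)
      then show False using EO[of s] xO noZ[of s] sub by auto
    qed
    then show ?thesis using eR by (auto simp: T_def)
  qed
  have UA: "E \<union> T = \<Union>A" using RE E by (auto simp: T_def O'_def)
  obtain U1 U2 where U12: "components (S2 - E) = {U1, U2}" "U1 \<noteq> U2"
    using jordan_two_components[OF loop[OF E] circle_subset_S2[OF E] circle_ne_S2[OF E]] by blast
  obtain V where V: "V \<in> components (S2 - E)" "V \<noteq> U"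
  proof (cases "U = U1")
    case True then show thesis using that[of U2] U12 by auto
  next
    case False then show thesis using that[of U1] U12 by auto
  qed
  \<comment> \<open>The puncture must miss every curve, so that their images are compact, and must
    miss \<open>U\<close>, so that \<open>U\<close> still joins \<open>W\<close> to
    \<open>W'\<close> off \<open>E\<close> in the plane.\<close>
  have "V - \<Union>A \<noteq> {}"
  proof (rule open_not_covered)
    show "finite A" by (rule arrangement_finite[OF arr])
    show "openin (top_of_set S2) V" by (rule sphere_component_open[OF pseudocircle_closed(1)[OF arrangement_pseudocircle[OF arr E]] V(1)])
    show "V \<noteq> {}" using V in_components_nonempty by blast
    fix F assume F: "F \<in> A"
    obtain W0 where W0: "W0 \<in> components (S2 - F)"
      using jordan_two_components[OF loop[OF F] circle_subset_S2[OF F] circle_ne_S2[OF F]] by (metis insertI1)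
    then have "F \<subseteq> closure W0" using jordan_subset_closure[OF loop[OF F] circle_subset_S2[OF F] circle_ne_S2[OF F]] by blast
    also have "\<dots> \<subseteq> closure (S2 - F)" using W0 in_components_subset closure_mono by blast
    finally show "closed F \<and> F \<subseteq> closure (S2 - F)"
      using pseudocircle_closed(1)[OF arrangement_pseudocircle[OF arr F]] by simp
  qed
  then obtain p where p: "p \<in> V" "p \<notin> \<Union>A" by blast
  have pS: "p \<in> S2" using p V in_components_subset by blast
  have pU: "p \<notin> U" using p V U components_eq by blast
  obtain h k where hom: "homeomorphism (S2 - {p}) (UNIV :: complex set) h k"
    using punctured_sphere_homeomorphism pS by blast
  have ch: "continuous_on (S2 - {p}) h" and ck: "continuous_on UNIV k"
    and kh: "\<And>x. x \<in> S2 - {p} \<Longrightarrow> k (h x) = x" and hk: "\<And>z. h (k z) = z"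
    and ki: "range k = S2 - {p}"
    using hom by (auto simp: homeomorphism_def)
  have ih: "inj_on h (S2 - {p})" using kh by (metis inj_onI)
  have AS: "\<Union>A \<subseteq> S2 - {p}" using p circle_subset_S2 by auto
  have US: "U \<subseteq> S2 - {p}" "U \<inter> E = {}" "connected U"
    using U(1) in_components_subset in_components_connected pU by blast+
  have sets: "E \<subseteq> S2 - {p}" "T \<subseteq> S2 - {p}" "R \<subseteq> S2 - {p}" "e \<subseteq> S2 - {p}" "W \<subseteq> S2 - {p}" "W' \<subseteq> S2 - {p}"
    using AS RE U US(1) unfolding UA[symmetric] by blast+
  have cpt: "compact (h ` S)" if "compact S" "S \<subseteq> S2 - {p}" for S
    using that ch continuous_on_subset compact_continuous_image by blast
  have con: "connected (h ` S)" if "connected S" "S \<subseteq> S2 - {p}" for S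
    using that ch continuous_on_subset connected_continuous_image by blast
  have hint: "h ` S \<inter> h ` S' = h ` (S \<inter> S')" if "S \<subseteq> S2 - {p}" "S' \<subseteq> S2 - {p}" for S S'
    using inj_on_image_Int[OF ih that] by simp
  have cls: "h s \<in> closure (h ` S)" if s: "s \<in> closure S" "s \<in> S2 - {p}" "S \<subseteq> S2 - {p}" for s S
    unfolding closure_approachable
  proof (intro allI impI)
    fix r :: real assume "r > 0"
    then obtain d where d: "d > 0" "\<And>x. x \<in> S2 - {p} \<Longrightarrow> dist x s < d \<Longrightarrow> dist (h x) (h s) < r"
      using ch s(2) unfolding continuous_on_iff by metis
    obtain x where "x \<in> S" "dist x s < d" using s(1) d(1) by (auto simp: closure_approachable)
    then show "\<exists>y\<in>h ` S. dist y (h s) < r" using d s by blast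
  qed
  have Ec: "compact E" using pseudocircle_closed(2)[OF arrangement_pseudocircle[OF arr E]] .
  have Tc: "compact T" using Rc Oc by (auto simp: T_def)
  have tt: "?g t \<in> e" "?g t' \<in> e" using t by (auto simp: e_def)
  have "\<exists>a\<in>h ` W. \<exists>b\<in>h ` W'. connected_component (- (h ` E \<union> h ` T)) a b"
  proof (rule Janiszewski_near)
    show "compact (h ` E)" using cpt[OF Ec sets(1)] .
    show "closed (h ` T)" using compact_imp_closed[OF cpt[OF Tc sets(2)]] .
    show "connected (h ` E \<inter> h ` T)" using hint[OF sets(1,2)] ET con[OF Rconn sets(3)] by simp
    show "connected (h ` e)" using con co[OF sub(1)] sets by (simp add: e_def)
    show "h ` e \<subseteq> - h ` T" using hint[OF sets(4,2)] eT by auto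
    show "h (?g t) \<in> h ` e" "h (?g t') \<in> h ` e" using tt by auto
    show "h (?g t) \<in> closure (h ` W)" using cls[OF t(2) subsetD[OF sets(4) tt(1)] sets(5)] .
    show "h (?g t') \<in> closure (h ` W')" using cls[OF t(4) subsetD[OF sets(4) tt(2)] sets(6)] .
    fix a b assume ab: "a \<in> h ` W" "b \<in> h ` W'"
    have "h ` U \<inter> h ` E = {}" using hint[OF US(1) sets(1)] US(2) by simp
    then show "connected_component (- h ` E) a b"
      unfolding connected_component_def using ab U con[OF US(3,1)] by (intro exI[of _ "h ` U"]) auto
  qed
  then obtain a b K where ab: "a \<in> W" "b \<in> W'" and K: "connected K" "K \<subseteq> - (h ` E \<union> h ` T)" "h a \<in> K" "h b \<in> K"
    unfolding connected_component_def by blast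
  have "connected (k ` K)" using K ck by (metis connected_continuous_image continuous_on_subset subset_UNIV)
  moreover have "k ` K \<subseteq> S2 - \<Union>A"
  proof
    fix x assume "x \<in> k ` K"
    then obtain z where z: "z \<in> K" "x = k z" by auto
    then have "h x = z" using hk by simp
    then have "x \<notin> E \<union> T" using z K by blast
    then have "x \<notin> \<Union>A" unfolding UA .
    moreover have "x \<in> range k" using z by simp
    ultimately show "x \<in> S2 - \<Union>A" unfolding ki by simp
  qed
  moreover have kK: "a \<in> k ` K" "b \<in> k ` K"
    using kh[OF subsetD[OF sets(5) ab(1)]] kh[OF subsetD[OF sets(6) ab(2)]] K(3,4) by (metis imageI)+
  ultimately have "k ` K \<subseteq> W" "k ` K \<subseteq> W'"
    using components_maximal[OF W(1)[unfolded cells_def], of "k ` K"] components_maximal[OF W(2)[unfolded cells_def], of "k ` K"]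
      ab kK by auto
  then have "W \<inter> W' \<noteq> {}" using kK(1) by blast
  then show ?thesis using components_eq[OF W[unfolded cells_def]] by simp
qed

lemma cells_finite_aux: "finite (cells A)"
proof -
  define ix where "ix W i \<longleftrightarrow> (case i of (E, n, U) \<Rightarrow> E \<in> A \<and> U \<in> components (S2 - E) \<and> W \<subseteq> U \<and>
    (\<exists>t\<in>{0<..<1} - Z E. n = card {z \<in> Z E. z < t} \<and> \<gamma> E t \<in> closure W))" for W i
  have ex: "\<exists>i. ix W i" if W: "W \<in> cells A" for W
  proof -
    obtain E t where E: "E \<in> A" "t \<in> {0<..<1} - Z E" "\<gamma> E t \<in> closure W" using cell_touches_edge[OF W] by blast
    have "connected W" "W \<subseteq> S2 - E" "W \<noteq> {}"
      using W in_components_connected in_components_subset in_components_nonempty E unfolding cells_def by blast+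
    moreover from this have "S2 - E \<noteq> {}" by auto
    ultimately obtain U where "U \<in> components (S2 - E)" "W \<subseteq> U"
      using exists_component_superset[of W "S2 - E"] by auto
    then show ?thesis using E by (intro exI[of _ "(E, card {z \<in> Z E. z < t}, U)"]) (auto simp: ix_def)
  qed
  then obtain f where f: "\<And>W. W \<in> cells A \<Longrightarrow> ix W (f W)" by metis
  have same: "W = W'" if W: "W \<in> cells A" "W' \<in> cells A" "ix W i" "ix W' i" for W W' i
  proof -
    obtain E n U where i: "i = (E, n, U)" by (cases i)
    obtain t t' where t: "E \<in> A" "U \<in> components (S2 - E)" "W \<subseteq> U" "W' \<subseteq> U"
      "t \<in> {0<..<1} - Z E" "n = card {z \<in> Z E. z < t}" "\<gamma> E t \<in> closure W"
      "t' \<in> {0<..<1} - Z E" "n = card {z \<in> Z E. z < t'}" "\<gamma> E t' \<in> closure W'"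
      using W(3,4) unfolding i ix_def by auto
    show ?thesis
    proof (cases "t \<le> t'")
      case True
      then show ?thesis using same_edge_same_cell[OF W(1,2) t(1,2,3,4,5,7,8,10)] t by simp
    next
      case False
      then show ?thesis using same_edge_same_cell[OF W(2,1) t(1,2,4,3,8,10,5,7)] t by simp
    qed
  qed
  have "inj_on f (cells A)" using f same by (metis inj_onI)
  moreover have "f ` cells A \<subseteq> (SIGMA E:A. {..card (Z E)} \<times> components (S2 - E))"
  proof
    fix i assume "i \<in> f ` cells A"
    then obtain W where W: "ix W i" using f by auto
    obtain E n U where i: "i = (E, n, U)" by (cases i)
    have "E \<in> A" "U \<in> components (S2 - E)" "n \<le> card (Z E)"
      using W Z_finite unfolding i ix_def by (auto intro!: card_mono)
    then show "i \<in> (SIGMA E:A. {..card (Z E)} \<times> components (S2 - E))" by (auto simp: i)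
  qed
  moreover have "finite (SIGMA E:A. {..card (Z E)} \<times> components (S2 - E))"
  proof (intro finite_SigmaI finite_cartesian_product finite_atMost)
    show "finite A" by (rule arrangement_finite[OF arr])
    fix E assume E: "E \<in> A"
    obtain U1 U2 where "components (S2 - E) = {U1, U2}"
      using jordan_two_components[OF loop[OF E] circle_subset_S2[OF E] circle_ne_S2[OF E]] by metis
    then show "finite (components (S2 - E))" by simp
  qed
  ultimately show ?thesis by (rule inj_on_finite)
qed

end

lemma cells_finite:
  assumes arr: "simple_pi_arrangement A" and n: "card A \<ge> 2"
  shows "finite (cells A)"
proof -
  have "\<forall>E\<in>A. \<exists>g. simple_path g \<and> pathfinish g = pathstart g \<and> path_image g = E"
    using arrangement_pseudocircle[OF arr] unfolding pseudocircle_def by metis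
  then obtain \<gamma> where g: "\<forall>E\<in>A. simple_path (\<gamma> E) \<and> pathfinish (\<gamma> E) = pathstart (\<gamma> E) \<and> path_image (\<gamma> E) = E"
    by (rule bchoice[THEN exE])
  have "\<exists>F\<in>A. F \<noteq> E" if "E \<in> A" for E
  proof (rule ccontr)
    assume "\<not> ?thesis"
    then have "A \<subseteq> {E}" by auto
    then have "card A \<le> 1" using card_mono[of "{E}" A] by simp
    then show False using n by simp
  qed
  moreover have "A \<noteq> {}" using n by auto
  ultimately show ?thesis using cells_finite_aux[OF arr, of \<gamma>] g by metis
qed

subsection \<open>Counting triangles\<close>

text \<open>Bundles the locale's assumptions on a pair of arcs, so that the arcs can be chosen for
  all pseudocircles at once.\<close>

definition splits where "splits C D E \<gamma> \<eta> \<longleftrightarrow> arc \<gamma> \<and> path_image \<gamma> = E \<inter> (D \<union> C) \<and> E \<inter> C = {\<gamma> 0, \<gamma> 1} \<and> arc \<eta> \<and>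
    pathstart \<eta> = pathfinish \<gamma> \<and> pathfinish \<eta> = pathstart \<gamma> \<and>
    path_image \<gamma> \<inter> path_image \<eta> = {\<gamma> 0, \<gamma> 1} \<and> path_image \<gamma> \<union> path_image \<eta> = E"
  for C D E :: "(real^3) set" and \<gamma> \<eta> :: "real \<Rightarrow> real^3"

text \<open>The two points on \<open>C\<close> cut \<open>E\<close> into two arcs, each on one side
  of \<open>C\<close> apart from its ends. They are on different sides because \<open>E\<close>
  crosses \<open>C\<close>.\<close>

lemma side_arcs:
  assumes arr: "simple_pi_arrangement A" and C: "C \<in> A" and E: "E \<in> A" "E \<noteq> C"
    and UV: "components (S2 - C) = {U, V}" "U \<noteq> V" and D: "D \<in> {U, V}"
  shows "\<exists>\<gamma> \<eta>. splits C D E \<gamma> \<eta>"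
proof -
  have pE: "E \<subseteq> S2" using arrangement_pseudocircle[OF arr E(1)] by (simp add: pseudocircle_def)
  obtain g where g: "simple_path g" "pathfinish g = pathstart g" "path_image g = E"
    using arrangement_pseudocircle[OF arr E(1)] unfolding pseudocircle_def by blast
  have "card (E \<inter> C) = 2" using arrangement_card_2[OF arr E(1) C E(2)] .
  then obtain a b where ab: "E \<inter> C = {a, b}" "a \<noteq> b" by (meson card_2_iff)
  have abi: "a \<in> path_image g" "b \<in> path_image g" using ab g(3) by auto
  obtain u d where u: "arc u" "arc d" "pathstart u = a" "pathfinish u = b" "pathstart d = b" "pathfinish d = a"
      "path_image u \<inter> path_image d = {a,b}" "path_image u \<union> path_image d = E"
    using exists_double_arc[OF g(1,2) abi ab(2)] g(3) by metis
  have uC: "path_image u - {a, b} \<subseteq> S2 - C" "path_image d - {a, b} \<subseteq> S2 - C"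
    using u(8) ab(1) pE by blast+
  have con: "connected (path_image u - {a, b})" "connected (path_image d - {a, b})"
    using connected_simple_path_endless[OF arc_imp_simple_path[OF u(1)]]
      connected_simple_path_endless[OF arc_imp_simple_path[OF u(2)]] u(3-6) by (auto simp: insert_commute)
  have ne: "path_image u - {a, b} \<noteq> {}" "path_image d - {a, b} \<noteq> {}"
    using nonempty_simple_path_endless[OF arc_imp_simple_path[OF u(1)]]
      nonempty_simple_path_endless[OF arc_imp_simple_path[OF u(2)]] u(3-6) by (auto simp: insert_commute)
  have inW: "\<exists>W\<in>{U, V}. T \<subseteq> W" if T: "connected T" "T \<noteq> {}" "T \<subseteq> S2 - C" for T
  proof -
    have "S2 - C \<noteq> {}" using T by auto
    then obtain W where "W \<in> components (S2 - C)" "T \<subseteq> W"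
      using exists_component_superset[of T "S2 - C"] T by auto
    then show ?thesis using UV by auto
  qed
  obtain Wu where Wu: "Wu \<in> {U, V}" "path_image u - {a, b} \<subseteq> Wu" using inW[OF con(1) ne(1) uC(1)] by blast
  obtain Wd where Wd: "Wd \<in> {U, V}" "path_image d - {a, b} \<subseteq> Wd" using inW[OF con(2) ne(2) uC(2)] by blast
  have "Wu \<noteq> Wd"
  proof
    assume eq: "Wu = Wd"
    have a: "a \<in> E" "a \<in> C" using ab by auto
    have "crosses_at C E a" using arrangement_crosses[OF arr C E(1) E(2)[symmetric] a(2,1)] .
    then obtain x y where xy: "x \<in> E \<inter> ball a 1 - C" "y \<in> E \<inter> ball a 1 - C" "\<not> connected_component (S2 - C) x y"
      unfolding crosses_at_def using zero_less_one by meson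
    have "x \<in> Wu" "y \<in> Wu" using xy Wu Wd eq u(8) ab(1) by blast+
    moreover have "connected Wu" "Wu \<subseteq> S2 - C"
      using Wu(1) in_components_connected[of Wu "S2 - C"] in_components_subset[of Wu "S2 - C"] unfolding UV(1) by auto
    ultimately show False using xy(3) unfolding connected_component_def by blast
  qed
  have disj: "W \<inter> W' = {}" if "W \<in> {U, V}" "W' \<in> {U, V}" "W \<noteq> W'" for W W'
    using that components_nonoverlap[of W "S2 - C" W'] unfolding UV(1) by auto
  have DC: "D \<inter> C = {}" using D in_components_subset[of D "S2 - C"] unfolding UV(1) by auto
  have img: "path_image c = E \<inter> (D \<union> C)"
    if "path_image c - {a, b} \<subseteq> D" "(path_image c' - {a, b}) \<inter> D = {}" "path_image c \<union> path_image c' = E"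
      "{a, b} \<subseteq> path_image c" for c c' :: "real \<Rightarrow> real^3"
  proof
    have "{a, b} \<subseteq> C" using ab(1) by blast
    then show "path_image c \<subseteq> E \<inter> (D \<union> C)" using that(1,3) by blast
    show "E \<inter> (D \<union> C) \<subseteq> path_image c"
    proof
      fix x assume x: "x \<in> E \<inter> (D \<union> C)"
      show "x \<in> path_image c"
      proof (cases "x \<in> {a, b}")
        case False
        then have "x \<notin> C" using x ab(1) by blast
        then have "x \<notin> path_image c'" using x that(2) False by blast
        then show ?thesis using x that(3) by blast
      qed (use that(4) in blast)
    qed
  qed
  have ends: "{a, b} \<subseteq> path_image u" "{a, b} \<subseteq> path_image d" using u(7) by blast+
  consider "Wu = D" | "Wd = D" using Wu Wd D \<open>Wu \<noteq> Wd\<close> by auto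
  then show ?thesis
  proof cases
    case 1
    have "Wd \<inter> D = {}" using disj[OF Wd(1) D] 1 \<open>Wu \<noteq> Wd\<close> by auto
    then have "(path_image d - {a, b}) \<inter> D = {}"
      using Wd(2) by blast
    then have "path_image u = E \<inter> (D \<union> C)" using img[of u d] Wu(2) 1 u(8) ends by auto
    moreover have "u 0 = a" "u 1 = b" using u(3,4) by (auto simp: pathstart_def pathfinish_def)
    ultimately have "splits C D E u d" unfolding splits_def using u ab by auto
    then show ?thesis by blast
  next
    case 2
    have "Wu \<inter> D = {}" using disj[OF Wu(1) D] 2 \<open>Wu \<noteq> Wd\<close> by auto
    then have "(path_image u - {a, b}) \<inter> D = {}" using Wu(2) by blast
    then have "path_image d = E \<inter> (D \<union> C)" using img[of d u] Wd(2) 2 u(8) ends by auto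
    moreover have "d 0 = b" "d 1 = a" using u(5,6) by (auto simp: pathstart_def pathfinish_def)
    ultimately have "splits C D E d u" unfolding splits_def using u ab by auto
    then show ?thesis by blast
  qed
qed

lemma circle_two_triangles:
  assumes arr: "simple_pi_arrangement A" and n: "card A \<ge> 3" and C: "C \<in> A"
  shows "\<exists>T\<in>triangles A. \<exists>T'\<in>triangles A. T \<noteq> T' \<and>
    2 \<le> card (closure T \<inter> crossings A \<inter> C) \<and> 2 \<le> card (closure T' \<inter> crossings A \<inter> C)"
proof -
  have more: "\<exists>F\<in>A. F \<noteq> E \<and> F \<noteq> E'" for E E'
  proof (rule ccontr)
    assume "\<not> ?thesis"
    then have "A \<subseteq> {E, E'}" by auto
    then have "card A \<le> card {E, E'}" by (rule card_mono[rotated]) simp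
    also have "\<dots> \<le> 2" by (simp add: card_insert_if)
    finally show False using n by simp
  qed
  obtain F0 where F0: "F0 \<in> A" "F0 \<noteq> C" using more[of C C] by blast
  have pC: "C \<subseteq> S2" using arrangement_pseudocircle[OF arr C] by (simp add: pseudocircle_def)
  obtain g where g: "simple_path g" "pathfinish g = pathstart g" "path_image g = C"
    using arrangement_pseudocircle[OF arr C] unfolding pseudocircle_def by blast
  obtain U V where UV: "components (S2 - C) = {U, V}" "U \<noteq> V"
    using jordan_two_components[OF g pC arrangement_ne_sphere[OF arr C F0(1) F0(2)[symmetric]]] by blast
  have cover: "S2 - C = U \<union> V" using Union_components[of "S2 - C"] UV by auto
  have hit: "E \<inter> F \<inter> (U \<union> V) \<noteq> {}" if "E \<in> A - {C}" "F \<in> A - {C}" "E \<noteq> F" for E F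
  proof -
    have "card (E \<inter> F) = 2" using arrangement_card_2[OF arr] that by auto
    then have "E \<inter> F \<noteq> {}" by auto
    then obtain p where p: "p \<in> E" "p \<in> F" by blast
    have "p \<notin> C" using arrangement_no_triple[OF arr _ _ C p] that by auto
    moreover have "E \<subseteq> S2" using arrangement_pseudocircle[OF arr, of E] that by (simp add: pseudocircle_def)
    ultimately show ?thesis unfolding cover[symmetric] using p by blast
  qed
  \<comment> \<open>If both sides failed, some \<open>E1\<close> would meet no other pseudocircle in
    \<open>U\<close>, and some \<open>E2\<close> none in \<open>V\<close>. Two distinct ones would
    not meet off \<open>C\<close>; a single one would miss a third pseudocircle, which exists since
    there are at least three.\<close>
  have "\<exists>D\<in>{U, V}. \<forall>E\<in>A - {C}. \<exists>F\<in>A. F \<noteq> E \<and> E \<inter> F \<inter> D \<noteq> {}"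
  proof (rule ccontr)
    assume no: "\<not> ?thesis"
    then have "\<not> (\<forall>E\<in>A - {C}. \<exists>F\<in>A. F \<noteq> E \<and> E \<inter> F \<inter> U \<noteq> {})" by simp
    then obtain E1 where E1: "E1 \<in> A - {C}" "\<not> (\<exists>F\<in>A. F \<noteq> E1 \<and> E1 \<inter> F \<inter> U \<noteq> {})" by blast
    have "\<not> (\<forall>E\<in>A - {C}. \<exists>F\<in>A. F \<noteq> E \<and> E \<inter> F \<inter> V \<noteq> {})" using no by simp
    then obtain E2 where E2: "E2 \<in> A - {C}" "\<not> (\<exists>F\<in>A. F \<noteq> E2 \<and> E2 \<inter> F \<inter> V \<noteq> {})" by blast
    have E: "E1 \<in> A - {C}" "\<And>F. F \<in> A \<Longrightarrow> F \<noteq> E1 \<Longrightarrow> E1 \<inter> F \<inter> U = {}"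
        "E2 \<in> A - {C}" "\<And>F. F \<in> A \<Longrightarrow> F \<noteq> E2 \<Longrightarrow> E2 \<inter> F \<inter> V = {}"
      using E1 E2 by metis+
    show False
    proof (cases "E1 = E2")
      case True
      obtain F where F: "F \<in> A" "F \<noteq> C" "F \<noteq> E1" using more[of C E1] by blast
      have "E1 \<inter> F \<inter> (U \<union> V) = {}"
        using E(2)[OF F(1,3)] E(4)[of F] F True by (simp add: Int_Un_distrib)
      then show False using hit[OF E(1), of F] F by auto
    next
      case False
      have "E1 \<inter> E2 \<inter> U = {}" using E(2)[of E2] E(3) False by auto
      moreover have "E1 \<inter> E2 \<inter> V = {}" using E(4)[of E1] E(1) False by (simp add: Int_commute)
      ultimately have "E1 \<inter> E2 \<inter> (U \<union> V) = {}" by (simp add: Int_Un_distrib)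
      then show False using hit[OF E(1,3) False] by simp
    qed
  qed
  then obtain D where D: "D \<in> {U, V}" and cr: "\<forall>E\<in>A - {C}. \<exists>F\<in>A. F \<noteq> E \<and> E \<inter> F \<inter> D \<noteq> {}" by blast
  have "\<forall>E\<in>A - {C}. \<exists>ge. splits C D E (fst ge) (snd ge)"
    using side_arcs[OF arr C _ _ UV D] by simp
  then obtain ge where ge: "\<forall>E\<in>A - {C}. splits C D E (fst (ge E)) (snd (ge E))"
    by (rule bchoice[THEN exE])
  interpret arrangement_side A C D "\<lambda>E. fst (ge E)" "\<lambda>E. snd (ge E)" g
  proof
    show "D \<in> components (S2 - C)" using D UV by auto
    fix E assume E: "E \<in> A - {C}"
    note geE = ge[rule_format, OF E, unfolded splits_def]
    show "E \<inter> C = {fst (ge E) 0, fst (ge E) 1}"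
      "path_image (fst (ge E)) \<inter> path_image (snd (ge E)) = {fst (ge E) 0, fst (ge E) 1}"
      using geE by metis+
  qed (use arr C g ge[unfolded splits_def] cr in metis)+
  have "fst (ge F0) 0 \<in> X" using gam_ends(1)[of F0] F0 by auto
  then show ?thesis using two_triangles by blast
qed

theorem theorem4:
  fixes A :: "(real^3) set set"
  assumes "simple_pi_arrangement A"
    and "card A \<ge> 3"
  shows "real (card (triangles A)) \<ge> 2 * real (card A) / 3"
proof -
  note arr = assms(1)
  have fA: "finite A" by (rule arrangement_finite[OF arr])
  have fT: "finite (triangles A)" using cells_finite[OF arr] assms(2) by (simp add: triangles_def)
  define K where "K T = closure T \<inter> crossings A" for T
  have K3: "card (K T) = 3" "finite (K T)" if "T \<in> triangles A" for T
    using that by (auto simp: triangles_def K_def intro: card_ge_0_finite)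
  have low: "2 \<le> card {T \<in> triangles A. 2 \<le> card (K T \<inter> C)}" if C: "C \<in> A" for C
  proof -
    obtain T T' where T: "T \<in> triangles A" "T' \<in> triangles A" "T \<noteq> T'" "2 \<le> card (K T \<inter> C)" "2 \<le> card (K T' \<inter> C)"
      using circle_two_triangles[OF arr assms(2) C] by (auto simp: K_def)
    have "card {T, T'} \<le> card {T \<in> triangles A. 2 \<le> card (K T \<inter> C)}"
      by (rule card_mono) (use fT T in auto)
    then show ?thesis using T(3) by simp
  qed
  have up: "card {C \<in> A. 2 \<le> card (K T \<inter> C)} \<le> 3" if T: "T \<in> triangles A" for T
  proof -
    have inc: "card {C \<in> A. p \<in> C} \<le> 2" if p: "p \<in> K T" for p
    proof -
      obtain E F where EF: "E \<in> A" "F \<in> A" "E \<noteq> F" "p \<in> E" "p \<in> F"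
        using p by (auto simp: K_def crossings_iff)
      have "{C \<in> A. p \<in> C} \<subseteq> {E, F}"
        using arrangement_no_triple[OF arr EF(1,2) _ EF(4,5)] EF(3) by auto
      then have "card {C \<in> A. p \<in> C} \<le> card {E, F}" by (rule card_mono[rotated]) simp
      then show ?thesis using EF(3) by simp
    qed
    have "2 * card {C \<in> A. 2 \<le> card (K T \<inter> C)} = (\<Sum>C\<in>{C \<in> A. 2 \<le> card (K T \<inter> C)}. 2)" by simp
    also have "\<dots> \<le> (\<Sum>C\<in>{C \<in> A. 2 \<le> card (K T \<inter> C)}. card (K T \<inter> C))" by (rule sum_mono) auto
    also have "\<dots> \<le> (\<Sum>C\<in>A. card (K T \<inter> C))" by (rule sum_mono2) (use fA in auto)
    also have "\<dots> = (\<Sum>C\<in>A. \<Sum>p\<in>K T. if p \<in> C then 1 else 0)"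
      using K3(2)[OF T] by (intro sum.cong refl) (simp add: sum.If_cases)
    also have "\<dots> = (\<Sum>p\<in>K T. \<Sum>C\<in>A. if p \<in> C then 1 else 0)" by (rule sum.swap)
    also have "\<dots> = (\<Sum>p\<in>K T. card {C \<in> A. p \<in> C})"
      using fA by (intro sum.cong refl) (simp add: sum.If_cases Int_def)
    also have "\<dots> \<le> (\<Sum>p\<in>K T. 2)" by (rule sum_mono) (rule inc)
    also have "\<dots> = 6" using K3(1)[OF T] by simp
    finally show ?thesis by simp
  qed
  have "2 * card A = (\<Sum>C\<in>A. 2)" by simp
  also have "\<dots> \<le> (\<Sum>C\<in>A. card {T \<in> triangles A. 2 \<le> card (K T \<inter> C)})" by (rule sum_mono) (rule low)
  also have "\<dots> = (\<Sum>T\<in>triangles A. card {C \<in> A. 2 \<le> card (K T \<inter> C)})"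
    using sum_multicount_gen[OF fA fT, of "\<lambda>C T. 2 \<le> card (K T \<inter> C)" "\<lambda>T. card {C \<in> A. 2 \<le> card (K T \<inter> C)}"] by simp
  also have "\<dots> \<le> (\<Sum>T\<in>triangles A. 3)" by (rule sum_mono) (rule up)
  finally have "2 * card A \<le> 3 * card (triangles A)" by simp
  then have "real (2 * card A) \<le> real (3 * card (triangles A))" by (rule of_nat_mono)
  then show ?thesis by simp
qed

end
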